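(* Let $\pi$ and $\pi'$ be smooth representations of $G=\mathrm{GL}_2(F)$ with $\pi$ supersingular. Then every $P$-equivariant linear map $\pi\to\pi'$ is $G$-equivariant, i.e. $\mathrm{Hom}_P(\pi,\pi')=\mathrm{Hom}_G(\pi,\pi')$.
   Context: $F$ non-Archimedean local field of residual characteristic $p$. $P$ the upper triangular Borel subgroup of $G$, $T$ the diagonal torus. Representations are smooth on $\overline{\mathbf F}_p$-vector spaces. For a smooth character $\chi$ of $T$ viewed as a character of $P$, $\mathrm{Ind}_P^G\chi$ is the smooth induction. A supersingular representation is an irreducible smooth representation of $G$ admitting a central character which is not isomorphic to a subquotient of $\mathrm{Ind}_P^G\chi$ for any smooth character $\chi$ of $T$. *)

theory Defs
  imports Complex_Main "HOL-Library.Function_Algebras" "HOL-Computational_Algebra.Polynomial"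
begin

text \<open>A valuation is a function val :: 'f => int; its value at 0 is irrelevant
  (0 is treated as having valuation +infinity through the predicate close).\<close>

definition close :: "('f::field \<Rightarrow> int) \<Rightarrow> int \<Rightarrow> 'f \<Rightarrow> 'f \<Rightarrow> bool" where
  "close val n x y \<longleftrightarrow> x = y \<or> val (x - y) \<ge> n"

definition integral :: "('f::field \<Rightarrow> int) \<Rightarrow> 'f \<Rightarrow> bool" where
  "integral val x \<longleftrightarrow> x = 0 \<or> val x \<ge> 0"

definition nonarch_local_field :: "('f::field \<Rightarrow> int) \<Rightarrow> nat \<Rightarrow> bool" where
  "nonarch_local_field val p \<longleftrightarrow>
     (\<forall>x y. x \<noteq> 0 \<longrightarrow> y \<noteq> 0 \<longrightarrow> val (x * y) = val x + val y) \<and>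
     (\<forall>x y. x \<noteq> 0 \<longrightarrow> y \<noteq> 0 \<longrightarrow> x + y \<noteq> 0 \<longrightarrow> val (x + y) \<ge> min (val x) (val y)) \<and>
     (\<forall>n. \<exists>x. x \<noteq> 0 \<and> val x = n) \<and>
     (\<forall>s :: nat \<Rightarrow> 'f.
        (\<forall>n. \<exists>N. \<forall>i\<ge>N. \<forall>j\<ge>N. close val n (s i) (s j)) \<longrightarrow>
        (\<exists>L. \<forall>n. \<exists>N. \<forall>i\<ge>N. close val n (s i) L)) \<and>
     finite ((\<lambda>x. {y. integral val y \<and> close val 1 x y}) ` {x. integral val x}) \<and>
     prime p \<and> close val 1 (of_nat p) 0"

type_synonym 'f mat2 = "'f \<times> 'f \<times> 'f \<times> 'f"  \<comment> \<open>(a,b,c,d) is the matrix [[a,b],[c,d]]\<close>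

fun mmul :: "'f::field mat2 \<Rightarrow> 'f mat2 \<Rightarrow> 'f mat2" where
  "mmul (a, b, c, d) (a', b', c', d') =
     (a * a' + b * c', a * b' + b * d', c * a' + d * c', c * b' + d * d')"

fun mdet :: "'f::field mat2 \<Rightarrow> 'f" where
  "mdet (a, b, c, d) = a * d - b * c"

definition one2 :: "'f::field mat2" where
  "one2 = (1, 0, 0, 1)"

definition GL2 :: "'f::field mat2 set" where
  "GL2 = {g. mdet g \<noteq> 0}"

definition Borel :: "'f::field mat2 set" where
  "Borel = {(a, b, c, d). c = 0 \<and> a \<noteq> 0 \<and> d \<noteq> 0}"

text \<open>Principal congruence subgroups K_n = 1 + p_F^n M_2(O_F), n >= 1: a basis of
  open neighbourhoods of the identity in GL_2(F).\<close>
definition Kcong :: "('f::field \<Rightarrow> int) \<Rightarrow> int \<Rightarrow> 'f mat2 set" where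
  "Kcong val n = {(a, b, c, d). close val n a 1 \<and> close val n b 0 \<and> close val n c 0
                    \<and> close val n d 1} \<inter> GL2"

definition alg_closure_Fp :: "nat \<Rightarrow> 'k::field itself \<Rightarrow> bool" where
  "alg_closure_Fp p _ \<longleftrightarrow>
     prime p \<and> of_nat p = (0::'k) \<and>
     (\<forall>q :: 'k poly. degree q \<ge> 1 \<longrightarrow> (\<exists>x. poly q x = 0)) \<and>
     (\<forall>x :: 'k. \<exists>q :: 'k poly. q \<noteq> 0 \<and> (\<forall>i. coeff q i \<in> range of_nat) \<and> poly q x = 0)"

text \<open>A representation is given by a scalar multiplication sc on an ambient type,
  a carrier subspace V, and an action act (only its values on GL_2(F) and V matter).\<close>

definition lin_on :: "('k::field \<Rightarrow> 'v::ab_group_add \<Rightarrow> 'v) \<Rightarrow> 'v set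
     \<Rightarrow> ('k \<Rightarrow> 'w::ab_group_add \<Rightarrow> 'w) \<Rightarrow> ('v \<Rightarrow> 'w) \<Rightarrow> bool" where
  "lin_on sc V sc' f \<longleftrightarrow>
     (\<forall>u\<in>V. \<forall>w\<in>V. f (u + w) = f u + f w) \<and> (\<forall>c. \<forall>u\<in>V. f (sc c u) = sc' c (f u))"

definition stable :: "'f::field mat2 set \<Rightarrow> ('f mat2 \<Rightarrow> 'v \<Rightarrow> 'v) \<Rightarrow> 'v set \<Rightarrow> bool" where
  "stable H act W \<longleftrightarrow> (\<forall>g\<in>H. \<forall>v\<in>W. act g v \<in> W)"

definition smooth_rep :: "('f::field \<Rightarrow> int) \<Rightarrow> ('k::field \<Rightarrow> 'v::ab_group_add \<Rightarrow> 'v)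
     \<Rightarrow> 'v set \<Rightarrow> ('f mat2 \<Rightarrow> 'v \<Rightarrow> 'v) \<Rightarrow> bool" where
  "smooth_rep val sc V act \<longleftrightarrow>
     vector_space sc \<and> module.subspace sc V \<and>
     stable GL2 act V \<and>
     (\<forall>g\<in>GL2. lin_on sc V sc (act g)) \<and>
     (\<forall>v\<in>V. act one2 v = v) \<and>
     (\<forall>g\<in>GL2. \<forall>h\<in>GL2. \<forall>v\<in>V. act (mmul g h) v = act g (act h v)) \<and>
     (\<forall>v\<in>V. \<exists>n\<ge>1. \<forall>g\<in>Kcong val n. act g v = v)"

definition equivariant_on :: "'f::field mat2 set \<Rightarrow> 'v set \<Rightarrow> ('f mat2 \<Rightarrow> 'v \<Rightarrow> 'v)
     \<Rightarrow> ('f mat2 \<Rightarrow> 'w \<Rightarrow> 'w) \<Rightarrow> ('v \<Rightarrow> 'w) \<Rightarrow> bool" where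
  "equivariant_on H V act act' f \<longleftrightarrow> (\<forall>g\<in>H. \<forall>v\<in>V. f (act g v) = act' g (f v))"

definition Hom :: "'f::field mat2 set \<Rightarrow> ('k::field \<Rightarrow> 'v::ab_group_add \<Rightarrow> 'v) \<Rightarrow> 'v set
     \<Rightarrow> ('f mat2 \<Rightarrow> 'v \<Rightarrow> 'v) \<Rightarrow> ('k \<Rightarrow> 'w::ab_group_add \<Rightarrow> 'w) \<Rightarrow> 'w set
     \<Rightarrow> ('f mat2 \<Rightarrow> 'w \<Rightarrow> 'w) \<Rightarrow> ('v \<Rightarrow> 'w) set" where
  "Hom H sc V act sc' V' act' =
     {f. lin_on sc V sc' f \<and> f ` V \<subseteq> V' \<and> equivariant_on H V act act' f}"

definition irreducible_rep :: "('k::field \<Rightarrow> 'v::ab_group_add \<Rightarrow> 'v) \<Rightarrow> 'v set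
     \<Rightarrow> ('f::field mat2 \<Rightarrow> 'v \<Rightarrow> 'v) \<Rightarrow> bool" where
  "irreducible_rep sc V act \<longleftrightarrow>
     V \<noteq> {0} \<and>
     (\<forall>W. module.subspace sc W \<and> W \<subseteq> V \<and> stable GL2 act W \<longrightarrow> W = {0} \<or> W = V)"

definition has_central_char :: "('k::field \<Rightarrow> 'v::ab_group_add \<Rightarrow> 'v) \<Rightarrow> 'v set
     \<Rightarrow> ('f::field mat2 \<Rightarrow> 'v \<Rightarrow> 'v) \<Rightarrow> bool" where
  "has_central_char sc V act \<longleftrightarrow>
     (\<exists>\<omega> :: 'f \<Rightarrow> 'k. \<forall>z. z \<noteq> 0 \<longrightarrow> (\<forall>v\<in>V. act (z, 0, 0, z) v = sc (\<omega> z) v))"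

text \<open>A character of T is given by chi a d = chi(diag(a,d)).\<close>
definition smooth_char_T :: "('f::field \<Rightarrow> int) \<Rightarrow> ('f \<Rightarrow> 'f \<Rightarrow> 'k::field) \<Rightarrow> bool" where
  "smooth_char_T val \<chi> \<longleftrightarrow>
     (\<forall>a d. a \<noteq> 0 \<longrightarrow> d \<noteq> 0 \<longrightarrow> \<chi> a d \<noteq> 0) \<and>
     (\<forall>a d a' d'. a \<noteq> 0 \<longrightarrow> d \<noteq> 0 \<longrightarrow> a' \<noteq> 0 \<longrightarrow> d' \<noteq> 0 \<longrightarrow>
        \<chi> (a * a') (d * d') = \<chi> a d * \<chi> a' d') \<and>
     (\<exists>n\<ge>1. \<forall>a d. close val n a 1 \<longrightarrow> close val n d 1 \<longrightarrow> \<chi> a d = 1)"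

fun charP :: "('f \<Rightarrow> 'f \<Rightarrow> 'k) \<Rightarrow> 'f mat2 \<Rightarrow> 'k" where
  "charP \<chi> (a, b, c, d) = \<chi> a d"

definition ind_space :: "('f::field \<Rightarrow> int) \<Rightarrow> ('f \<Rightarrow> 'f \<Rightarrow> 'k::field) \<Rightarrow> ('f mat2 \<Rightarrow> 'k) set" where
  "ind_space val \<chi> =
     {f. (\<forall>g. g \<notin> GL2 \<longrightarrow> f g = 0) \<and>
         (\<forall>b\<in>Borel. \<forall>g\<in>GL2. f (mmul b g) = charP \<chi> b * f g) \<and>
         (\<exists>n\<ge>1. \<forall>k\<in>Kcong val n. \<forall>g\<in>GL2. f (mmul g k) = f g)}"

definition ind_scale :: "'k::field \<Rightarrow> ('f mat2 \<Rightarrow> 'k) \<Rightarrow> ('f mat2 \<Rightarrow> 'k)" where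
  "ind_scale c f = (\<lambda>g. c * f g)"

definition ind_act :: "'f::field mat2 \<Rightarrow> ('f mat2 \<Rightarrow> 'k::field) \<Rightarrow> ('f mat2 \<Rightarrow> 'k)" where
  "ind_act g f = (\<lambda>h. if h \<in> GL2 then f (mmul h g) else 0)"

text \<open>pi is isomorphic to a subquotient W1/W2 of Ind_P^G chi (W2 \<subseteq> W1 subrepresentations)
  iff there is a subrepresentation W1 and a surjective G-equivariant linear map W1 \<rightarrow> pi
  (its kernel being W2).\<close>
definition subquotient_of_ind :: "('f::field \<Rightarrow> int) \<Rightarrow> ('f \<Rightarrow> 'f \<Rightarrow> 'k::field)
     \<Rightarrow> ('k \<Rightarrow> 'v::ab_group_add \<Rightarrow> 'v) \<Rightarrow> 'v set \<Rightarrow> ('f mat2 \<Rightarrow> 'v \<Rightarrow> 'v) \<Rightarrow> bool" where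
  "subquotient_of_ind val \<chi> sc V act \<longleftrightarrow>
     (\<exists>W1. module.subspace ind_scale W1 \<and> W1 \<subseteq> ind_space val \<chi> \<and> stable GL2 ind_act W1 \<and>
        (\<exists>\<phi>. lin_on ind_scale W1 sc \<phi> \<and> \<phi> ` W1 = V \<and> equivariant_on GL2 W1 ind_act act \<phi>))"

definition supersingular :: "('f::field \<Rightarrow> int) \<Rightarrow> ('k::field \<Rightarrow> 'v::ab_group_add \<Rightarrow> 'v)
     \<Rightarrow> 'v set \<Rightarrow> ('f mat2 \<Rightarrow> 'v \<Rightarrow> 'v) \<Rightarrow> bool" where
  "supersingular val sc V act \<longleftrightarrow>
     smooth_rep val sc V act \<and> irreducible_rep sc V act \<and> has_central_char sc V act \<and>
     \<not> (\<exists>\<chi> :: 'f \<Rightarrow> 'f \<Rightarrow> 'k. smooth_char_T val \<chi> \<and> subquotient_of_ind val \<chi> sc V act)"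

end

(* Write s for the Weyl element, w for the uniformizer, Pi = (0,1;w,0), I for the Iwahori subgroup, I1 for its
   pro-p radical and, on I1-invariants, S x = sum_l u(l) s x and U = S Pi, with l running over the residue field.

   Suppose x is an I1-invariant torus eigenvector of pi with U x = 0 and S x a multiple of x.  Since
   s u(m) s = u(1/m) s diag(m,-1/m) u(1/m), the equation S y = 0 expresses y as a combination of the vectors
   u(b) s y.  Hence Pi x is a combination of u(b) diag(w,1) x, and x a combination of u(b) diag(w,1) Pi x up to
   the centre.  These are relations in P, so a P-equivariant map phi preserves them; each use of them enlarges the
   lower unipotent group fixing phi(x), which is therefore I1-invariant, and the first relation then gives
   phi(Pi x) = Pi phi(x).  As G = P I u P Pi I, phi commutes with G on x, hence on pi.

   If U x = lam x with lam nonzero, the translates of x satisfy the relations of the translates of the function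
   on P\G supported on P s I, so pi is a quotient of a principal series, contrary to supersingularity.

   It remains to find a polynomial in U killing a suitable S x'.  By irreducibility x = S x' is a combination of
   translates of U x - x.  Read in the compact induction of the character of I Z on x', this is a nonzero element
   of the kernel of the map to pi; the kernel is smooth in characteristic p, so it contains a nonzero I1-invariant
   element, i.e. a Hecke operator, which has the form C(U) S + Pi D(U) S.  Applying S and U turns
   C(U) x + Pi D(U) x = 0 into two polynomials in U killing x, not both zero. *)

theory Submission
  imports Defs "HOL-Library.Product_Plus"
begin

text \<open>No quotient or Hom space is formed. A homomorphism out of a compact induction or a
  principal series is handled as its graph: the subrepresentation of \<open>Fun\<close> \<times> V
  generated by a pair, where \<open>Fun\<close> is the space of smooth functions on G. The graph is
  single valued as soon as it contains no (0, w) with w nonzero.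

  The delicate point is that the relation between translates of x must be nontrivial. Let delta
  generate the compact induction and put f = S delta. If f were itself in the span of the translates
  of U f - f, expressing x by U x - x would say nothing. A principal series with U-eigenvalue 1
  excludes this: it contains a nonzero image of f fixed by U. Supersingularity forbids the same
  eigenvalue in pi, so there U x - x is nonzero and generates.

  Hecke words in which S is not applied first are eliminated by a second test map, delta to S
  delta^s - e delta. It kills f, while those words stay independent on its image.

  Characteristic p enters twice: p-th roots of unity are trivial, so pro-p groups fix vectors, and
  the number of residues is zero, so S S is a multiple of S.\<close>

subsection \<open>Linear algebra\<close>

text \<open>The index set consists of translates: a linear relation between translates of a function is passed on to
  the corresponding translates of a vector.\<close>

lemma sum_zero_class_split:
  fixes F :: "'i \<Rightarrow> 'x \<Rightarrow> 'k::field" and w :: "'i \<Rightarrow> 'v::ab_group_add"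
  assumes vs: "vector_space sc" and fin: "finite A"
    and sep: "\<And>i. i \<in> A \<Longrightarrow> \<exists>z. F i z \<noteq> 0 \<and> (\<forall>j\<in>A. F j z = 0 \<or> (\<exists>c. (\<forall>h. F j h = c * F i h) \<and> w j = sc c (w i)))"
    and zero: "\<And>h. (\<Sum>i\<in>A. c i * F i h) = 0"
  shows "(\<Sum>i\<in>A. sc (c i) (w i)) = 0"
  using fin sep zero
proof (induction "card A" arbitrary: A rule: less_induct)
  case less
  interpret vector_space sc by (rule vs)
  show ?case
  proof (cases "A = {}")
    case False
    then obtain i where i: "i \<in> A" by auto
    obtain z where z: "F i z \<noteq> 0"
      and zj: "\<forall>j\<in>A. F j z = 0 \<or> (\<exists>c. (\<forall>h. F j h = c * F i h) \<and> w j = sc c (w i))"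
      using less.prems(2)[OF i] by blast
    \<comment> \<open>The functions that do not vanish at z are all multiples of \<open>F i\<close>.
      Evaluation at z shows that the coefficients of this class cancel, so it drops out of both
      relations and induction applies to the rest.\<close>
    define B where "B = {j\<in>A. F j z \<noteq> 0}"
    have "\<forall>j\<in>B. \<exists>r. (\<forall>h. F j h = r * F i h) \<and> w j = sc r (w i)"
      using zj by (auto simp: B_def)
    then obtain r where r: "\<And>j h. j \<in> B \<Longrightarrow> F j h = r j * F i h" "\<And>j. j \<in> B \<Longrightarrow> w j = sc (r j) (w i)"
      by metis
    have fB: "finite B" "B \<subseteq> A" using less.prems(1) by (auto simp: B_def)
    have "(\<Sum>j\<in>A. c j * F j z) = (\<Sum>j\<in>B. c j * F j z)"
      using less.prems(1) by (intro sum.mono_neutral_right) (auto simp: B_def)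
    also have "\<dots> = (\<Sum>j\<in>B. c j * r j) * F i z"
      unfolding sum_distrib_right using r(1) by (intro sum.cong) auto
    finally have s0: "(\<Sum>j\<in>B. c j * r j) = 0" using less.prems(3) z by simp
    have wB: "(\<Sum>j\<in>B. sc (c j) (w j)) = 0"
    proof -
      have "(\<Sum>j\<in>B. sc (c j) (w j)) = (\<Sum>j\<in>B. sc (c j * r j) (w i))"
        using r(2) by (intro sum.cong) auto
      also have "\<dots> = sc (\<Sum>j\<in>B. c j * r j) (w i)" by (simp add: scale_sum_left)
      finally show ?thesis using s0 by simp
    qed
    have FB: "(\<Sum>j\<in>B. c j * F j h) = 0" for h
    proof -
      have "(\<Sum>j\<in>B. c j * F j h) = (\<Sum>j\<in>B. c j * r j) * F i h"
        unfolding sum_distrib_right using r(1) by (intro sum.cong) auto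
      then show ?thesis using s0 by simp
    qed
    have split: "(\<Sum>j\<in>A. g j) = (\<Sum>j\<in>A - B. g j) + (\<Sum>j\<in>B. g j)" for g :: "'i \<Rightarrow> 'z::comm_monoid_add"
      using sum.subset_diff[OF fB(2) less.prems(1)] by blast
    have "i \<in> B" using i z by (simp add: B_def)
    then have "card (A - B) < card A" using i less.prems(1) by (intro psubset_card_mono) auto
    moreover have "(\<Sum>j\<in>A - B. c j * F j h) = 0" for h
      using less.prems(3)[of h] FB[of h] split[of "\<lambda>j. c j * F j h"] by simp
    ultimately have "(\<Sum>j\<in>A - B. sc (c j) (w j)) = 0"
      using less.prems(1,2) by (intro less.hyps) (auto, meson DiffD1)
    then show ?thesis using split[of "\<lambda>j. sc (c j) (w j)"] wB by simp
  qed simp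
qed

section \<open>Polynomials in a linear operator and eigenvectors\<close>

definition lin_op :: "('k::field \<Rightarrow> 'v::ab_group_add \<Rightarrow> 'v) \<Rightarrow> 'v set \<Rightarrow> ('v \<Rightarrow> 'v) \<Rightarrow> bool" where
  "lin_op sc W f \<longleftrightarrow> vector_space sc \<and> module.subspace sc W \<and> f ` W \<subseteq> W \<and> lin_on sc W sc f"

definition poly_op :: "('k::field \<Rightarrow> 'v::ab_group_add \<Rightarrow> 'v) \<Rightarrow> ('v \<Rightarrow> 'v) \<Rightarrow> 'k poly \<Rightarrow> 'v \<Rightarrow> 'v" where
  "poly_op sc f q w = (\<Sum>i\<le>degree q. sc (coeff q i) ((f ^^ i) w))"

locale linear_operator =
  fixes sc :: "'k::field \<Rightarrow> 'v::ab_group_add \<Rightarrow> 'v" and W :: "'v set" and f :: "'v \<Rightarrow> 'v"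
  assumes lin_op: "lin_op sc W f"
begin

sublocale vector_space sc using lin_op by (simp add: lin_op_def)

lemma sub: "subspace W" and closed: "w \<in> W \<Longrightarrow> f w \<in> W"
  and f_add: "u \<in> W \<Longrightarrow> w \<in> W \<Longrightarrow> f (u + w) = f u + f w"
  and f_scale: "w \<in> W \<Longrightarrow> f (sc c w) = sc c (f w)"
  using lin_op by (auto simp: lin_op_def lin_on_def)

lemma f_zero: "f 0 = 0"
  using f_scale[OF subspace_0[OF sub], of 0] by simp

lemma f_sum: "(\<And>i. i \<in> A \<Longrightarrow> g i \<in> W) \<Longrightarrow> f (\<Sum>i\<in>A. g i) = (\<Sum>i\<in>A. f (g i))"
  by (induction A rule: infinite_finite_induct) (auto simp: f_zero f_add subspace_sum[OF sub])

lemma f_diff: "u \<in> W \<Longrightarrow> w \<in> W \<Longrightarrow> f (u - w) = f u - f w"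
  using f_add[of "u - w" w] subspace_diff[OF sub, of u w] by (simp add: algebra_simps)

lemma funpow_closed: "w \<in> W \<Longrightarrow> (f ^^ i) w \<in> W"
  by (induction i) (auto simp: closed)

lemma funpow_scale: "w \<in> W \<Longrightarrow> (f ^^ i) (sc c w) = sc c ((f ^^ i) w)"
  by (induction i) (auto simp: f_scale funpow_closed)

lemma funpow_add: "u \<in> W \<Longrightarrow> w \<in> W \<Longrightarrow> (f ^^ i) (u + w) = (f ^^ i) u + (f ^^ i) w"
  by (induction i) (auto simp: f_add funpow_closed)

lemma poly_op_closed: "w \<in> W \<Longrightarrow> poly_op sc f q w \<in> W"
  unfolding poly_op_def by (intro subspace_sum[OF sub] subspace_scale[OF sub] funpow_closed)

lemma poly_op_bound: "degree q \<le> n \<Longrightarrow> poly_op sc f q w = (\<Sum>i\<le>n. sc (coeff q i) ((f ^^ i) w))"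
  unfolding poly_op_def by (intro sum.mono_neutral_left) (auto simp: coeff_eq_0)

lemma poly_op_0: "poly_op sc f 0 w = 0"
  by (simp add: poly_op_def)

lemma poly_op_add: "poly_op sc f (q + r) w = poly_op sc f q w + poly_op sc f r w"
proof -
  let ?n = "max (degree q) (degree r)"
  have "poly_op sc f (q + r) w = (\<Sum>i\<le>?n. sc (coeff (q + r) i) ((f ^^ i) w))"
    by (rule poly_op_bound) (simp add: degree_add_le_max)
  also have "\<dots> = poly_op sc f q w + poly_op sc f r w"
    by (simp add: poly_op_bound[of q ?n] poly_op_bound[of r ?n] scale_left_distrib sum.distrib)
  finally show ?thesis .
qed

lemma poly_op_smult: "poly_op sc f (smult c q) w = sc c (poly_op sc f q w)"
  by (simp add: poly_op_bound[OF degree_smult_le] poly_op_def scale_sum_right)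

lemma poly_op_pCons:
  assumes "w \<in> W" shows "poly_op sc f (pCons a q) w = sc a w + f (poly_op sc f q w)"
proof -
  have "poly_op sc f (pCons a q) w = (\<Sum>i\<le>Suc (degree q). sc (coeff (pCons a q) i) ((f ^^ i) w))"
    by (rule poly_op_bound) (simp add: degree_pCons_le)
  also have "\<dots> = sc a w + (\<Sum>i\<le>degree q. sc (coeff q i) (f ((f ^^ i) w)))"
    by (subst sum.atMost_Suc_shift) simp
  also have "\<dots> = sc a w + f (poly_op sc f q w)"
    unfolding poly_op_def using assms
    by (subst f_sum) (auto simp: f_scale funpow_closed intro: subspace_scale[OF sub])
  finally show ?thesis .
qed

lemma poly_op_linear_mult:
  assumes "w \<in> W" shows "poly_op sc f ([:- a, 1:] * q) w = f (poly_op sc f q w) - sc a (poly_op sc f q w)"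
proof -
  have "[:- a, 1:] * q = pCons 0 q + smult (- a) q"
    by simp
  then show ?thesis by (simp only: poly_op_add poly_op_smult poly_op_pCons[OF assms]) simp
qed

lemma poly_op_monom: "poly_op sc f (monom c n) w = sc c ((f ^^ n) w)"
proof -
  have "poly_op sc f (monom c n) w = (\<Sum>i\<le>n. sc (coeff (monom c n) i) ((f ^^ i) w))"
    by (rule poly_op_bound) (simp add: degree_monom_le)
  also have "\<dots> = (\<Sum>i\<in>{n}. sc (coeff (monom c n) i) ((f ^^ i) w))"
    by (intro sum.mono_neutral_right) auto
  finally show ?thesis by simp
qed

text \<open>Split off roots of q one at a time until the cofactor r no longer kills w. Keeping the
  eigenvector in the form r(f) w lets \<open>good_vector_of_annihilating_poly\<close> exhibit it as
  a value of U.\<close>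

lemma eigenvector_of_annihilating_poly:
  assumes ac: "\<And>q :: 'k poly. degree q \<ge> 1 \<Longrightarrow> \<exists>x. poly q x = 0"
    and w: "w \<in> W" "w \<noteq> 0" and q: "q \<noteq> 0" "poly_op sc f q w = 0"
  shows "\<exists>r a. poly_op sc f r w \<noteq> 0 \<and> f (poly_op sc f r w) = sc a (poly_op sc f r w)"
  using q
proof (induction "degree q" arbitrary: q rule: less_induct)
  case less
  have "degree q \<noteq> 0"
  proof
    assume "degree q = 0"
    then obtain c where "q = [:c:]" by (rule degree_eq_zeroE)
    then show False using less.prems w by (simp add: poly_op_def)
  qed
  then obtain a where "poly q a = 0" using ac[of q] by auto
  then obtain r where r: "q = [:- a, 1:] * r" by (auto simp: poly_eq_0_iff_dvd elim: dvdE)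
  have r0: "r \<noteq> 0" using r less.prems by auto
  have rq: "degree r < degree q" unfolding r by (subst degree_mult_eq) (use r0 in auto)
  show ?case
  proof (cases "poly_op sc f r w = 0")
    case True
    then show ?thesis using less.hyps[OF rq r0] by blast
  next
    case False
    have "f (poly_op sc f r w) = sc a (poly_op sc f r w)"
      using less.prems(2) poly_op_linear_mult[OF w(1), of a r] r by simp
    then show ?thesis using False by blast
  qed
qed

text \<open>X^n - 1 annihilates w. It is nonzero in every characteristic, and repeated roots do no
  harm.\<close>

lemma eigenvector_of_finite_order:
  assumes ac: "\<And>q :: 'k poly. degree q \<ge> 1 \<Longrightarrow> \<exists>x. poly q x = 0"
    and w: "w \<in> W" "w \<noteq> 0" and n: "n \<ge> 1" "(f ^^ n) w = w"
  shows "\<exists>v a. v \<in> W \<and> v \<noteq> 0 \<and> f v = sc a v"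
proof -
  have "poly_op sc f (monom 1 n + monom (-1) 0) w = 0"
    unfolding poly_op_add poly_op_monom using n(2) by simp
  moreover have "coeff (monom 1 n + monom (-1 :: 'k) 0) n = 1" using n(1) by simp
  then have "monom 1 n + monom (-1 :: 'k) 0 \<noteq> 0" by (metis coeff_0 zero_neq_one)
  ultimately show ?thesis using eigenvector_of_annihilating_poly[OF ac w] poly_op_closed[OF w(1)] by blast
qed

end

text \<open>Induction on the number of operators: an eigenspace of one operator is stable under the
  others because they commute.\<close>

lemma common_eigenvector:
  fixes sc :: "'k::field \<Rightarrow> 'v::ab_group_add \<Rightarrow> 'v"
  assumes ac: "\<And>q :: 'k poly. degree q \<ge> 1 \<Longrightarrow> \<exists>x. poly q x = 0"
    and "finite A" and vs: "vector_space sc" and sub: "module.subspace sc W" "w \<in> W" "w \<noteq> 0"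
    and lin: "\<And>a. a \<in> A \<Longrightarrow> lin_op sc W (g a)"
    and comm: "\<And>a b w. a \<in> A \<Longrightarrow> b \<in> A \<Longrightarrow> w \<in> W \<Longrightarrow> g a (g b w) = g b (g a w)"
    and ord: "\<And>a. a \<in> A \<Longrightarrow> \<exists>n\<ge>1::nat. \<forall>w\<in>W. (g a ^^ n) w = w"
  shows "\<exists>v\<in>W. v \<noteq> 0 \<and> (\<forall>a\<in>A. \<exists>c. g a v = sc c v)"
  using \<open>finite A\<close> sub lin comm ord
proof (induction A arbitrary: W w rule: finite_induct)
  case empty
  then show ?case by auto
next
  case (insert a A)
  interpret vector_space sc by (rule vs)
  interpret a: linear_operator sc W "g a" by unfold_locales (use insert.prems in auto)
  obtain n :: nat where n: "n \<ge> 1" "\<forall>w\<in>W. (g a ^^ n) w = w" using insert.prems(6)[of a] by auto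
  obtain v c where v: "v \<in> W" "v \<noteq> 0" "g a v = sc c v"
    using a.eigenvector_of_finite_order[OF ac insert.prems(2,3) n(1)] n(2) insert.prems(2) by blast
  define W' where "W' = {w\<in>W. g a w = sc c w}"
  have W'sub: "subspace W'"
    unfolding W'_def using insert.prems(1)
    by (intro subspaceI) (auto simp: subspace_0 subspace_add subspace_scale a.f_zero a.f_add a.f_scale
        scale_right_distrib mult.commute)
  have "\<exists>v\<in>W'. v \<noteq> 0 \<and> (\<forall>a\<in>A. \<exists>c. g a v = sc c v)"
  proof (rule insert.IH[OF W'sub _ v(2)])
    show "v \<in> W'" using v by (simp add: W'_def)
    show "lin_op sc W' (g b)" if "b \<in> A" for b
    proof -
      interpret b: linear_operator sc W "g b" by unfold_locales (use insert.prems that in auto)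
      have "g a (g b w) = sc c (g b w)" if "w \<in> W" "g a w = sc c w" for w
        using insert.prems(5)[of a b w] \<open>b \<in> A\<close> that by (simp add: b.f_scale)
      then show ?thesis
        unfolding lin_op_def lin_on_def W'_def
        using b.closed b.f_add b.f_scale W'sub vs by (auto simp: W'_def)
    qed
    show "g a (g b w) = g b (g a w)" if "a \<in> A" "b \<in> A" "w \<in> W'" for a b w
      using insert.prems(5)[of a b w] that by (simp add: W'_def)
    show "\<exists>n\<ge>1::nat. \<forall>w\<in>W'. (g a ^^ n) w = w" if "a \<in> A" for a
      using insert.prems(6)[of a] that by (auto simp: W'_def)
  qed
  then show ?case by (auto simp: W'_def)
qed

subsection \<open>Valuations and residues\<close>

locale local_field =
  fixes val :: "'f::field \<Rightarrow> int" and p :: nat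
  assumes nonarch: "nonarch_local_field val p"
begin

text \<open>The value of val at 0 is junk, hence the separate clause for 0.\<close>

definition vge :: "int \<Rightarrow> 'f \<Rightarrow> bool" where
  "vge n x \<longleftrightarrow> x = 0 \<or> val x \<ge> n"

definition unit_elt :: "'f \<Rightarrow> bool" where
  "unit_elt x \<longleftrightarrow> x \<noteq> 0 \<and> val x = 0"

lemma close_iff: "close val n x y \<longleftrightarrow> vge n (x - y)"
  by (auto simp: close_def vge_def)

lemma integral_iff: "integral val x \<longleftrightarrow> vge 0 x"
  by (auto simp: integral_def vge_def)

lemma val_mult: "x \<noteq> 0 \<Longrightarrow> y \<noteq> 0 \<Longrightarrow> val (x * y) = val x + val y"
  using nonarch by (auto simp: nonarch_local_field_def)

lemma val_add: "x \<noteq> 0 \<Longrightarrow> y \<noteq> 0 \<Longrightarrow> x + y \<noteq> 0 \<Longrightarrow> min (val x) (val y) \<le> val (x + y)"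
  using nonarch by (auto simp: nonarch_local_field_def)

lemma prime_p: "prime p" and vge_p: "vge 1 (of_nat p)"
  using nonarch close_iff[of 1 "of_nat p" 0] by (auto simp: nonarch_local_field_def)

lemma val_one [simp]: "val 1 = 0"
  using val_mult[of 1 1] by simp

lemma val_minus [simp]: "val (- x) = val x"
proof (cases "x = 0")
  case False
  have "val (- 1) + val (- 1) = val ((- 1) * (- 1))" by (subst val_mult) auto
  then have "val (- 1) = 0" by simp
  then show ?thesis using val_mult[of "-1" x] False by simp
qed simp

lemma val_inverse: "x \<noteq> 0 \<Longrightarrow> val (inverse x) = - val x"
  using val_mult[of x "inverse x"] by simp

lemma val_divide: "x \<noteq> 0 \<Longrightarrow> y \<noteq> 0 \<Longrightarrow> val (x / y) = val x - val y"
  by (simp add: divide_inverse val_mult val_inverse)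

lemma val_power: "x \<noteq> 0 \<Longrightarrow> val (x ^ n) = int n * val x"
  by (induction n) (auto simp: val_mult algebra_simps)

lemma vge_0 [simp]: "vge n 0" and vge_minus [simp]: "vge n (- x) \<longleftrightarrow> vge n x"
  by (auto simp: vge_def)

lemma vge_1 [simp]: "vge n 1 \<longleftrightarrow> n \<le> 0"
  by (simp add: vge_def)

lemma vge_add [intro]: "vge n x \<Longrightarrow> vge n y \<Longrightarrow> vge n (x + y)"
  using val_add[of x y] by (fastforce simp: vge_def)

lemma vge_diff [intro]: "vge n x \<Longrightarrow> vge n y \<Longrightarrow> vge n (x - y)"
  using vge_add[of n x "- y"] by simp

lemma vge_diff_comm: "vge n (x - y) \<longleftrightarrow> vge n (y - x)"
  using vge_minus[of n "x - y"] by simp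

lemma vge_mult: "vge m x \<Longrightarrow> vge n y \<Longrightarrow> vge (m + n) (x * y)"
  by (cases "x = 0"; cases "y = 0") (auto simp: vge_def val_mult)

lemma vge_mono: "vge m x \<Longrightarrow> n \<le> m \<Longrightarrow> vge n x"
  by (auto simp: vge_def)

lemma vge_mult_le: "vge m x \<Longrightarrow> vge n y \<Longrightarrow> k \<le> m + n \<Longrightarrow> vge k (x * y)"
  using vge_mult vge_mono by blast

lemma vge_of_nat: "vge 0 (of_nat n)"
  by (induction n) auto

lemma unit_elt_vge: "unit_elt x \<Longrightarrow> n \<le> 0 \<Longrightarrow> vge n x"
  by (auto simp: unit_elt_def vge_def)

lemma unit_elt_mult: "unit_elt x \<Longrightarrow> unit_elt y \<Longrightarrow> unit_elt (x * y)"
  by (auto simp: unit_elt_def val_mult)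

lemma unit_elt_divide: "unit_elt x \<Longrightarrow> unit_elt y \<Longrightarrow> unit_elt (x / y)"
  by (auto simp: unit_elt_def val_divide)

lemma unit_elt_1 [simp]: "unit_elt 1" by (simp add: unit_elt_def)

lemma unit_elt_minus [simp]: "unit_elt (- x) \<longleftrightarrow> unit_elt x" by (simp add: unit_elt_def)

lemma unit_elt_power: "unit_elt x \<Longrightarrow> unit_elt (x ^ n)"
  by (induction n) (auto intro: unit_elt_mult)

lemma unit_elt_nonzero: "unit_elt x \<Longrightarrow> x \<noteq> 0" by (simp add: unit_elt_def)

lemma vge_mult_unit [simp]: "unit_elt u \<Longrightarrow> vge n (u * x) \<longleftrightarrow> vge n x"
  "unit_elt u \<Longrightarrow> vge n (x * u) \<longleftrightarrow> vge n x" "unit_elt u \<Longrightarrow> vge n (x / u) \<longleftrightarrow> vge n x"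
  by (cases "x = 0"; auto simp: vge_def unit_elt_def val_mult val_divide)+

lemma unit_elt_iff: "unit_elt x \<longleftrightarrow> vge 0 x \<and> \<not> vge 1 x"
  by (auto simp: unit_elt_def vge_def)

lemma unit_elt_cong: "vge 1 (x - y) \<Longrightarrow> unit_elt x \<Longrightarrow> unit_elt y"
  unfolding unit_elt_iff
  by (metis vge_add vge_diff add_diff_cancel_left' diff_add_cancel vge_mono zero_le_one)

lemma unit_elt_of_one_unit: "n \<ge> 1 \<Longrightarrow> vge n (a - 1) \<Longrightarrow> unit_elt a"
  using unit_elt_cong[of 1 a] vge_mono[of n] by (metis unit_elt_1 vge_diff_comm)

lemma one_unit_mult: "n \<ge> 1 \<Longrightarrow> vge n (a - 1) \<Longrightarrow> vge n (b - 1) \<Longrightarrow> vge n (a * b - 1)"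
proof -
  assume *: "n \<ge> 1" "vge n (a - 1)" "vge n (b - 1)"
  have "a * b - 1 = a * (b - 1) + (a - 1)" by (simp add: algebra_simps)
  moreover have "vge n (a * (b - 1) + (a - 1))" using * unit_elt_of_one_unit[of n a] by (intro vge_add) auto
  ultimately show ?thesis by (simp only:)
qed

lemma one_unit_inverse: "n \<ge> 1 \<Longrightarrow> vge n (a - 1) \<Longrightarrow> vge n (inverse a - 1)"
proof -
  assume *: "n \<ge> 1" "vge n (a - 1)"
  then have u: "unit_elt a" by (rule unit_elt_of_one_unit)
  have "inverse a - 1 = (1 - a) / a" using u by (simp add: unit_elt_def field_simps)
  then show ?thesis using u * by (simp add: vge_diff_comm)
qed

lemma one_unit_divide: "n \<ge> 1 \<Longrightarrow> vge n (a - 1) \<Longrightarrow> vge n (b - 1) \<Longrightarrow> vge n (a / b - 1)"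
  by (simp add: divide_inverse one_unit_mult one_unit_inverse)

definition unif :: 'f where "unif = (SOME x. x \<noteq> 0 \<and> val x = 1)"

lemma unif_nonzero [simp]: "unif \<noteq> 0" and val_unif [simp]: "val unif = 1"
proof -
  have "\<exists>x. x \<noteq> 0 \<and> val x = 1" using nonarch by (auto simp: nonarch_local_field_def)
  from someI_ex[OF this] show "unif \<noteq> 0" "val unif = 1" unfolding unif_def by auto
qed

lemma vge_unif_mult [simp]: "vge n (unif * x) \<longleftrightarrow> vge (n - 1) x"
  "vge n (x * unif) \<longleftrightarrow> vge (n - 1) x" "vge n (x / unif) \<longleftrightarrow> vge (n + 1) x"
  by (cases "x = 0"; auto simp: vge_def val_mult val_divide)+

lemma vge_unif_power [simp]: "vge n (unif ^ m * x) \<longleftrightarrow> vge (n - int m) x"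
  "vge n (x * unif ^ m) \<longleftrightarrow> vge (n - int m) x" "vge n (x / unif ^ m) \<longleftrightarrow> vge (n + int m) x"
  by (cases "x = 0"; auto simp: vge_def val_mult val_divide val_power)+

lemma vge_unif [simp]: "vge n unif \<longleftrightarrow> n \<le> 1" by (simp add: vge_def)

text \<open>Choosing 0 to represent the maximal ideal makes every other representative a unit, so
  sums over residues split into the term at 0 and terms with invertible index.\<close>

lemma ex_residue_system:
  "\<exists>L. finite L \<and> 0 \<in> L \<and> (\<forall>x\<in>L. vge 0 x) \<and> (\<forall>x. vge 0 x \<longrightarrow> (\<exists>!l. l \<in> L \<and> vge 1 (x - l)))"
proof -
  define cls where "cls x = {y. vge 0 y \<and> vge 1 (x - y)}" for x
  define rep where "rep C = (if 0 \<in> C then 0 else SOME y. y \<in> C)" for C :: "'f set"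
  define L where "L = rep ` cls ` {x. vge 0 x}"
  have "finite (cls ` {x. vge 0 x})"
    using nonarch by (simp add: nonarch_local_field_def integral_iff close_iff cls_def)
  then have "finite L" by (simp add: L_def)
  moreover have "0 \<in> L"
  proof -
    have "0 = rep (cls 0)" by (simp add: rep_def cls_def)
    then show ?thesis unfolding L_def by (metis imageI mem_Collect_eq vge_0)
  qed
  moreover have rep: "rep (cls x) \<in> cls x" if "vge 0 x" for x
  proof -
    have "x \<in> cls x" using that by (simp add: cls_def)
    then show ?thesis by (auto simp: rep_def intro: someI)
  qed
  moreover have "\<forall>x\<in>L. vge 0 x" using rep by (auto simp: L_def cls_def)
  moreover have "\<exists>!l. l \<in> L \<and> vge 1 (x - l)" if x: "vge 0 x" for x
  proof (rule ex1I[of _ "rep (cls x)"])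
    show "rep (cls x) \<in> L \<and> vge 1 (x - rep (cls x))" using x rep[OF x] by (auto simp: L_def cls_def)
    fix l assume l: "l \<in> L \<and> vge 1 (x - l)"
    then obtain y where y: "vge 0 y" "l = rep (cls y)" by (auto simp: L_def)
    then have "vge 1 (y - l)" using rep[OF y(1)] by (simp add: cls_def)
    then have xy: "vge 1 (x - y)" using l vge_diff[of 1 "x - l" "y - l"] by simp
    have "vge 1 (x - z) = vge 1 (y - z)" for z
      using vge_diff[OF _ xy, of "x - z"] vge_add[OF _ xy, of "y - z"] by (auto simp: algebra_simps)
    then have "cls x = cls y" by (simp add: cls_def)
    then show "l = rep (cls x)" using y by simp
  qed
  ultimately show ?thesis by blast
qed

definition res :: "'f set" where
  "res = (SOME L. finite L \<and> 0 \<in> L \<and> (\<forall>x\<in>L. vge 0 x) \<and> (\<forall>x. vge 0 x \<longrightarrow> (\<exists>!l. l \<in> L \<and> vge 1 (x - l))))"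

lemma finite_res: "finite res" and zero_res: "0 \<in> res" and res_integral: "l \<in> res \<Longrightarrow> vge 0 l"
  and ex1_res: "vge 0 x \<Longrightarrow> \<exists>!l. l \<in> res \<and> vge 1 (x - l)"
  using someI_ex[OF ex_residue_system] unfolding res_def by blast+

definition rrep :: "'f \<Rightarrow> 'f" where "rrep x = (THE l. l \<in> res \<and> vge 1 (x - l))"

lemma rrep_res: "vge 0 x \<Longrightarrow> rrep x \<in> res" and rrep_close: "vge 0 x \<Longrightarrow> vge 1 (x - rrep x)"
  using theI'[OF ex1_res, of x] unfolding rrep_def by blast+

lemma res_eqI: "l \<in> res \<Longrightarrow> m \<in> res \<Longrightarrow> vge 1 (l - m) \<Longrightarrow> l = m"
  using ex1_res[of l] res_integral[of l] by auto

lemma rrep_unique: "vge 0 x \<Longrightarrow> l \<in> res \<Longrightarrow> vge 1 (x - l) \<Longrightarrow> rrep x = l"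
  using ex1_res[of x] rrep_res rrep_close by blast

lemma res_unit: "l \<in> res \<Longrightarrow> l \<noteq> 0 \<Longrightarrow> unit_elt l"
  using res_eqI[of l 0] zero_res res_integral by (auto simp: unit_elt_iff)

lemma rrep_unit: "unit_elt x \<Longrightarrow> rrep x \<in> res - {0}"
  using rrep_res[of x] rrep_close[of x] by (auto simp: unit_elt_iff)

text \<open>A map that is injective on residue classes permutes the finite set A. It serves for
  translations and for multiplication by units, with A either all of \<open>res\<close> or its
  nonzero elements.\<close>

lemma res_sum_reindex:
  assumes A: "A \<subseteq> res" and h: "\<And>l. l \<in> A \<Longrightarrow> vge 0 (h l)" "\<And>l. l \<in> A \<Longrightarrow> rrep (h l) \<in> A"
    and inj: "\<And>l m. l \<in> A \<Longrightarrow> m \<in> A \<Longrightarrow> vge 1 (h l - h m) \<Longrightarrow> vge 1 (l - m)"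
    and g: "\<And>x y. vge 0 x \<Longrightarrow> y \<in> A \<Longrightarrow> vge 1 (x - y) \<Longrightarrow> g x = g y"
  shows "(\<Sum>l\<in>A. g (h l)) = (\<Sum>l\<in>A. g l)"
proof -
  have fA: "finite A" using A finite_res finite_subset by blast
  have "inj_on (\<lambda>l. rrep (h l)) A"
  proof (rule inj_onI)
    fix l m assume *: "l \<in> A" "m \<in> A" "rrep (h l) = rrep (h m)"
    then have "vge 1 (h l - h m)"
      using vge_diff[OF rrep_close[of "h l"] rrep_close[of "h m"]] h by simp
    then show "l = m" using inj * A res_eqI by blast
  qed
  moreover have "(\<lambda>l. rrep (h l)) ` A \<subseteq> A" using h by auto
  ultimately have bij: "bij_betw (\<lambda>l. rrep (h l)) A A"
    using fA by (simp add: bij_betw_def endo_inj_surj)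
  have "(\<Sum>l\<in>A. g (h l)) = (\<Sum>l\<in>A. g (rrep (h l)))"
    using h rrep_close A by (intro sum.cong g) auto
  also have "\<dots> = (\<Sum>l\<in>A. g l)" by (rule sum.reindex_bij_betw[OF bij])
  finally show ?thesis .
qed

text \<open>The classes of \<open>r\<close> are the orbits of the prime field acting on the residue
  field by translation, and each orbit has p elements.\<close>

lemma p_dvd_card_res: "p dvd card res"
proof -
  define r where "r = {(l, m). l \<in> res \<and> m \<in> res \<and> (\<exists>n::int. vge 1 (l - m - of_int n))}"
  have cast: "vge 1 (of_int (int p * n))" for n
  proof -
    have "vge 0 (of_int n)" by (cases n) (use vge_of_nat in \<open>auto simp del: of_nat_Suc\<close>)
    then show ?thesis using vge_mult[OF vge_p, of 0 "of_int n"] by simp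
  qed
  have eq: "equiv res r"
  proof (rule equivI)
    show "refl_on res r" by (auto simp: refl_on_def r_def intro!: exI[of _ 0])
    show "r \<subseteq> res \<times> res" by (auto simp: r_def)
    show "sym r"
    proof (rule symI)
      fix l m assume "(l, m) \<in> r"
      then obtain n where n: "l \<in> res" "m \<in> res" "vge 1 (l - m - of_int n)" by (auto simp: r_def)
      then have "vge 1 (m - l - of_int (- n))" by (subst vge_minus[symmetric]) (simp add: algebra_simps)
      then show "(m, l) \<in> r" using n by (auto simp: r_def simp del: of_int_minus)
    qed
    show "trans r"
    proof (rule transI)
      fix l m k assume "(l, m) \<in> r" "(m, k) \<in> r"
      then obtain n n' where n: "l \<in> res" "k \<in> res" "vge 1 (l - m - of_int n)" "vge 1 (m - k - of_int n')"
        by (auto simp: r_def)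
      then have "vge 1 (l - k - of_int (n + n'))"
        using vge_add[OF n(3,4)] by (simp add: algebra_simps)
      then show "(l, k) \<in> r" using n by (auto simp: r_def simp del: of_int_add)
    qed
  qed
  have "p dvd card C" if C: "C \<in> res // r" for C
  proof -
    obtain l where l: "l \<in> res" "C = r `` {l}" using C by (auto elim!: quotientE)
    have vl: "vge 0 (l + of_nat i)" for i using l res_integral vge_of_nat by auto
    have "C = (\<lambda>i. rrep (l + of_nat i)) ` {..<p}"
    proof (intro equalityI subsetI)
      fix m assume "m \<in> C"
      then obtain n where n: "m \<in> res" "vge 1 (l - m - of_int n)" by (auto simp: l r_def)
      define i where "i = nat ((- n) mod int p)"
      have p0: "p > 0" using prime_p prime_gt_0_nat by blast
      have i: "i < p" "int i = (- n) mod int p"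
        using p0 by (auto simp: i_def nat_less_iff)
      have "- n = int p * ((- n) div int p) + int i" using i by simp
      then have "of_int (- n) - of_nat i = (of_int (int p * ((- n) div int p)) :: 'f)"
        by (metis add_diff_cancel_right' of_int_add of_int_of_nat_eq)
      then have "vge 1 (of_int (- n) - of_nat i)" using cast by simp
      then have "vge 1 ((l - m - of_int n) - (of_int (- n) - of_nat i))" using n by blast
      then have "vge 1 (l + of_nat i - m)" by (simp add: algebra_simps)
      then have "m = rrep (l + of_nat i)" using rrep_unique[OF vl n(1)] by simp
      then show "m \<in> (\<lambda>i. rrep (l + of_nat i)) ` {..<p}" using i by auto
    next
      fix m assume "m \<in> (\<lambda>i. rrep (l + of_nat i)) ` {..<p}"
      then obtain i where i: "m = rrep (l + of_nat i)" by auto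
      then have "vge 1 (l - m - of_int (- int i))" using rrep_close[OF vl, of i] by (simp add: algebra_simps)
      then show "m \<in> C" using i rrep_res[OF vl] l by (auto simp: r_def simp del: of_int_minus)
    qed
    moreover have "inj_on (\<lambda>i. rrep (l + of_nat i)) {..<p}"
    proof (rule linorder_inj_onI)
      fix i j assume ij: "i < j" "i \<in> {..<p}" "j \<in> {..<p}"
      show "rrep (l + of_nat i) \<noteq> rrep (l + of_nat j)"
      proof
        assume "rrep (l + of_nat i) = rrep (l + of_nat j)"
        then have "vge 1 ((l + of_nat j) - (l + of_nat i))"
          using vge_diff[OF rrep_close[OF vl, of j] rrep_close[OF vl, of i]] by simp
        then have d: "vge 1 (of_nat (j - i))" using ij by (simp add: of_nat_diff)
        \<comment> \<open>By Bezout a coincidence of two residues in one orbit would put 1 into the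
          maximal ideal.\<close>
        have "coprime (int (j - i)) (int p)"
          using prime_p ij by (metis coprime_int_iff coprime_commute diff_less less_imp_diff_less lessThan_iff
              nat_dvd_not_less prime_imp_coprime zero_less_diff)
        then obtain a b where "a * int (j - i) + b * int p = 1"
          using bezout_int[of "int (j - i)" "int p"] by auto
        then have "of_int a * of_nat (j - i) + of_int (int p * b) = (1::'f)"
          by (metis mult.commute of_int_1 of_int_add of_int_mult of_int_of_nat_eq)
        moreover have "vge 0 (of_int a)" by (cases a) (use vge_of_nat in \<open>auto simp del: of_nat_Suc\<close>)
        then have "vge 1 (of_int a * of_nat (j - i))" using d vge_mult[of 0 "of_int a" 1] by simp
        ultimately have "vge 1 (1::'f)" using cast[of b] vge_add by metis
        then show False by simp
      qed
    qed auto
    ultimately have "card C = p" by (simp add: card_image)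
    then show ?thesis by simp
  qed
  moreover have "\<Union> (res // r) = res" using eq by (rule Union_quotient)
  ultimately show ?thesis
    using dvd_partition[of "res // r" p] finite_res quotient_disj[OF eq] by metis
qed

text \<open>Pigeonhole gives an order for each nonzero residue, and the product of these orders
  serves for all units. It gives torus elements finite order on pro-p Iwahori invariants.\<close>

lemma ex_unit_order: "\<exists>n\<ge>1. \<forall>a. unit_elt a \<longrightarrow> vge 1 (a ^ n - 1)"
proof -
  have one: "\<exists>n\<ge>1. vge 1 (a ^ n - 1)" if a: "unit_elt a" for a
  proof -
    have v: "vge 0 (a ^ i)" for i using unit_elt_power[OF a] unit_elt_vge by blast
    have "\<not> inj_on (\<lambda>i. rrep (a ^ i)) (UNIV :: nat set)"
      using finite_subset[OF _ finite_res, of "(\<lambda>i. rrep (a ^ i)) ` UNIV"] rrep_res[OF v]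
      by (meson finite_imageD image_subsetI infinite_UNIV_nat)
    then obtain i j :: nat where ij: "i < j" "rrep (a ^ i) = rrep (a ^ j)"
      by (metis (mono_tags, lifting) UNIV_I inj_onI linorder_neqE_nat)
    have "vge 1 (a ^ j - a ^ i)"
      using vge_diff[OF rrep_close[OF v, of j] rrep_close[OF v, of i]] ij by simp
    also have "a ^ j - a ^ i = a ^ i * (a ^ (j - i) - 1)"
      using ij by (simp add: right_diff_distrib flip: power_add)
    finally have "vge 1 (a ^ (j - i) - 1)" using unit_elt_power[OF a] by simp
    then show ?thesis using ij by (intro exI[of _ "j - i"]) auto
  qed
  then obtain n where n: "\<And>a. unit_elt a \<Longrightarrow> n a \<ge> 1 \<and> vge 1 (a ^ n a - 1)" by metis
  define N where "N = (\<Prod>l\<in>res - {0}. n l)"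
  have pow: "vge 1 (a ^ k - 1)" if "vge 1 (a - 1)" for a k
    using that by (induction k) (auto intro: one_unit_mult)
  have "N \<ge> 1" unfolding N_def using n res_unit by (intro prod_ge_1) auto
  moreover have "vge 1 (a ^ N - 1)" if a: "unit_elt a" for a
  proof -
    define l where "l = rrep a"
    have va: "vge 0 a" using a unit_elt_vge by blast
    have l: "l \<in> res - {0}" "vge 1 (a - l)" using rrep_unit[OF a] rrep_close[OF va] by (auto simp: l_def)
    then have ul: "unit_elt l" using res_unit by blast
    have "n l dvd N" unfolding N_def using l(1) finite_res by (intro dvd_prodI) auto
    then obtain k where k: "N = n l * k" by (elim dvdE)
    have "vge 1 (l ^ N - 1)" unfolding k power_mult using n[OF ul] pow by blast
    moreover have "vge 1 (a / l - 1)"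
      using l(2) ul by (simp add: unit_elt_nonzero divide_diff_eq_iff)
    then have "vge 1 ((a / l) ^ N - 1)" by (rule pow)
    ultimately have "vge 1 (l ^ N * (a / l) ^ N - 1)" by (intro one_unit_mult) auto
    then show ?thesis using ul by (simp add: power_divide unit_elt_nonzero)
  qed
  ultimately show ?thesis by blast
qed

end

subsection \<open>Pro-p Iwahori invariants and Hecke operators\<close>

abbreviation um :: "'f::field \<Rightarrow> 'f mat2" where "um b \<equiv> (1, b, 0, 1)"
abbreviation lm :: "'f::field \<Rightarrow> 'f mat2" where "lm c \<equiv> (1, 0, c, 1)"
abbreviation dm :: "'f::field \<Rightarrow> 'f \<Rightarrow> 'f mat2" where "dm a d \<equiv> (a, 0, 0, d)"
abbreviation sm :: "'f::field mat2" where "sm \<equiv> (0, 1, 1, 0)"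
abbreviation (in local_field) tm :: "nat \<Rightarrow> 'f mat2" where "tm n \<equiv> (unif ^ n, 0, 0, 1)"
abbreviation (in local_field) pm :: "'f mat2" where "pm \<equiv> (0, 1, unif, 0)"

fun minv :: "'f::field mat2 \<Rightarrow> 'f mat2" where
  "minv (a, b, c, d) = (d / (a * d - b * c), - b / (a * d - b * c), - c / (a * d - b * c), a / (a * d - b * c))"

lemma GL2_iff [simp]: "(a, b, c, d) \<in> GL2 \<longleftrightarrow> a * d - b * c \<noteq> 0"
  by (simp add: GL2_def)

lemma one2_GL2 [simp]: "one2 \<in> GL2"
  by (simp add: one2_def)

lemma mdet_mmul: "mdet (mmul g h) = mdet g * mdet h"
  by (cases g; cases h) (simp add: algebra_simps)

lemma mmul_GL2 [simp, intro]: "g \<in> GL2 \<Longrightarrow> h \<in> GL2 \<Longrightarrow> mmul g h \<in> GL2"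
  by (simp add: GL2_def mdet_mmul)

lemma mmul_assoc: "mmul (mmul g h) k = mmul g (mmul h k)"
  by (cases g; cases h; cases k) (simp add: algebra_simps)

lemma mmul_one2 [simp]: "mmul one2 g = g" "mmul g one2 = g"
  by (cases g; simp add: one2_def)+

lemma mmul_minv: assumes "g \<in> GL2" shows "mmul (minv g) g = one2" "mmul g (minv g) = one2"
proof -
  obtain a b c d where g: "g = (a, b, c, d)" by (cases g)
  then have "a * d - b * c \<noteq> 0" using assms by simp
  then show "mmul (minv g) g = one2" "mmul g (minv g) = one2"
    by (simp_all add: g one2_def mult.commute flip: diff_divide_distrib add_divide_distrib)
qed

lemma minv_GL2 [simp, intro]: assumes "g \<in> GL2" shows "minv g \<in> GL2"
proof -
  have "mdet (minv g) * mdet g = 1"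
    using mdet_mmul[of "minv g" g] mmul_minv(1)[OF assms] by (simp add: one2_def)
  then show ?thesis by (auto simp: GL2_def)
qed

lemma mmul_minv_cancel: "g \<in> GL2 \<Longrightarrow> mmul (minv g) (mmul g h) = h" "g \<in> GL2 \<Longrightarrow> mmul g (mmul (minv g) h) = h"
  by (simp_all add: mmul_minv flip: mmul_assoc)

definition flip :: "('a \<Rightarrow> 'a \<Rightarrow> 'b) \<Rightarrow> 'a \<Rightarrow> 'a \<Rightarrow> 'b" where "flip \<chi> a d = \<chi> d a"

lemma flip_flip [simp]: "flip (flip \<chi>) = \<chi>" by (simp add: flip_def fun_eq_iff)

text \<open>The eigenvalue of S on the image of S, see \<open>So_So\<close>.\<close>

definition (in local_field) echi :: "('f \<Rightarrow> 'f \<Rightarrow> 'k::field) \<Rightarrow> 'k" where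
  "echi \<chi> = (\<Sum>m\<in>res - {0}. \<chi> m (- 1 / m))"

locale rep = local_field val p
  for val :: "'f::field \<Rightarrow> int" and p :: nat +
  fixes sc :: "'k::field \<Rightarrow> 'v::ab_group_add \<Rightarrow> 'v" and V :: "'v set" and act :: "'f mat2 \<Rightarrow> 'v \<Rightarrow> 'v"
  assumes coeff: "alg_closure_Fp p TYPE('k)"
    and smooth_rep: "smooth_rep val sc V act"
begin

sublocale vector_space sc
  using smooth_rep by (simp add: smooth_rep_def)

lemma alg_closed: "degree (q :: 'k poly) \<ge> 1 \<Longrightarrow> \<exists>x. poly q x = 0"
  and char_p: "of_nat p = (0 :: 'k)"
  using coeff by (auto simp: alg_closure_Fp_def)

lemma subspace_V: "subspace V"
  and act_closed [simp, intro]: "g \<in> GL2 \<Longrightarrow> v \<in> V \<Longrightarrow> act g v \<in> V"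
  and act_add: "g \<in> GL2 \<Longrightarrow> u \<in> V \<Longrightarrow> v \<in> V \<Longrightarrow> act g (u + v) = act g u + act g v"
  and act_scale: "g \<in> GL2 \<Longrightarrow> v \<in> V \<Longrightarrow> act g (sc c v) = sc c (act g v)"
  and act_one: "v \<in> V \<Longrightarrow> act one2 v = v"
  and act_mmul: "g \<in> GL2 \<Longrightarrow> h \<in> GL2 \<Longrightarrow> v \<in> V \<Longrightarrow> act (mmul g h) v = act g (act h v)"
  and smooth: "v \<in> V \<Longrightarrow> \<exists>n\<ge>1. \<forall>g\<in>Kcong val n. act g v = v"
  using smooth_rep by (auto simp: smooth_rep_def lin_on_def stable_def)

lemma V_scale [simp, intro]: "v \<in> V \<Longrightarrow> sc c v \<in> V" and V_add [simp, intro]: "u \<in> V \<Longrightarrow> v \<in> V \<Longrightarrow> u + v \<in> V"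
  and V_0 [simp]: "0 \<in> V" and V_diff [simp, intro]: "u \<in> V \<Longrightarrow> v \<in> V \<Longrightarrow> u - v \<in> V"
  using subspace_V by (auto intro: subspace_scale subspace_add subspace_diff subspace_0)

lemma V_sum [intro]: "(\<And>i. i \<in> A \<Longrightarrow> g i \<in> V) \<Longrightarrow> (\<Sum>i\<in>A. g i) \<in> V"
  by (rule subspace_sum[OF subspace_V])

lemma act_linear: "g \<in> GL2 \<Longrightarrow> linear_operator sc V (act g)"
  unfolding linear_operator_def lin_op_def lin_on_def
  using subspace_V act_add act_scale vector_space_axioms by auto

lemma act_0 [simp]: "g \<in> GL2 \<Longrightarrow> act g 0 = 0"
  using linear_operator.f_zero[OF act_linear] .

lemma act_sum: "g \<in> GL2 \<Longrightarrow> (\<And>i. i \<in> A \<Longrightarrow> h i \<in> V) \<Longrightarrow> act g (\<Sum>i\<in>A. h i) = (\<Sum>i\<in>A. act g (h i))"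
  using linear_operator.f_sum[OF act_linear] by blast

lemma act_diff: "g \<in> GL2 \<Longrightarrow> u \<in> V \<Longrightarrow> v \<in> V \<Longrightarrow> act g (u - v) = act g u - act g v"
  using linear_operator.f_diff[OF act_linear] .

lemma act_inj: "g \<in> GL2 \<Longrightarrow> v \<in> V \<Longrightarrow> act g v = 0 \<Longrightarrow> v = 0"
  using act_mmul[of "minv g" g v] by (simp add: mmul_minv act_one)

lemma act_eq:
  assumes "mmul g h = mmul g' h'" "g \<in> GL2" "h \<in> GL2" "g' \<in> GL2" "h' \<in> GL2" "v \<in> V"
  shows "act g (act h v) = act g' (act h' v)"
  using assms by (metis act_mmul)

lemma act_eq1:
  assumes "mmul g h = k" "g \<in> GL2" "h \<in> GL2" "v \<in> V"
  shows "act g (act h v) = act k v"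
  using assms by (metis act_mmul)

text \<open>Invariance is under u(b) with b in the i-th power of the maximal ideal, the 1-units of the torus, and the
  lower unipotents with entry in the j-th power; i = 0 and j = 1 give the invariants of the pro-p Iwahori subgroup.\<close>

definition fixed :: "int \<Rightarrow> int \<Rightarrow> 'v \<Rightarrow> bool" where
  "fixed i j x \<longleftrightarrow> x \<in> V \<and> (\<forall>b. vge i b \<longrightarrow> act (um b) x = x) \<and>
     (\<forall>a d. vge 1 (a - 1) \<longrightarrow> vge 1 (d - 1) \<longrightarrow> act (dm a d) x = x) \<and>
     (\<forall>c. vge j c \<longrightarrow> act (lm c) x = x)"

lemma fixedI:
  assumes "x \<in> V" "\<And>b. vge i b \<Longrightarrow> act (um b) x = x"
    "\<And>a d. unit_elt a \<Longrightarrow> unit_elt d \<Longrightarrow> vge 1 (a - 1) \<Longrightarrow> vge 1 (d - 1) \<Longrightarrow> act (dm a d) x = x"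
    "\<And>c. vge j c \<Longrightarrow> act (lm c) x = x"
  shows "fixed i j x"
  unfolding fixed_def using assms unit_elt_of_one_unit[of 1] by auto

lemma fixedD:
  assumes "fixed i j x"
  shows "x \<in> V" "vge i b \<Longrightarrow> act (um b) x = x"
    "vge 1 (a - 1) \<Longrightarrow> vge 1 (d - 1) \<Longrightarrow> act (dm a d) x = x" "vge j c \<Longrightarrow> act (lm c) x = x"
  using assms by (auto simp: fixed_def)

lemma fixed_mono: "fixed i j x \<Longrightarrow> i \<le> i' \<Longrightarrow> j \<le> j' \<Longrightarrow> fixed i' j' x"
  unfolding fixed_def using vge_mono by blast

lemma subspace_fixed: "subspace {x. fixed i j x}"
  using unit_elt_of_one_unit[of 1] unit_elt_nonzero
  by (intro subspaceI) (auto simp: fixed_def act_add act_scale)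

lemma fixed_scale: "fixed i j x \<Longrightarrow> fixed i j (sc c x)"
  using subspace_scale[OF subspace_fixed] by blast

lemma fixed_sum: "(\<And>l. l \<in> A \<Longrightarrow> fixed i j (g l)) \<Longrightarrow> fixed i j (\<Sum>l\<in>A. g l)"
  using subspace_sum[OF subspace_fixed, of A g] by blast

lemma um_cong:
  assumes "fixed 1 j y" "vge 1 (b - b')"
  shows "act (um b) y = act (um b') y"
proof -
  have "act (um b') (act (um (b - b')) y) = act (um b) y"
    using fixedD(1)[OF assms(1)] by (intro act_eq1) auto
  then show ?thesis using fixedD(2)[OF assms(1)] assms(2) by simp
qed

text \<open>Conjugation by an integral u(b) preserves the group behind \<open>fixed 1 j\<close>:
  moving a torus 1-unit or a lower unipotent past u(b) changes b only within its residue class and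
  costs at most a torus 1-unit.\<close>

lemma fixed_um:
  assumes y: "fixed 1 j y" and j: "j \<ge> 1" and b: "vge 0 b"
  shows "fixed 1 j (act (um b) y)"
proof (rule fixedI)
  note yV = fixedD(1)[OF y]
  show "act (um b) y \<in> V" using yV by simp
  show "act (um b') (act (um b) y) = act (um b) y" if "vge 1 b'" for b'
  proof -
    have "act (um b') (act (um b) y) = act (um b) (act (um b') y)"
      using yV by (intro act_eq) auto
    then show ?thesis using fixedD(2)[OF y that] by simp
  qed
  show "act (dm a d) (act (um b) y) = act (um b) y"
    if u: "unit_elt a" "unit_elt d" "vge 1 (a - 1)" "vge 1 (d - 1)" for a d
  proof -
    have "act (dm a d) (act (um b) y) = act (um (b * (a / d))) (act (dm a d) y)"
      using yV u by (intro act_eq) (auto simp: unit_elt_nonzero)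
    also have "\<dots> = act (um b) y"
    proof -
      have "b * (a / d) - b = b * (a / d - 1)" by (simp add: algebra_simps)
      moreover have "vge (0 + 1) (b * (a / d - 1))" by (intro vge_mult b one_unit_divide u) auto
      ultimately show ?thesis using fixedD(3)[OF y u(3,4)] um_cong[OF y] by simp
    qed
    finally show ?thesis .
  qed
  show "act (lm c) (act (um b) y) = act (um b) y" if c: "vge j c" for c
  proof -
    define e where "e = 1 + c * b"
    have cb: "vge j (c * b)" using vge_mult[OF c b] by simp
    then have e1: "vge 1 (e - 1)" using vge_mono j by (simp add: e_def)
    then have e: "unit_elt e" using unit_elt_of_one_unit[of 1] by simp
    have ei: "vge 1 (1 / e - 1)" using one_unit_divide[OF _ _ e1, of 1] by simp
    have "act (lm c) (act (um b) y) = act (mmul (lm c) (um b)) y"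
      using yV by (intro act_eq1) auto
    also have "mmul (lm c) (um b) = mmul (mmul (um (b / e)) (dm (1 / e) e)) (lm (c / e))"
      using e by (simp add: unit_elt_nonzero field_simps) (simp add: e_def algebra_simps)
    also have "act \<dots> y = act (um (b / e)) (act (dm (1 / e) e) (act (lm (c / e)) y))"
      using yV e by (simp add: act_mmul unit_elt_nonzero del: mmul.simps)
    also have "\<dots> = act (um (b / e)) y"
      using fixedD(4)[OF y, of "c / e"] fixedD(3)[OF y ei e1] c e by simp
    also have "\<dots> = act (um b) y"
    proof (rule um_cong[OF y])
      have "b / e - b = b * (1 / e - 1)" by (simp add: algebra_simps)
      then show "vge 1 (b / e - b)" using vge_mult[OF b ei] by simp
    qed
    finally show ?thesis .
  qed
qed

definition usum :: "'v \<Rightarrow> 'v" where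
  "usum y = (\<Sum>l\<in>res. act (um l) y)"

text \<open>Translation permutes the residue classes, so summing over them turns invariance for b in
  the maximal ideal into invariance for all integral b.\<close>

lemma fixed_usum:
  assumes y: "fixed 1 j y" and j: "j \<ge> 1"
  shows "fixed 0 j (usum y)"
proof -
  have f: "fixed 1 j (usum y)"
    unfolding usum_def using fixed_um[OF y j] res_integral by (intro fixed_sum) auto
  note yV = fixedD(1)[OF y]
  show ?thesis
  proof (rule fixedI)
    show "act (um b) (usum y) = usum y" if b: "vge 0 b" for b
    proof -
      have "act (um b) (usum y) = (\<Sum>l\<in>res. act (um b) (act (um l) y))"
        unfolding usum_def using yV by (intro act_sum) auto
      also have "\<dots> = (\<Sum>l\<in>res. act (um (b + l)) y)"
        using yV by (intro sum.cong act_eq1) (auto simp: algebra_simps)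
      also have "\<dots> = (\<Sum>l\<in>res. act (um l) y)"
        using b res_integral rrep_res
        by (intro res_sum_reindex[where g = "\<lambda>z. act (um z) y"] um_cong[OF y]) auto
      finally show ?thesis by (simp add: usum_def)
    qed
  qed (use fixedD[OF f] in auto)
qed

text \<open>Conjugation by diag(unif, 1) trades upper for lower invariance. The passage from j to j
  - 1 is the gain that \<open>Borel_Hom_equivariant_at_good_vector\<close> iterates.\<close>

lemma fixed_tm1:
  assumes y: "fixed i j y" shows "fixed (i + 1) (j - 1) (act (tm 1) y)"
proof (rule fixedI)
  note yV = fixedD(1)[OF y]
  show "act (tm 1) y \<in> V" using yV by simp
  show "act (um b) (act (tm 1) y) = act (tm 1) y" if "vge (i + 1) b" for b
  proof -
    have "act (um b) (act (tm 1) y) = act (tm 1) (act (um (b / unif)) y)"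
      using yV by (intro act_eq) auto
    then show ?thesis using fixedD(2)[OF y, of "b / unif"] that by simp
  qed
  show "act (dm a d) (act (tm 1) y) = act (tm 1) y"
    if "unit_elt a" "unit_elt d" "vge 1 (a - 1)" "vge 1 (d - 1)" for a d
  proof -
    have "act (dm a d) (act (tm 1) y) = act (tm 1) (act (dm a d) y)"
      using yV that by (intro act_eq) (auto simp: unit_elt_nonzero)
    then show ?thesis using fixedD(3)[OF y] that by simp
  qed
  show "act (lm c) (act (tm 1) y) = act (tm 1) y" if "vge (j - 1) c" for c
  proof -
    have "act (lm c) (act (tm 1) y) = act (tm 1) (act (lm (c * unif)) y)"
      using yV by (intro act_eq) auto
    then show ?thesis using fixedD(4)[OF y, of "c * unif"] that by simp
  qed
qed

lemma fixed_sm: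
  assumes y: "fixed i j y" shows "fixed j i (act sm y)"
proof (rule fixedI)
  note yV = fixedD(1)[OF y]
  show "act sm y \<in> V" using yV by simp
  show "act (um b) (act sm y) = act sm y" if "vge j b" for b
  proof -
    have "act (um b) (act sm y) = act sm (act (lm b) y)" using yV by (intro act_eq) auto
    then show ?thesis using fixedD(4)[OF y that] by simp
  qed
  show "act (dm a d) (act sm y) = act sm y"
    if "unit_elt a" "unit_elt d" "vge 1 (a - 1)" "vge 1 (d - 1)" for a d
  proof -
    have "act (dm a d) (act sm y) = act sm (act (dm d a) y)"
      using yV that by (intro act_eq) (auto simp: unit_elt_nonzero)
    then show ?thesis using fixedD(3)[OF y] that by simp
  qed
  show "act (lm c) (act sm y) = act sm y" if "vge i c" for c
  proof -
    have "act (lm c) (act sm y) = act sm (act (um c) y)" using yV by (intro act_eq) auto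
    then show ?thesis using fixedD(2)[OF y that] by simp
  qed
qed

lemma fixed_pm:
  assumes y: "fixed i j y" shows "fixed (j - 1) (i + 1) (act pm y)"
proof (rule fixedI)
  note yV = fixedD(1)[OF y]
  show "act pm y \<in> V" using yV by simp
  show "act (um b) (act pm y) = act pm y" if "vge (j - 1) b" for b
  proof -
    have "act (um b) (act pm y) = act pm (act (lm (b * unif)) y)" using yV by (intro act_eq) auto
    then show ?thesis using fixedD(4)[OF y, of "b * unif"] that by simp
  qed
  show "act (dm a d) (act pm y) = act pm y"
    if "unit_elt a" "unit_elt d" "vge 1 (a - 1)" "vge 1 (d - 1)" for a d
  proof -
    have "act (dm a d) (act pm y) = act pm (act (dm d a) y)"
      using yV that by (intro act_eq) (auto simp: unit_elt_nonzero)
    then show ?thesis using fixedD(3)[OF y] that by simp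
  qed
  show "act (lm c) (act pm y) = act pm y" if "vge (i + 1) c" for c
  proof -
    have "act (lm c) (act pm y) = act pm (act (um (c / unif)) y)" using yV by (intro act_eq) auto
    then show ?thesis using fixedD(2)[OF y, of "c / unif"] that by simp
  qed
qed

text \<open>On pro-p Iwahori invariants these are the Hecke operators S and U of the double cosets of s and of
  diag(unif, 1).\<close>

definition So :: "'v \<Rightarrow> 'v" where "So x = usum (act sm x)"
definition Uo :: "'v \<Rightarrow> 'v" where "Uo x = So (act pm x)"

lemma Uo_eq: "x \<in> V \<Longrightarrow> Uo x = usum (act (tm 1) x)"
  unfolding Uo_def So_def using act_eq1[of sm pm "tm 1" x] by simp

lemma fixed_So: "fixed 0 1 x \<Longrightarrow> fixed 0 1 (So x)"
  unfolding So_def using fixed_mono[OF fixed_sm, of 0 1 x 1 1] by (intro fixed_usum) auto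

lemma fixed_pm01: "fixed 0 1 x \<Longrightarrow> fixed 0 1 (act pm x)"
  using fixed_pm[of 0 1 x] by simp

lemma fixed_Uo: "fixed 0 1 x \<Longrightarrow> fixed 0 1 (Uo x)"
  unfolding Uo_def by (intro fixed_So fixed_pm01)

lemma So_closed: "x \<in> V \<Longrightarrow> So x \<in> V" and Uo_closed: "x \<in> V \<Longrightarrow> Uo x \<in> V"
  unfolding Uo_def So_def usum_def by auto

lemma So_add: "x \<in> V \<Longrightarrow> y \<in> V \<Longrightarrow> So (x + y) = So x + So y"
  by (simp add: So_def usum_def act_add sum.distrib)

lemma So_scale: "x \<in> V \<Longrightarrow> So (sc c x) = sc c (So x)"
  by (simp add: So_def usum_def act_scale scale_sum_right)

lemma So_linear: "linear_operator sc V So"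
  unfolding linear_operator_def lin_op_def lin_on_def
  using So_add So_scale So_closed subspace_V vector_space_axioms by auto

lemma Uo_linear: "linear_operator sc V Uo"
  unfolding linear_operator_def lin_op_def lin_on_def
  using Uo_closed subspace_V vector_space_axioms by (auto simp: Uo_def act_add act_scale So_add So_scale)

lemma pm_pm: "x \<in> V \<Longrightarrow> act pm (act pm x) = act (dm unif unif) x"
  by (intro act_eq1) auto

text \<open>Only the values of \<chi> on units are constrained, which is why later constructions
  divide by powers of \<open>unif\<close> before applying \<chi>.\<close>

definition eig :: "('f \<Rightarrow> 'f \<Rightarrow> 'k) \<Rightarrow> 'v \<Rightarrow> bool" where
  "eig \<chi> x \<longleftrightarrow> fixed 0 1 x \<and> (\<forall>a d. unit_elt a \<longrightarrow> unit_elt d \<longrightarrow> act (dm a d) x = sc (\<chi> a d) x)"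

lemma eig_fixed: "eig \<chi> x \<Longrightarrow> fixed 0 1 x" and eig_V: "eig \<chi> x \<Longrightarrow> x \<in> V"
  by (auto simp: eig_def fixed_def)

lemma eig_act: "eig \<chi> x \<Longrightarrow> unit_elt a \<Longrightarrow> unit_elt d \<Longrightarrow> act (dm a d) x = sc (\<chi> a d) x"
  by (simp add: eig_def)

lemma subspace_eig: "subspace {x. eig \<chi> x}"
proof (intro subspaceI)
  show "0 \<in> {x. eig \<chi> x}" using subspace_0[OF subspace_fixed] by (auto simp: eig_def unit_elt_nonzero)
  show "x + y \<in> {x. eig \<chi> x}" if "x \<in> {x. eig \<chi> x}" "y \<in> {x. eig \<chi> x}" for x y
    using subspace_add[OF subspace_fixed, of x 0 1 y] that eig_V[of \<chi> x] eig_V[of \<chi> y]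
    by (auto simp: eig_def act_add scale_right_distrib unit_elt_nonzero)
  show "sc c x \<in> {x. eig \<chi> x}" if "x \<in> {x. eig \<chi> x}" for c x
    using subspace_scale[OF subspace_fixed, of x 0 1 c] that eig_V[of \<chi> x]
    by (auto simp: eig_def act_scale unit_elt_nonzero mult.commute)
qed

lemma eig_pm: assumes x: "eig \<chi> x" shows "eig (flip \<chi>) (act pm x)"
  unfolding eig_def
proof (intro conjI allI impI)
  show "fixed 0 1 (act pm x)" using x fixed_pm01 eig_fixed by blast
  fix a d assume u: "unit_elt a" "unit_elt d"
  have "act (dm a d) (act pm x) = act pm (act (dm d a) x)"
    using eig_V[OF x] u by (intro act_eq) (auto simp: unit_elt_nonzero)
  then show "act (dm a d) (act pm x) = sc (flip \<chi> a d) (act pm x)"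
    using eig_act[OF x u(2,1)] eig_V[OF x] by (simp add: act_scale flip_def)
qed

lemma fixed_sm01: "fixed 0 1 x \<Longrightarrow> fixed 1 1 (act sm x)"
  using fixed_mono[OF fixed_sm, of 0 1 x 1 1] by simp

lemma eig_So: assumes x: "eig \<chi> x" shows "eig (flip \<chi>) (So x)"
  unfolding eig_def
proof (intro conjI allI impI)
  show "fixed 0 1 (So x)" using x fixed_So eig_fixed by blast
  note xV = eig_V[OF x]
  fix a d assume u: "unit_elt a" "unit_elt d"
  have "act (dm a d) (So x) = (\<Sum>l\<in>res. act (dm a d) (act (um l) (act sm x)))"
    unfolding So_def usum_def using xV u by (intro act_sum) (auto simp: unit_elt_nonzero)
  also have "\<dots> = (\<Sum>l\<in>res. sc (flip \<chi> a d) (act (um (l * (a / d))) (act sm x)))"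
  proof (intro sum.cong refl)
    fix l
    have "act (dm a d) (act (um l) (act sm x)) = act (um (l * (a / d))) (act (dm a d) (act sm x))"
      using xV u by (intro act_eq) (auto simp: unit_elt_nonzero)
    also have "act (dm a d) (act sm x) = act sm (act (dm d a) x)"
      using xV u by (intro act_eq) (auto simp: unit_elt_nonzero)
    also have "\<dots> = sc (flip \<chi> a d) (act sm x)"
      using eig_act[OF x u(2,1)] xV by (simp add: act_scale flip_def)
    finally show "act (dm a d) (act (um l) (act sm x)) = sc (flip \<chi> a d) (act (um (l * (a / d))) (act sm x))"
      using xV by (simp add: act_scale)
  qed
  also have "\<dots> = sc (flip \<chi> a d) (\<Sum>l\<in>res. act (um (l * (a / d))) (act sm x))"
    by (simp add: scale_sum_right)
  also have "(\<Sum>l\<in>res. act (um (l * (a / d))) (act sm x)) = (\<Sum>l\<in>res. act (um l) (act sm x))"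
  proof (rule res_sum_reindex[where g = "\<lambda>z. act (um z) (act sm x)"])
    have ad: "unit_elt (a / d)" using u by (rule unit_elt_divide)
    show v: "vge 0 (l * (a / d))" if "l \<in> res" for l using that res_integral vge_mult_unit(2)[OF ad] by blast
    then show "rrep (l * (a / d)) \<in> res" if "l \<in> res" for l using that rrep_res by blast
    show "vge 1 (l - m)" if "vge 1 (l * (a / d) - m * (a / d))" for l m
      using that vge_mult_unit(2)[OF ad, of 1 "l - m"] by (metis left_diff_distrib)
  qed (use um_cong[OF fixed_sm01[OF eig_fixed[OF x]]] in auto)
  finally show "act (dm a d) (So x) = sc (flip \<chi> a d) (So x)" by (simp add: So_def usum_def)
qed

lemma eig_Uo: "eig \<chi> x \<Longrightarrow> eig \<chi> (Uo x)"
  unfolding Uo_def using eig_So[OF eig_pm, of \<chi> x] by simp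

lemma sm_um_sm:
  assumes x: "eig \<chi> x" and m: "unit_elt m"
  shows "act sm (act (um m) (act sm x)) = sc (\<chi> m (- 1 / m)) (act (um (1 / m)) (act sm x))"
proof -
  note xV = eig_V[OF x]
  have m0: "m \<noteq> 0" using m by (rule unit_elt_nonzero)
  have um: "unit_elt (- 1 / m)" using unit_elt_divide[OF unit_elt_1 m] by simp
  have "act sm (act (um m) (act sm x)) = act (mmul sm (mmul (um m) sm)) x"
    using xV by (simp add: act_mmul del: mmul.simps)
  also have "mmul sm (mmul (um m) sm) = mmul (um (1 / m)) (mmul sm (mmul (dm m (- 1 / m)) (um (1 / m))))"
    using m0 by (simp add: field_simps)
  also have "act \<dots> x = act (um (1 / m)) (act sm (act (dm m (- 1 / m)) (act (um (1 / m)) x)))"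
    using xV m0 by (simp add: act_mmul del: mmul.simps)
  also have "act (um (1 / m)) x = x"
    using fixedD(2)[OF eig_fixed[OF x], of "1 / m"] m by simp
  also have "act (dm m (- 1 / m)) x = sc (\<chi> m (- 1 / m)) x" using eig_act[OF x m um] .
  finally show ?thesis using xV by (simp add: act_scale)
qed

lemma card_res_zero: "of_nat (card res) = (0 :: 'k)"
  using p_dvd_card_res char_p by (metis dvdE mult_zero_left of_nat_mult)

lemma sm_sm: "x \<in> V \<Longrightarrow> act sm (act sm x) = x"
  using act_eq1[of sm sm one2 x] act_one by (simp add: one2_def)

lemma sm_So:
  assumes x: "eig \<chi> x"
  shows "act sm (So x) = x + (\<Sum>m\<in>res - {0}. sc (\<chi> m (- 1 / m)) (act (um (1 / m)) (act sm x)))"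
proof -
  note xV = eig_V[OF x]
  have u0: "um 0 = one2" by (simp add: one2_def)
  have "act sm (So x) = (\<Sum>m\<in>res. act sm (act (um m) (act sm x)))"
    unfolding So_def usum_def using xV by (intro act_sum) auto
  also have "\<dots> = act sm (act (um 0) (act sm x)) + (\<Sum>m\<in>res - {0}. act sm (act (um m) (act sm x)))"
    by (rule sum.remove[OF finite_res zero_res])
  also have "act sm (act (um 0) (act sm x)) = x" using xV by (simp add: u0 act_one sm_sm)
  also have "(\<Sum>m\<in>res - {0}. act sm (act (um m) (act sm x))) =
      (\<Sum>m\<in>res - {0}. sc (\<chi> m (- 1 / m)) (act (um (1 / m)) (act sm x)))"
    using sm_um_sm[OF x] res_unit by (intro sum.cong) auto
  finally show ?thesis .
qed

text \<open>The quadratic Hecke relation. The summand x of \<open>sm_So\<close> is counted once for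
  each residue, which gives 0 since p divides their number; in every other summand u(1/m) is
  absorbed by the invariance of S x.\<close>

lemma So_So:
  assumes x: "eig \<chi> x"
  shows "So (So x) = sc (echi \<chi>) (So x)"
proof -
  note xV = eig_V[OF x]
  have SV: "So x \<in> V" using xV So_closed by blast
  let ?w = "\<lambda>l m. sc (\<chi> m (- 1 / m)) (act (um l) (act (um (1 / m)) (act sm x)))"
  have "So (So x) = (\<Sum>l\<in>res. act (um l) x + (\<Sum>m\<in>res - {0}. ?w l m))"
    unfolding So_def[of "So x"] usum_def sm_So[OF x]
    using xV by (intro sum.cong refl, subst act_add, simp_all add: act_sum act_scale V_sum)
  also have "\<dots> = (\<Sum>l\<in>res. x) + (\<Sum>m\<in>res - {0}. \<Sum>l\<in>res. ?w l m)"
    using fixedD(2)[OF eig_fixed[OF x]] res_integral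
    by (simp add: sum.distrib sum.swap[of _ "res - {0}"])
  also have "(\<Sum>l\<in>res. x) = sc (of_nat (card res)) x"
    by (simp add: sum_constant_scale)
  also have "\<dots> = 0" by (simp add: card_res_zero)
  also have "(\<Sum>m\<in>res - {0}. \<Sum>l\<in>res. ?w l m) = (\<Sum>m\<in>res - {0}. sc (\<chi> m (- 1 / m)) (So x))"
  proof (intro sum.cong refl)
    fix m assume "m \<in> res - {0}"
    then have m: "unit_elt m" using res_unit by blast
    have "(\<Sum>l\<in>res. ?w l m) = sc (\<chi> m (- 1 / m)) (\<Sum>l\<in>res. act (um (1 / m)) (act (um l) (act sm x)))"
      unfolding scale_sum_right
      using xV by (intro sum.cong refl arg_cong[of _ _ "sc _"] act_eq) (auto simp: algebra_simps)
    also have "(\<Sum>l\<in>res. act (um (1 / m)) (act (um l) (act sm x))) = act (um (1 / m)) (So x)"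
      unfolding So_def usum_def using xV by (intro act_sum[symmetric]) auto
    also have "\<dots> = So x"
      using fixedD(2)[OF fixed_So[OF eig_fixed[OF x]], of "1 / m"] m by simp
    finally show "(\<Sum>l\<in>res. ?w l m) = sc (\<chi> m (- 1 / m)) (So x)" .
  qed
  also have "\<dots> = sc (echi \<chi>) (So x)" by (simp add: echi_def scale_sum_left)
  finally show ?thesis by simp
qed

lemma So_zero_eq:
  assumes "eig \<chi> x" "So x = 0"
  shows "x = (\<Sum>m\<in>res - {0}. sc (- \<chi> m (- 1 / m)) (act (um (1 / m)) (act sm x)))"
  using sm_So[OF assms(1)] assms(2) by (simp add: sum_negf eq_neg_iff_add_eq_0)

end

subsection \<open>Borel-equivariant maps at good vectors\<close>

context rep
begin

definition good_vector :: "'v \<Rightarrow> bool" where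
  "good_vector x \<longleftrightarrow> x \<noteq> 0 \<and> Uo x = 0 \<and> (\<exists>\<chi> c. eig \<chi> x \<and> So x = sc c x)"

lemma fixed_central:
  assumes y: "fixed i j y" and z: "z \<noteq> 0" shows "fixed i j (act (dm z z) y)"
proof (rule fixedI)
  note yV = fixedD(1)[OF y]
  show "act (dm z z) y \<in> V" using yV z by simp
  show "act (um b) (act (dm z z) y) = act (dm z z) y" if "vge i b" for b
    using act_eq[of "um b" "dm z z" "dm z z" "um b" y] fixedD(2)[OF y that] yV z by simp
  show "act (dm a d) (act (dm z z) y) = act (dm z z) y"
    if "unit_elt a" "unit_elt d" "vge 1 (a - 1)" "vge 1 (d - 1)" for a d
    using act_eq[of "dm a d" "dm z z" "dm z z" "dm a d" y] fixedD(3)[OF y that(3,4)] yV z that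
    by (simp add: unit_elt_nonzero mult.commute)
  show "act (lm c) (act (dm z z) y) = act (dm z z) y" if "vge j c" for c
    using act_eq[of "lm c" "dm z z" "dm z z" "lm c" y] fixedD(4)[OF y that] yV z by simp
qed

text \<open>The common shape of the two relations between the images of x and Pi x: each use lowers
  the level of lower unipotent invariance. The maximum with 1 meets the bound on j in
  \<open>fixed_um\<close>.\<close>

lemma fixed_um_tm_sum:
  assumes X: "fixed 0 j X" and b: "\<And>i. i \<in> A \<Longrightarrow> vge 0 (b i)"
  shows "fixed 1 (max 1 (j - 1)) (\<Sum>i\<in>A. sc (c i) (act (um (b i)) (act (tm 1) X)))"
  using fixed_mono[OF fixed_tm1[OF X], of 1 "max 1 (j - 1)"] b
  by (intro fixed_sum fixed_scale fixed_um) auto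

end

locale rep_pair = local_field val p + A: rep val p sc V act + B: rep val p sc' V' act'
  for val :: "'f::field \<Rightarrow> int" and p :: nat
    and sc :: "'k::field \<Rightarrow> 'v::ab_group_add \<Rightarrow> 'v" and V act
    and sc' :: "'k \<Rightarrow> 'w::ab_group_add \<Rightarrow> 'w" and V' act'
begin

lemma Borel_Hom_equivariant_at_good_vector:
  assumes \<phi>: "\<phi> \<in> Hom Borel sc V act sc' V' act'" and good: "A.good_vector x" and g: "g \<in> GL2"
  shows "\<phi> (act g x) = act' g (\<phi> x)"
proof -
  have \<phi>_add: "\<phi> (u + w) = \<phi> u + \<phi> w" if "u \<in> V" "w \<in> V" for u w
    using \<phi> that by (simp add: Hom_def lin_on_def)
  have \<phi>_scale: "\<phi> (sc c u) = sc' c (\<phi> u)" if "u \<in> V" for c u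
    using \<phi> that by (simp add: Hom_def lin_on_def)
  have \<phi>V: "\<phi> u \<in> V'" if "u \<in> V" for u using \<phi> that by (auto simp: Hom_def)
  have \<phi>P: "\<phi> (act (a, b, 0, d) u) = act' (a, b, 0, d) (\<phi> u)" if "u \<in> V" "a \<noteq> 0" "d \<noteq> 0" for a b d u
    using \<phi> that by (auto simp: Hom_def equivariant_on_def Borel_def)
  have \<phi>_0: "\<phi> 0 = 0" using \<phi>_scale[of 0 0] by simp
  have \<phi>_sum: "\<phi> (\<Sum>i\<in>I. h i) = (\<Sum>i\<in>I. \<phi> (h i))" if "\<And>i. i \<in> I \<Longrightarrow> h i \<in> V" for I :: "'f set" and h
    using that
  proof (induction I rule: infinite_finite_induct)
    case (insert i I)
    then show ?case using \<phi>_add[of "h i" "sum h I"] by (simp add: A.V_sum)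
  qed (auto simp: \<phi>_0)
  have \<phi>_comb: "\<phi> (\<Sum>i\<in>I. sc (c i) (act (um (b i)) (act (dm z z') u))) =
      (\<Sum>i\<in>I. sc' (c i) (act' (um (b i)) (act' (dm z z') (\<phi> u))))"
    if "u \<in> V" "z \<noteq> 0" "z' \<noteq> 0" for I :: "'f set" and c b z z' u
    using that by (subst \<phi>_sum) (auto simp: \<phi>_scale \<phi>P)
  obtain \<chi> c0 where x0: "x \<noteq> 0" "A.Uo x = 0" "A.eig \<chi> x" "A.So x = sc c0 x"
    using good by (auto simp: A.good_vector_def)
  note xV = A.eig_V[OF x0(3)]
  define y where "y = act pm x"
  have yV: "y \<in> V" using xV by (simp add: y_def)
  have y: "A.eig (flip \<chi>) y" unfolding y_def by (rule A.eig_pm[OF x0(3)])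
  have smx: "act sm x = act (dm 1 (1 / unif)) y"
    unfolding y_def using xV by (simp add: A.act_eq1)
  \<comment> \<open>Both cases express x by the vectors u(b) s x: through \<open>So_zero_eq\<close>
    if S x = 0, and otherwise by dividing S x by its eigenvalue.\<close>
  obtain I :: "'f set" and b c where Ib: "\<And>i. i \<in> I \<Longrightarrow> vge 0 (b i)"
    and x_comb: "x = (\<Sum>i\<in>I. sc (c i) (act (um (b i)) (act sm x)))"
  proof (cases "c0 = 0")
    case True
    then have "A.So x = 0" using x0(4) by simp
    from that[OF _ A.So_zero_eq[OF x0(3) this]] res_unit show thesis
      by (auto simp: unit_elt_vge)
  next
    case False
    have "x = sc (inverse c0) (A.So x)" using x0(4) False by simp
    then have "x = (\<Sum>i\<in>res. sc (inverse c0) (act (um i) (act sm x)))"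
      unfolding A.So_def A.usum_def by (simp add: A.scale_sum_right)
    from that[OF _ this] res_integral show thesis by auto
  qed
  define X where "X = \<phi> x"
  define Y where "Y = \<phi> y"
  have XV: "X \<in> V'" and YV: "Y \<in> V'" using \<phi>V xV yV by (auto simp: X_def Y_def)
  have X_comb: "X = (\<Sum>i\<in>I. sc' (c i) (act' (um (b i)) (act' (dm 1 (1 / unif)) Y)))"
    unfolding X_def Y_def using \<phi>_comb[OF yV, of 1 "1 / unif" c b I] x_comb smx by simp
  have Soy: "A.So y = 0" using x0(2) by (simp add: A.Uo_def y_def)
  have smy: "act sm y = act (dm unif 1) x"
    unfolding y_def using xV by (simp add: A.act_eq1)
  have y_comb: "y = (\<Sum>m\<in>res - {0}. sc (- flip \<chi> m (- 1 / m)) (act (um (1 / m)) (act (dm unif 1) x)))"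
    using A.So_zero_eq[OF y Soy] by (simp add: smy)
  have Y_comb: "Y = (\<Sum>m\<in>res - {0}. sc' (- flip \<chi> m (- 1 / m)) (act' (um (1 / m)) (act' (dm unif 1) X)))"
    unfolding X_def Y_def
    using \<phi>_comb[OF xV, of unif 1 "\<lambda>m. - flip \<chi> m (- 1 / m)" "\<lambda>m. 1 / m" "res - {0}"] y_comb by simp
  have inv: "vge 0 (1 / m)" if "m \<in> res - {0}" for m
    using unit_elt_divide[OF unit_elt_1 res_unit, of m] that by (auto intro: unit_elt_vge)
  \<comment> \<open>Invariance under upper unipotents and the torus passes through \<phi> because
    these lie in P. Only the lower unipotents remain.\<close>
  have low: "B.fixed 0 j (\<phi> u)"
    if u: "A.fixed 0 1 u" and "\<And>c. vge j c \<Longrightarrow> act' (lm c) (\<phi> u) = \<phi> u" for u j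
  proof (rule B.fixedI)
    note uV = A.fixedD(1)[OF u]
    show "\<phi> u \<in> V'" using uV \<phi>V by blast
    show "act' (um b) (\<phi> u) = \<phi> u" if "vge 0 b" for b
      using \<phi>P[OF uV, of 1 1 b] A.fixedD(2)[OF u that] by simp
    show "act' (dm a d) (\<phi> u) = \<phi> u"
      if "unit_elt a" "unit_elt d" "vge 1 (a - 1)" "vge 1 (d - 1)" for a d
      using \<phi>P[OF uV, of a d 0] A.fixedD(3)[OF u that(3,4)] that by (simp add: unit_elt_nonzero)
  qed (use that in auto)
  note xf = A.eig_fixed[OF x0(3)] and yf = A.eig_fixed[OF y]
  \<comment> \<open>If X has level k + 1, then Y has level k by \<open>Y_comb\<close>, and then X
    has level k by \<open>X_comb\<close>. So one round trip lowers the level of X by one, down to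
    1.\<close>
  have Yfix: "B.fixed 0 k Y" if "B.fixed 0 (k + 1) X" "k \<ge> 1" for k
  proof -
    have "B.fixed 1 (max 1 (k + 1 - 1)) Y"
      using B.fixed_um_tm_sum[OF that(1), of "res - {0}" "\<lambda>m. 1 / m" "\<lambda>m. - flip \<chi> m (- 1 / m)"]
        Y_comb inv by simp
    then have "act' (lm c) Y = Y" if "vge k c" for c
      using B.fixedD(4)[of 1 k Y c] that \<open>k \<ge> 1\<close> by (simp add: max_def)
    then show ?thesis using low[OF yf] by (simp add: Y_def)
  qed
  have Xfix: "B.fixed 0 k X" if "B.fixed 0 k Y" "k \<ge> 1" for k
  proof -
    let ?u = "inverse unif"
    have "act' (dm 1 (1 / unif)) Y = act' (tm 1) (act' (dm ?u ?u) Y)"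
      using YV by (subst B.act_eq1[of _ _ "dm 1 (1 / unif)"]) (auto simp: field_simps)
    then have "X = (\<Sum>i\<in>I. sc' (c i) (act' (um (b i)) (act' (tm 1) (act' (dm ?u ?u) Y))))"
      using X_comb by simp
    moreover have "B.fixed 0 k (act' (dm ?u ?u) Y)" using B.fixed_central[OF that(1)] by simp
    ultimately have "B.fixed 1 (max 1 (k - 1)) X"
      using B.fixed_um_tm_sum[of k "act' (dm ?u ?u) Y" I b c] Ib by simp
    then have "act' (lm c) X = X" if "vge k c" for c
      using B.fixedD(4)[of 1 "max 1 (k - 1)" X c] vge_mono[OF that, of "max 1 (k - 1)"] \<open>k \<ge> 1\<close> by auto
    then show ?thesis using low[OF xf] by (simp add: X_def)
  qed
  \<comment> \<open>Smoothness of the target supplies the initial level of the descent.\<close>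
  obtain n where n: "n \<ge> 1" "\<And>g. g \<in> Kcong val n \<Longrightarrow> act' g X = X" using B.smooth[OF XV] by auto
  have "act' (lm c) X = X" if "vge n c" for c
    using n(2)[of "lm c"] that by (simp add: Kcong_def close_iff)
  then have "B.fixed 0 n X" using low[OF xf] by (simp add: X_def)
  moreover have "B.fixed 0 1 X" if "B.fixed 0 (int k + 1) X" for k
    using that
  proof (induction k)
    case (Suc k)
    have "B.fixed 0 (int (Suc k)) X"
      using Suc.prems Yfix[of "int (Suc k)"] Xfix[of "int (Suc k)"] by simp
    then show ?case using Suc.IH by (simp add: add.commute)
  qed simp
  ultimately have Xf: "B.fixed 0 1 X" using n(1) by (metis add.commute add_diff_cancel_left' zle_iff_zadd)
  have Xe: "B.eig \<chi> X"
    unfolding B.eig_def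
  proof (intro conjI allI impI Xf)
    fix a d assume u: "unit_elt a" "unit_elt d"
    show "act' (dm a d) X = sc' (\<chi> a d) X"
      using \<phi>P[OF xV, of a d 0] A.eig_act[OF x0(3) u] u xV by (simp add: X_def \<phi>_scale unit_elt_nonzero)
  qed
  \<comment> \<open>U is a sum of translates by elements of P, so \<phi> commutes with it, although
    nothing is known yet about S or Pi separately.\<close>
  have UX: "B.Uo X = 0"
  proof -
    have "B.Uo X = (\<Sum>l\<in>res. sc' 1 (act' (um l) (act' (dm unif 1) X)))"
      using B.Uo_eq[OF XV] by (simp add: B.usum_def)
    also have "\<dots> = \<phi> (\<Sum>l\<in>res. sc 1 (act (um l) (act (dm unif 1) x)))"
      unfolding X_def by (rule \<phi>_comb[symmetric]) (use xV in auto)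
    also have "(\<Sum>l\<in>res. sc 1 (act (um l) (act (dm unif 1) x))) = A.Uo x"
      using A.Uo_eq[OF xV] by (simp add: A.usum_def)
    finally show ?thesis using x0(2) \<phi>_0 by simp
  qed
  \<comment> \<open>\<open>So_zero_eq\<close>, now applied to Pi X in the target, yields the same
    combination of translates of X that expresses Y.\<close>
  have piX: "act' pm X = Y"
  proof -
    have "B.So (act' pm X) = 0" using UX by (simp add: B.Uo_def)
    note B.So_zero_eq[OF B.eig_pm[OF Xe] this]
    moreover have "act' sm (act' pm X) = act' (dm unif 1) X"
      using XV by (simp add: B.act_eq1)
    ultimately show ?thesis using Y_comb by simp
  qed
  obtain a b' c' d where gm: "g = (a, b', c', d)" by (cases g)
  define D where "D = a * d - b' * c'"
  have D: "D \<noteq> 0" using g by (simp add: gm D_def)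
  \<comment> \<open>The bottom row decides the cell: if c' / d is in the maximal ideal, then g lies
    in P I; otherwise d / c' is integral and g lies in P Pi I.\<close>
  show ?thesis
  proof (cases "d \<noteq> 0 \<and> vge 1 (c' / d)")
    case True
    have dec: "mmul (D / d, b', 0, d) (lm (c' / d)) = g"
      using True by (simp add: gm D_def field_simps)
    have "act g x = act (D / d, b', 0, d) (act (lm (c' / d)) x)"
      using True D xV by (intro A.act_eq1[symmetric, OF dec]) auto
    also have "act (lm (c' / d)) x = x" using A.fixedD(4)[OF xf] True by blast
    finally have "\<phi> (act g x) = act' (D / d, b', 0, d) X"
      using \<phi>P[OF xV] True D by (simp add: X_def)
    also have "\<dots> = act' (D / d, b', 0, d) (act' (lm (c' / d)) X)"
      using B.fixedD(4)[OF Xf] True by simp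
    also have "\<dots> = act' g X"
      using True D XV by (intro B.act_eq1[OF dec]) auto
    finally show ?thesis by (simp add: X_def)
  next
    case False
    have c0: "c' \<noteq> 0" using False D by (auto simp: D_def)
    have v: "vge 0 (d / c')"
    proof (cases "d = 0")
      case False
      then have "\<not> vge 1 (c' / d)" using \<open>\<not> (d \<noteq> 0 \<and> vge 1 (c' / d))\<close> by blast
      then show ?thesis using False c0 by (simp add: vge_def val_divide)
    qed simp
    let ?P = "(- D / c', a / unif, 0, c' / unif)"
    have dec: "mmul ?P (mmul pm (um (d / c'))) = g"
      using c0 by (simp add: gm D_def field_simps)
    have "act g x = act ?P (act (mmul pm (um (d / c'))) x)"
      using c0 D xV by (intro A.act_eq1[symmetric, OF dec]) auto
    also have "act (mmul pm (um (d / c'))) x = y"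
      using xV A.fixedD(2)[OF xf v] by (subst A.act_mmul) (auto simp: y_def)
    finally have "\<phi> (act g x) = act' ?P Y"
      using \<phi>P[OF yV] c0 D by (simp add: Y_def)
    also have "Y = act' (mmul pm (um (d / c'))) X"
      using XV B.fixedD(2)[OF Xf v] by (subst B.act_mmul) (auto simp: piX)
    also have "act' ?P \<dots> = act' g X"
      using c0 D XV by (intro B.act_eq1[OF dec]) auto
    finally show ?thesis by (simp add: X_def)
  qed
qed

lemma Borel_Hom_equivariant:
  assumes \<phi>: "\<phi> \<in> Hom Borel sc V act sc' V' act'" and good: "A.good_vector x"
    and irr: "irreducible_rep sc V act"
  shows "\<phi> \<in> Hom GL2 sc V act sc' V' act'"
proof -
  define W where "W = {u\<in>V. \<forall>g\<in>GL2. \<phi> (act g u) = act' g (\<phi> u)}"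
  have \<phi>_add: "\<phi> (u + w) = \<phi> u + \<phi> w" if "u \<in> V" "w \<in> V" for u w
    using \<phi> that by (simp add: Hom_def lin_on_def)
  have \<phi>_scale: "\<phi> (sc c u) = sc' c (\<phi> u)" if "u \<in> V" for c u
    using \<phi> that by (simp add: Hom_def lin_on_def)
  have \<phi>V: "\<phi> u \<in> V'" if "u \<in> V" for u using \<phi> that by (auto simp: Hom_def)
  have \<phi>_0: "\<phi> 0 = 0" using \<phi>_scale[of 0 0] by simp
  have "A.subspace W"
    unfolding W_def
    by (intro A.subspaceI) (auto simp: \<phi>_0 \<phi>_add \<phi>_scale A.act_add B.act_add A.act_scale B.act_scale \<phi>V)
  moreover have "stable GL2 act W"
    unfolding stable_def
  proof (intro ballI)
    fix h :: "'f mat2" and u assume h: "h \<in> GL2" and u: "u \<in> W"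
    have uV: "u \<in> V" using u by (simp add: W_def)
    have "\<phi> (act g (act h u)) = act' g (\<phi> (act h u))" if g: "g \<in> GL2" for g
    proof -
      have "\<phi> (act g (act h u)) = act' (mmul g h) (\<phi> u)"
        using u g h uV by (simp add: W_def flip: A.act_mmul)
      then show ?thesis using u g h uV \<phi>V by (simp add: W_def B.act_mmul)
    qed
    then show "act h u \<in> W" using uV h by (simp add: W_def)
  qed
  moreover have "x \<in> W" "x \<noteq> 0"
    using good Borel_Hom_equivariant_at_good_vector[OF \<phi> good]
    by (auto simp: W_def A.good_vector_def A.eig_V)
  ultimately have "W = V" using irr by (auto simp: irreducible_rep_def W_def)
  then show ?thesis using \<phi> by (auto simp: Hom_def equivariant_on_def W_def)
qed

end

subsection \<open>Fixed vectors of pro-p groups in characteristic p\<close>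

context local_field
begin

text \<open>GL_2 of the ring of integers.\<close>

definition GLO :: "'f mat2 set" where
  "GLO = {(a, b, c, d). vge 0 a \<and> vge 0 b \<and> vge 0 c \<and> vge 0 d \<and> unit_elt (a * d - b * c)}"

fun mcong :: "int \<Rightarrow> 'f mat2 \<Rightarrow> 'f mat2 \<Rightarrow> bool" where
  "mcong n (a, b, c, d) (a', b', c', d') \<longleftrightarrow>
     vge n (a' - a) \<and> vge n (b' - b) \<and> vge n (c' - c) \<and> vge n (d' - d)"

lemma GLO_GL2: "g \<in> GLO \<Longrightarrow> g \<in> GL2"
  by (auto simp: GLO_def GL2_def dest: unit_elt_nonzero)

lemma vge_mult0: "vge n x \<Longrightarrow> vge 0 y \<Longrightarrow> vge n (x * y)" "vge 0 x \<Longrightarrow> vge n y \<Longrightarrow> vge n (x * y)"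
  using vge_mult[of n x 0 y] vge_mult[of 0 x n y] by auto

lemma minv_GLO: assumes "g \<in> GLO" shows "minv g \<in> GLO"
proof -
  obtain a b c d where g: "g = (a, b, c, d)" by (cases g)
  define D where "D = a * d - b * c"
  have D: "unit_elt D" using assms by (simp add: g GLO_def D_def)
  have "d / D * (a / D) - - b / D * (- c / D) = 1 / D"
    using unit_elt_nonzero[OF D] by (simp add: divide_simps) (simp add: D_def algebra_simps)
  then show ?thesis using assms D by (simp add: g GLO_def unit_elt_divide flip: D_def)
qed

lemma mmul_GLO: assumes "g \<in> GLO" "h \<in> GLO" shows "mmul g h \<in> GLO"
proof -
  obtain a b c d where g: "g = (a, b, c, d)" by (cases g)
  obtain a' b' c' d' where h: "h = (a', b', c', d')" by (cases h)
  have "mdet (mmul g h) = (a * d - b * c) * (a' * d' - b' * c')"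
    unfolding mdet_mmul by (simp add: g h)
  then have "unit_elt (mdet (mmul g h))"
    using assms unit_elt_mult by (auto simp: g h GLO_def)
  then show ?thesis using assms by (auto simp: g h GLO_def intro!: vge_add vge_mult0)
qed

lemma mcong_mmul: assumes "g \<in> GLO" "mcong n h h'" shows "mcong n (mmul g h) (mmul g h')"
proof -
  obtain a b c d where g: "g = (a, b, c, d)" by (cases g)
  obtain x y z w where h: "h = (x, y, z, w)" by (cases h)
  obtain x' y' z' w' where h': "h' = (x', y', z', w')" by (cases h')
  have e: "u * t' + v * s' - (u * t + v * s) = u * (t' - t) + v * (s' - s)" for u v t s t' s' :: 'f
    by (simp add: algebra_simps)
  show ?thesis
    using assms by (auto simp: g h h' e GLO_def intro!: vge_add vge_mult0(2))
qed

text \<open>Congruence to 1 modulo a positive power of the maximal ideal forces the determinant to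
  be a unit.\<close>

lemma Kcong_iff: "n \<ge> 1 \<Longrightarrow> k \<in> Kcong val n \<longleftrightarrow> mcong n one2 k"
proof -
  assume n: "n \<ge> 1"
  obtain a b c d where k: "k = (a, b, c, d)" by (cases k)
  have "a * d - b * c \<noteq> 0" if "mcong n one2 k"
  proof -
    have *: "vge n (a - 1)" "vge n (d - 1)" "vge n b" "vge n c" using that by (auto simp: k one2_def)
    have "unit_elt (a * d)" using * by (intro unit_elt_mult unit_elt_of_one_unit[OF n])
    moreover have "vge 1 (b * c)" using n * vge_mult_le[of n b n c 1] by simp
    ultimately have "unit_elt (a * d - b * c)" using unit_elt_cong[of "a * d" "a * d - b * c"] by simp
    then show ?thesis by (rule unit_elt_nonzero)
  qed
  then show ?thesis by (auto simp: k one2_def Kcong_def close_iff)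
qed

lemma mcong_Kcong:
  assumes "g \<in> GLO" "mcong n g h" "n \<ge> 1"
  obtains k where "k \<in> Kcong val n" "h = mmul g k"
proof
  have "mcong n (mmul (minv g) g) (mmul (minv g) h)"
    by (rule mcong_mmul[OF minv_GLO[OF assms(1)] assms(2)])
  then show "mmul (minv g) h \<in> Kcong val n"
    using assms GLO_GL2 by (simp add: mmul_minv Kcong_iff)
  show "h = mmul g (mmul (minv g) h)" using assms GLO_GL2 by (simp add: mmul_minv_cancel)
qed

lemma Kcong_GLO: assumes "k \<in> Kcong val n" "n \<ge> 1" shows "k \<in> GLO"
proof -
  obtain a b c d where k: "k = (a, b, c, d)" by (cases k)
  have *: "vge n (a - 1)" "vge n (d - 1)" "vge n b" "vge n c"
    using assms Kcong_iff[of n k] by (auto simp: k one2_def)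
  have "unit_elt (a * d)" using * by (intro unit_elt_mult unit_elt_of_one_unit[OF assms(2)])
  moreover have "vge 1 (b * c)" using assms(2) * vge_mult_le[of n b n c 1] by simp
  ultimately have "unit_elt (a * d - b * c)" using unit_elt_cong[of "a * d" "a * d - b * c"] by simp
  moreover have "vge 0 a" "vge 0 d"
    using * by (auto intro!: unit_elt_vge unit_elt_of_one_unit[OF assms(2)])
  moreover have "vge 0 b" "vge 0 c"
    using * assms(2) by (auto elim!: vge_mono)
  ultimately show ?thesis by (simp add: k GLO_def)
qed

lemma Kcong_GL2: "k \<in> Kcong val n \<Longrightarrow> k \<in> GL2"
  by (simp add: Kcong_def)

lemma Kcong_mono: "m \<le> n \<Longrightarrow> Kcong val n \<subseteq> Kcong val m"
  unfolding Kcong_def close_iff using vge_mono by auto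

text \<open>\<open>Kcong val n\<close> is normal in GL_2 of the integers, which therefore acts on
  its invariants.\<close>

lemma Kcong_conj_GLO:
  assumes "k \<in> Kcong val n" "n \<ge> 1" "g \<in> GLO"
  obtains k' where "k' \<in> Kcong val n" "mmul k g = mmul g k'"
proof -
  obtain a b c d where g: "g = (a, b, c, d)" by (cases g)
  obtain x y z w where k: "k = (x, y, z, w)" by (cases k)
  have "mcong n one2 k" using assms Kcong_iff by blast
  then have *: "vge n (x - 1)" "vge n (w - 1)" "vge n y" "vge n z" by (auto simp: k one2_def)
  have e: "x * a + y * c - a = (x - 1) * a + y * c" "x * b + y * d - b = (x - 1) * b + y * d"
    "z * a + w * c - c = z * a + (w - 1) * c" "z * b + w * d - d = z * b + (w - 1) * d"
    by (simp_all add: algebra_simps)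
  have "mcong n g (mmul k g)"
    using assms(3) * by (auto simp: g k e GLO_def intro!: vge_add vge_mult0(1))
  then show ?thesis using mcong_Kcong[OF assms(3) _ assms(2)] that by metis
qed

text \<open>Modulo the next level the product of 1 + X and 1 + Y is 1 + X + Y. Together with
  \<open>near_one_power\<close> this makes the layers of the congruence filtration abelian of
  exponent p.\<close>

lemma near_one_mmul:
  assumes "n \<ge> 1" "mcong n one2 (x, y, z, w)" "mcong n one2 (x', y', z', w')"
  shows "mcong (n + 1) (x + x' - 1, y + y', z + z', w + w' - 1) (mmul (x, y, z, w) (x', y', z', w'))"
proof -
  have m: "vge (n + 1) (u * v)" if "vge n u" "vge n v" for u v
    using vge_mult_le[OF that] assms(1) by simp
  have *: "vge n (x - 1)" "vge n (w - 1)" "vge n y" "vge n z"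
    "vge n (x' - 1)" "vge n (w' - 1)" "vge n y'" "vge n z'"
    using assms by (auto simp: one2_def)
  have e: "x * x' + y * z' - (x + x' - 1) = (x - 1) * (x' - 1) + y * z'"
     "x * y' + y * w' - (y + y') = (x - 1) * y' + y * (w' - 1)"
     "z * x' + w * z' - (z + z') = z * (x' - 1) + (w - 1) * z'"
     "z * y' + w * w' - (w + w' - 1) = z * y' + (w - 1) * (w' - 1)"
    by (simp_all add: algebra_simps)
  show ?thesis unfolding mmul.simps mcong.simps e by (intro conjI vge_add m *)
qed

end

context rep
begin

lemma funpow_act:
  assumes "g \<in> GL2" "v \<in> V"
  shows "(mmul g ^^ n) one2 \<in> GL2 \<and> (act g ^^ n) v = act ((mmul g ^^ n) one2) v"
  using assms by (induction n) (auto simp: act_one act_mmul)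

text \<open>Frobenius is injective on a field of characteristic p.\<close>

lemma pth_root_of_one:
  assumes "c ^ p = (1 :: 'k)" shows "c = 1"
proof -
  have "CHAR('k) dvd p" using char_p by (simp add: of_nat_eq_0_iff_char_dvd)
  moreover have "CHAR('k) \<noteq> 1" using of_nat_CHAR[where 'a = 'k]
    by (metis of_nat_1 zero_neq_one)
  ultimately have ch: "CHAR('k) = p" using prime_p by (metis prime_nat_iff)
  have "c ^ p = ((c - 1) + 1) ^ p" by simp
  also have "\<dots> = (c - 1) ^ p + 1 ^ p"
    by (rule freshmans_dream) (use ch prime_p in auto)
  finally have "(c - 1) ^ p = 0" using assms by simp
  then show ?thesis by simp
qed

text \<open>On the invariants of \<open>Kcong val n\<close> the elements of A act by commuting
  operators with p-th power 1. They have a common eigenvector, whose eigenvalues are p-th roots of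
  unity, hence 1. This serves for the layers of the congruence filtration and for the unipotents
  over the residue field.\<close>

lemma fixed_vector_step:
  assumes n: "n \<ge> 1" and A: "finite A" "A \<subseteq> GLO"
    and W: "subspace W" "W \<subseteq> V" "stable GL2 act W"
    and w: "w \<in> W" "w \<noteq> 0" "\<And>k. k \<in> Kcong val n \<Longrightarrow> act k w = w"
    and comm: "\<And>a b. a \<in> A \<Longrightarrow> b \<in> A \<Longrightarrow> mcong n (mmul a b) (mmul b a)"
    and pow: "\<And>a. a \<in> A \<Longrightarrow> mcong n one2 ((mmul a ^^ p) one2)"
  shows "\<exists>v\<in>W. v \<noteq> 0 \<and> (\<forall>k\<in>Kcong val n. act k v = v) \<and> (\<forall>a\<in>A. act a v = v)"
proof -
  define N where "N = {v\<in>W. \<forall>k\<in>Kcong val n. act k v = v}"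
  have NV: "N \<subseteq> V" using W by (auto simp: N_def)
  have N: "subspace N"
    using W subspace_0[OF W(1)] subspace_add[OF W(1)] subspace_scale[OF W(1)]
    by (intro subspaceI) (auto simp: N_def Kcong_GL2 act_add act_scale subset_iff)
  have AG: "a \<in> GL2" if "a \<in> A" for a using that A GLO_GL2 by blast
  have closed: "act a v \<in> N" if a: "a \<in> A" and v: "v \<in> N" for a v
  proof -
    have vV: "v \<in> V" using v NV by blast
    have "act k (act a v) = act a v" if k: "k \<in> Kcong val n" for k
    proof -
      obtain k' where "k' \<in> Kcong val n" "mmul k a = mmul a k'"
        using Kcong_conj_GLO[OF k n] a A by blast
      then have "act k (act a v) = act a (act k' v)"
        using AG[OF a] vV k by (intro act_eq) (auto simp: Kcong_GL2)
      then show ?thesis using \<open>k' \<in> Kcong val n\<close> v by (simp add: N_def)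
    qed
    moreover have "act a v \<in> W" using v W AG[OF a] by (auto simp: N_def stable_def)
    ultimately show ?thesis by (simp add: N_def)
  qed
  have powv: "(act a ^^ p) v = v" if a: "a \<in> A" and v: "v \<in> N" for a v
  proof -
    have "(mmul a ^^ p) one2 \<in> Kcong val n" using pow[OF a] Kcong_iff[OF n] by blast
    then show ?thesis using funpow_act[OF AG[OF a], of v p] v NV by (auto simp: N_def)
  qed
  have "\<exists>v\<in>N. v \<noteq> 0 \<and> (\<forall>a\<in>A. \<exists>c. act a v = sc c v)"
  proof (rule common_eigenvector[OF alg_closed A(1) vector_space_axioms N _ w(2)])
    show "w \<in> N" using w by (auto simp: N_def)
    show "lin_op sc N (act a)" if "a \<in> A" for a
      using closed[OF that] N vector_space_axioms NV AG[OF that]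
      by (auto simp: lin_op_def lin_on_def act_add act_scale subset_iff)
    show "act a (act b v) = act b (act a v)" if a: "a \<in> A" and b: "b \<in> A" and v: "v \<in> N" for a b v
    proof -
      obtain k where k: "k \<in> Kcong val n" "mmul b a = mmul (mmul a b) k"
        using mcong_Kcong[OF _ comm[OF a b] n] a b A mmul_GLO by blast
      have vV: "v \<in> V" using v NV by blast
      have "act b (act a v) = act (mmul (mmul a b) k) v"
        using AG a b vV k by (metis act_mmul)
      also have "\<dots> = act (mmul a b) (act k v)"
        using AG a b vV k Kcong_GL2 by (intro act_mmul) auto
      also have "act k v = v" using k v by (simp add: N_def)
      finally show ?thesis using AG a b vV by (simp add: act_mmul)
    qed
    show "\<exists>m\<ge>1. \<forall>v\<in>N. (act a ^^ m) v = v" if "a \<in> A" for a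
      using powv[OF that] prime_p by (metis prime_ge_1_nat)
  qed (use alg_closed in auto)
  then obtain v where v: "v \<in> N" "v \<noteq> 0" "\<And>a. a \<in> A \<Longrightarrow> \<exists>c. act a v = sc c v" by blast
  have "act a v = v" if a: "a \<in> A" for a
  proof -
    obtain c where c: "act a v = sc c v" using v(3)[OF a] by blast
    have "(act a ^^ m) v = sc (c ^ m) v" for m
    proof (induction m)
      case (Suc m)
      then show ?case using v(1) NV AG[OF a] c by (auto simp: act_scale mult.commute)
    qed simp
    then have "sc (c ^ p) v = sc 1 v" using powv[OF a v(1)] by simp
    then have "c ^ p = 1" using v(2) by (metis scale_cancel_right)
    then have "c = 1" by (rule pth_root_of_one)
    then show ?thesis using c by simp
  qed
  then show ?thesis using v by (auto simp: N_def)
qed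

lemma near_one_power:
  assumes n: "n \<ge> 1" and X: "vge n x" "vge n y" "vge n z" "vge n w"
  shows "mcong (n + 1) (1 + of_nat j * x, of_nat j * y, of_nat j * z, 1 + of_nat j * w)
    ((mmul (1 + x, y, z, 1 + w) ^^ j) one2)"
proof (induction j)
  case 0
  then show ?case by (simp add: one2_def)
next
  case (Suc j)
  obtain a b c d where h: "(mmul (1 + x, y, z, 1 + w) ^^ j) one2 = (a, b, c, d)"
    by (cases "(mmul (1 + x, y, z, 1 + w) ^^ j) one2")
  have IH: "vge (n + 1) (a - (1 + of_nat j * x))" "vge (n + 1) (b - of_nat j * y)"
     "vge (n + 1) (c - of_nat j * z)" "vge (n + 1) (d - (1 + of_nat j * w))"
    using Suc h by auto
  have J: "vge n (of_nat j * u)" if "vge n u" for u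
    using vge_mult[OF vge_of_nat that] by simp
  have near: "vge n (s - t)" if "vge (n + 1) (s - (t + of_nat j * u))" "vge n u" for s t u
    using vge_add[OF vge_mono[OF that(1), of n] J[OF that(2)]] by (simp add: algebra_simps)
  have "mcong n one2 (a, b, c, d)"
    using near[OF IH(1) X(1)] near[of b 0 y] near[of c 0 z] near[OF IH(4) X(4)] IH X by (simp add: one2_def)
  moreover have "mcong n one2 (1 + x, y, z, 1 + w)" using X by (simp add: one2_def)
  ultimately have m: "mcong (n + 1) (1 + x + a - 1, y + b, z + c, 1 + w + d - 1) (mmul (1 + x, y, z, 1 + w) (a, b, c, d))"
    using near_one_mmul[OF n] by blast
  obtain a' b' c' d' where h': "mmul (1 + x, y, z, 1 + w) (a, b, c, d) = (a', b', c', d')"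
    by (cases "mmul (1 + x, y, z, 1 + w) (a, b, c, d)")
  have one: "vge (n + 1) (s - (1 + of_nat (Suc j) * u))"
    if "vge (n + 1) (r - (1 + of_nat j * u))" "vge (n + 1) (s - (1 + u + r - 1))" for r s u
    using vge_add[OF that] by (simp add: algebra_simps)
  have zero: "vge (n + 1) (s - of_nat (Suc j) * u)"
    if "vge (n + 1) (r - of_nat j * u)" "vge (n + 1) (s - (u + r))" for r s u
    using vge_add[OF that] by (simp add: algebra_simps)
  show ?case
    using m one[OF IH(1)] zero[OF IH(2)] zero[OF IH(3)] one[OF IH(4)]
    unfolding funpow.simps o_apply h h' mcong.simps by blast
qed

text \<open>One layer of the filtration: the set A of the proof represents
  \<open>Kcong val n\<close> modulo \<open>Kcong val (n + 1)\<close>.\<close>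

lemma ex_Kcong_fixed:
  assumes W: "subspace W" "W \<subseteq> V" "stable GL2 act W" and n: "n \<ge> 1"
    and w: "w \<in> W" "w \<noteq> 0" "\<forall>k\<in>Kcong val (n + 1). act k w = w"
  shows "\<exists>v\<in>W. v \<noteq> 0 \<and> (\<forall>k\<in>Kcong val n. act k v = v)"
proof -
  define f where "f = (\<lambda>(x, y, z, w). (1 + unif ^ nat n * x, unif ^ nat n * y, unif ^ nat n * z, 1 + unif ^ nat n * w))"
  define A where "A = f ` (res \<times> res \<times> res \<times> res)"
  have v: "vge n (unif ^ nat n * x)" if "vge 0 x" for x using that n by simp
  have A: "\<exists>x y z w. a = (1 + x, y, z, 1 + w) \<and> vge n x \<and> vge n y \<and> vge n z \<and> vge n w" if "a \<in> A" for a
    using that v res_integral unfolding A_def f_def by fastforce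
  then have AK: "A \<subseteq> Kcong val n" using Kcong_iff[OF n] by (fastforce simp: one2_def)
  have "\<exists>v\<in>W. v \<noteq> 0 \<and> (\<forall>k\<in>Kcong val (n + 1). act k v = v) \<and> (\<forall>a\<in>A. act a v = v)"
  proof (rule fixed_vector_step[OF _ _ _ W w(1,2)])
    show "finite A" by (simp add: A_def finite_res)
    show "A \<subseteq> GLO" using AK Kcong_GLO n by blast
    show "mcong (n + 1) (mmul a b) (mmul b a)" if "a \<in> A" "b \<in> A" for a b
    proof -
      obtain x y z w where a: "a = (x, y, z, w)" by (cases a)
      obtain x' y' z' w' where b: "b = (x', y', z', w')" by (cases b)
      have ab: "mcong n one2 a" "mcong n one2 b" using AK that Kcong_iff[OF n] by blast+
      obtain r s t u where ab1: "mmul a b = (r, s, t, u)" by (cases "mmul a b")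
      obtain r' s' t' u' where ba: "mmul b a = (r', s', t', u')" by (cases "mmul b a")
      have *: "vge (n + 1) (i' - i)" if "vge (n + 1) (i - k)" "vge (n + 1) (i' - k)" for i i' k
        using vge_diff[OF that(2,1)] by simp
      have "mcong (n + 1) (x + x' - 1, y + y', z + z', w + w' - 1) (r, s, t, u)"
        using near_one_mmul[OF n ab[unfolded a b]] by (simp only: ab1 flip: a b)
      moreover have "mcong (n + 1) (x + x' - 1, y + y', z + z', w + w' - 1) (r', s', t', u')"
        using near_one_mmul[OF n ab(2)[unfolded b] ab(1)[unfolded a]]
        by (simp only: ba add.commute[of x' x] add.commute[of y' y] add.commute[of z' z] add.commute[of w' w] flip: a b)
      ultimately show ?thesis unfolding ab1 ba mcong.simps
        using *[of r _ r'] *[of s _ s'] *[of t _ t'] *[of u _ u'] by blast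
    qed
    show "mcong (n + 1) one2 ((mmul a ^^ p) one2)" if aA: "a \<in> A" for a
    proof -
      obtain x y z w where a: "a = (1 + x, y, z, 1 + w)" "vge n x" "vge n y" "vge n z" "vge n w"
        using A[OF aA] by blast
      obtain r s t u where h: "(mmul a ^^ p) one2 = (r, s, t, u)" by (cases "(mmul a ^^ p) one2")
      have P: "vge (n + 1) (of_nat p * i)" if "vge n i" for i
        using vge_mult[OF vge_p that] by (simp add: add.commute)
      have *: "vge (n + 1) (k - j)" if "vge (n + 1) (k - (j + of_nat p * i))" "vge n i" for k j i
        using vge_add[OF that(1) P[OF that(2)]] by (simp add: algebra_simps)
      note m = near_one_power[OF n a(2-5), of p, folded a(1), unfolded h]
      show ?thesis using m *[of r 1 x] *[of u 1 w] *[of s 0 y] *[of t 0 z] a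
        unfolding h by (simp add: one2_def)
    qed
  qed (use n w in auto)
  then obtain v where v: "v \<in> W" "v \<noteq> 0" "\<forall>k\<in>Kcong val (n + 1). act k v = v" "\<forall>a\<in>A. act a v = v" by blast
  have "act k v = v" if k: "k \<in> Kcong val n" for k
  proof -
    obtain x y z w where kk: "k = (x, y, z, w)" by (cases k)
    have kv: "vge n (x - 1)" "vge n y" "vge n z" "vge n (w - 1)"
      using k Kcong_iff[OF n] by (auto simp: kk one2_def)
    define r where "r u = rrep (u / unif ^ nat n)" for u
    have r: "r u \<in> res" "vge (n + 1) (u - unif ^ nat n * r u)" if "vge n u" for u
    proof -
      have v0: "vge 0 (u / unif ^ nat n)" using that n by simp
      then show "r u \<in> res" by (simp add: r_def rrep_res)
      have "vge (n + 1) (unif ^ nat n * (u / unif ^ nat n - r u))"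
        using rrep_close[OF v0] n by (simp add: r_def del: vge_unif_power(3))
      then show "vge (n + 1) (u - unif ^ nat n * r u)" by (simp add: right_diff_distrib)
    qed
    define a where "a = f (r (x - 1), r y, r z, r (w - 1))"
    have aA: "a \<in> A" using r(1) kv by (auto simp: a_def A_def)
    have "mcong (n + 1) a k"
      using r(2)[OF kv(1)] r(2)[OF kv(2)] r(2)[OF kv(3)] r(2)[OF kv(4)]
      by (simp add: a_def f_def kk algebra_simps)
    then obtain k' where k': "k' \<in> Kcong val (n + 1)" "k = mmul a k'"
      using mcong_Kcong[of a "n + 1" k] Kcong_GLO[of a n] AK aA n by (metis add_increasing2 subsetD zero_le_one)
    have "act k v = act a (act k' v)"
      unfolding k' using v W AK aA k' by (intro act_mmul) (auto simp: Kcong_GL2)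
    then show ?thesis using v k' aA by simp
  qed
  then show ?thesis using v by blast
qed

text \<open>Descend through the filtration to level 1, then add the unipotents u(l) with l in
  \<open>res\<close>; together with \<open>Kcong val 1\<close> they generate the pro-p Iwahori
  subgroup.\<close>

lemma ex_fixed:
  assumes W: "subspace W" "W \<subseteq> V" "stable GL2 act W" and w: "w \<in> W" "w \<noteq> 0"
  shows "\<exists>v\<in>W. v \<noteq> 0 \<and> fixed 0 1 v"
proof -
  have "\<exists>v\<in>W. v \<noteq> 0 \<and> (\<forall>k\<in>Kcong val 1. act k v = v)"
  proof -
    obtain n where n: "n \<ge> 1" "\<forall>k\<in>Kcong val n. act k w = w" using smooth w W by blast
    have "\<exists>v\<in>W. v \<noteq> 0 \<and> (\<forall>k\<in>Kcong val 1. act k v = v)"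
      if "\<exists>v\<in>W. v \<noteq> 0 \<and> (\<forall>k\<in>Kcong val (int m + 1). act k v = v)" for m
      using that
    proof (induction m)
      case (Suc m)
      then show ?case using ex_Kcong_fixed[OF W, of "int m + 1"] by (auto simp: algebra_simps)
    qed simp
    from this[of "nat (n - 1)"] show ?thesis using n w by auto
  qed
  then obtain v where v: "v \<in> W" "v \<noteq> 0" "\<And>k. k \<in> Kcong val 1 \<Longrightarrow> act k v = v" by blast
  have pw: "(mmul (um l) ^^ j) one2 = um (of_nat j * l)" for l :: 'f and j
    by (induction j) (auto simp: one2_def algebra_simps)
  have "\<exists>v\<in>W. v \<noteq> 0 \<and> (\<forall>k\<in>Kcong val 1. act k v = v) \<and> (\<forall>a\<in>um ` res. act a v = v)"
  proof (rule fixed_vector_step[OF _ _ _ W v])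
    show "um ` res \<subseteq> GLO" using res_integral by (auto simp: GLO_def)
    show "mcong 1 one2 ((mmul a ^^ p) one2)" if "a \<in> um ` res" for a
      using that vge_mult[OF vge_p, of 0] res_integral by (auto simp: pw) (auto simp: one2_def)
  qed (auto simp: finite_res add.commute)
  then obtain u where u: "u \<in> W" "u \<noteq> 0" "\<And>k. k \<in> Kcong val 1 \<Longrightarrow> act k u = u"
    "\<And>l. l \<in> res \<Longrightarrow> act (um l) u = u" by auto
  have uV: "u \<in> V" using u W by blast
  have "fixed 0 1 u"
  proof (rule fixedI[OF uV])
    show "act (um b) u = u" if b: "vge 0 b" for b
    proof -
      have "act (um b) u = act (um (rrep b)) (act (um (b - rrep b)) u)"
        using uV by (intro act_eq1[symmetric]) auto
      also have "act (um (b - rrep b)) u = u"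
        using rrep_close[OF b] by (intro u(3)) (simp add: Kcong_iff one2_def)
      finally show ?thesis using u(4)[OF rrep_res[OF b]] by simp
    qed
  qed (auto intro!: u(3) simp: Kcong_iff one2_def)
  then show ?thesis using u by blast
qed

text \<open>The torus over the residue field acts on the pro-p Iwahori invariants by commuting
  operators of finite order. The eigenvalues of a common eigenvector define \<chi>.\<close>

lemma ex_eig:
  assumes "V \<noteq> {0}"
  shows "\<exists>\<chi> x. eig \<chi> x \<and> x \<noteq> 0"
proof -
  obtain w where "w \<in> V" "w \<noteq> 0" using assms V_0 by blast
  then obtain w where w: "fixed 0 1 w" "w \<noteq> 0"
    using ex_fixed[OF subspace_V] by (auto simp: stable_def)
  define M where "M = {w. fixed 0 1 w}"
  define A where "A = (\<lambda>(l, m). dm l m) ` ((res - {0}) \<times> (res - {0}))"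
  have MV: "M \<subseteq> V" by (auto simp: M_def fixed_def)
  have A: "\<exists>l m. a = dm l m \<and> unit_elt l \<and> unit_elt m" if "a \<in> A" for a
    using that res_unit by (auto simp: A_def)
  have AG: "a \<in> GL2" if "a \<in> A" for a using A[OF that] by (auto simp: unit_elt_nonzero)
  have closed: "act a v \<in> M" if aA: "a \<in> A" and "v \<in> M" for a v
  proof -
    obtain l m where a: "a = dm l m" "unit_elt l" "unit_elt m" using A[OF aA] by blast
    have v: "fixed 0 1 v" using that by (simp add: M_def)
    have lm: "l \<noteq> 0" "m \<noteq> 0" using a by (auto simp: unit_elt_nonzero)
    note vV = fixedD(1)[OF v]
    have "fixed 0 1 (act (dm l m) v)"
    proof (rule fixedI)
      show "act (dm l m) v \<in> V" using vV lm by simp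
      show "act (um b) (act (dm l m) v) = act (dm l m) v" if "vge 0 b" for b
      proof -
        have "act (um b) (act (dm l m) v) = act (dm l m) (act (um (b * (m / l))) v)"
          using vV lm by (intro act_eq) auto
        then show ?thesis using fixedD(2)[OF v] that a unit_elt_divide[of m l] by simp
      qed
      show "act (dm b c) (act (dm l m) v) = act (dm l m) v"
        if "unit_elt b" "unit_elt c" "vge 1 (b - 1)" "vge 1 (c - 1)" for b c
      proof -
        have "act (dm b c) (act (dm l m) v) = act (dm l m) (act (dm b c) v)"
          using vV lm that by (intro act_eq) (auto simp: unit_elt_nonzero)
        then show ?thesis using fixedD(3)[OF v] that by simp
      qed
      show "act (lm c) (act (dm l m) v) = act (dm l m) v" if "vge 1 c" for c
      proof -
        have "act (lm c) (act (dm l m) v) = act (dm l m) (act (lm (c * (l / m))) v)"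
          using vV lm by (intro act_eq) auto
        then show ?thesis using fixedD(4)[OF v] that a unit_elt_divide[of l m] by simp
      qed
    qed
    then show ?thesis by (simp add: M_def a)
  qed
  obtain n :: nat where n: "n \<ge> 1" "\<And>a. unit_elt a \<Longrightarrow> vge 1 (a ^ n - 1)" using ex_unit_order by blast
  have pw: "(mmul (dm l m) ^^ j) one2 = dm (l ^ j) (m ^ j)" for l m :: 'f and j
    by (induction j) (auto simp: one2_def)
  have "\<exists>v\<in>M. v \<noteq> 0 \<and> (\<forall>a\<in>A. \<exists>c. act a v = sc c v)"
  proof (rule common_eigenvector[OF alg_closed _ vector_space_axioms _ _ w(2)])
    show "finite A" by (simp add: A_def finite_res)
    show "subspace M" unfolding M_def by (rule subspace_fixed)
    show "w \<in> M" using w by (simp add: M_def)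
    show "lin_op sc M (act a)" if "a \<in> A" for a
      using closed[OF that] \<open>subspace M\<close> vector_space_axioms MV AG[OF that]
      by (auto simp: lin_op_def lin_on_def act_add act_scale subset_iff)
    show "act a (act b v) = act b (act a v)" if ab: "a \<in> A" "b \<in> A" and "v \<in> M" for a b v
    proof (rule act_eq)
      show "mmul a b = mmul b a" using A[OF ab(1)] A[OF ab(2)] by (auto simp: mult.commute)
    qed (use AG ab that MV in auto)
    show "\<exists>m\<ge>1. \<forall>v\<in>M. (act a ^^ m) v = v" if aA: "a \<in> A" for a
    proof (intro exI[of _ n] conjI ballI n(1))
      fix v assume v: "v \<in> M"
      obtain l m where a: "a = dm l m" "unit_elt l" "unit_elt m" using A[OF aA] by blast
      have "(act a ^^ n) v = act (dm (l ^ n) (m ^ n)) v"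
        using funpow_act[OF AG[OF aA], of v n] v MV pw by (auto simp: a)
      also have "\<dots> = v" using fixedD(3)[of 0 1 v] v n(2) a by (simp add: M_def)
      finally show "(act a ^^ n) v = v" .
    qed
  qed auto
  then obtain v where v: "v \<in> M" "v \<noteq> 0" "\<And>a. a \<in> A \<Longrightarrow> \<exists>c. act a v = sc c v" by blast
  \<comment> \<open>Reading off values at the residues of a and d suffices because 1-units of the
    torus act trivially.\<close>
  define \<chi> where "\<chi> a d = (SOME c. act (dm (rrep a) (rrep d)) v = sc c v)" for a d
  have vf: "fixed 0 1 v" using v by (simp add: M_def)
  have "eig \<chi> v"
    unfolding eig_def
  proof (intro conjI allI impI vf)
    fix a d assume u: "unit_elt a" "unit_elt d"
    have l: "rrep a \<in> res - {0}" "rrep d \<in> res - {0}" using u rrep_unit by auto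
    then have lu: "unit_elt (rrep a)" "unit_elt (rrep d)" using res_unit by auto
    have "\<exists>c. act (dm (rrep a) (rrep d)) v = sc c v" using l by (intro v(3)) (auto simp: A_def)
    then have c: "act (dm (rrep a) (rrep d)) v = sc (\<chi> a d) v" unfolding \<chi>_def by (rule someI_ex)
    have q: "vge 1 (b / rrep b - 1)" if "unit_elt b" for b
    proof -
      have r: "unit_elt (rrep b)" using rrep_unit[OF that] res_unit by blast
      have "b / rrep b - 1 = (b - rrep b) / rrep b" using unit_elt_nonzero[OF r] by (simp add: diff_divide_distrib)
      then show ?thesis using rrep_close[of b] that r unit_elt_vge by simp
    qed
    have "act (dm a d) v = act (dm (rrep a) (rrep d)) (act (dm (a / rrep a) (d / rrep d)) v)"
      using u lu fixedD(1)[OF vf] by (intro act_eq1[symmetric]) (auto simp: unit_elt_nonzero)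
    then show "act (dm a d) v = sc (\<chi> a d) v"
      using fixedD(3)[OF vf q[OF u(1)] q[OF u(2)]] c by simp
  qed
  then show ?thesis using v by blast
qed

end

declare split_paired_All [simp del] split_paired_Ex [simp del]

subsection \<open>Compact induction from the Iwahori subgroup times the centre\<close>

context local_field
begin

text \<open>The conditions are relative to \<open>val a\<close>: dividing by a scalar of that
  valuation gives an element of the Iwahori subgroup, so no product with the centre has to be
  written.\<close>

definition IZ :: "'f mat2 set" where
  "IZ = {(a, b, c, d). a \<noteq> 0 \<and> d \<noteq> 0 \<and> val d = val a \<and> vge (val a) b \<and> vge (val a + 1) c}"

lemma val_add_eq: "x \<noteq> 0 \<Longrightarrow> vge (val x + 1) y \<Longrightarrow> x + y \<noteq> 0 \<and> val (x + y) = val x"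
proof -
  assume x: "x \<noteq> 0" and y: "vge (val x + 1) y"
  show ?thesis
  proof (cases "y = 0")
    case False
    then have vy: "val y \<ge> val x + 1" using y by (simp add: vge_def)
    have nz: "x + y \<noteq> 0"
    proof
      assume "x + y = 0"
      then have "y = - x" by (simp add: eq_neg_iff_add_eq_0 add.commute)
      then show False using vy by simp
    qed
    have "val (x + y) \<ge> val x" using val_add[OF x False nz] vy by simp
    moreover have "val x \<ge> min (val (x + y)) (val y)"
      using val_add[of "x + y" "- y"] x False nz by simp
    ultimately show ?thesis using vy nz by simp
  qed (use x in simp)
qed

lemma val_diff_eq: "x \<noteq> 0 \<Longrightarrow> vge (val x + 1) y \<Longrightarrow> x - y \<noteq> 0 \<and> val (x - y) = val x"
  using val_add_eq[of x "- y"] by simp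

lemma vge_divide: "y \<noteq> 0 \<Longrightarrow> vge n (x / y) \<longleftrightarrow> vge (n + val y) x"
  by (cases "x = 0") (auto simp: vge_def val_divide)

lemma IZ_det: assumes "(a, b, c, d) \<in> IZ" shows "a * d - b * c \<noteq> 0" "val (a * d - b * c) = 2 * val a"
proof -
  have *: "a \<noteq> 0" "d \<noteq> 0" "val d = val a" "vge (val a) b" "vge (val a + 1) c" using assms by (auto simp: IZ_def)
  have "vge (val (a * d) + 1) (b * c)" using vge_mult[OF *(4,5)] * by (simp add: val_mult algebra_simps)
  then show "a * d - b * c \<noteq> 0" "val (a * d - b * c) = 2 * val a"
    using val_diff_eq[of "a * d" "b * c"] * by (auto simp: val_mult)
qed

lemma IZ_GL2: "g \<in> IZ \<Longrightarrow> g \<in> GL2"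
  using IZ_det by (cases g) auto

lemma IZ_mmul: assumes "g \<in> IZ" "h \<in> IZ" shows "mmul g h \<in> IZ"
proof -
  obtain a b c d where g: "g = (a, b, c, d)" by (cases g)
  obtain a' b' c' d' where h: "h = (a', b', c', d')" by (cases h)
  have *: "a \<noteq> 0" "d \<noteq> 0" "val d = val a" "vge (val a) b" "vge (val a + 1) c" using assms by (auto simp: g IZ_def)
  have **: "a' \<noteq> 0" "d' \<noteq> 0" "val d' = val a'" "vge (val a') b'" "vge (val a' + 1) c'" using assms by (auto simp: h IZ_def)
  have va: "vge (val a) a" "vge (val a) d" "vge (val a') a'" "vge (val a') d'" using * ** by (auto simp: vge_def)
  have 1: "a * a' + b * c' \<noteq> 0 \<and> val (a * a' + b * c') = val a + val a'"
    using val_add_eq[of "a * a'" "b * c'"] vge_mult[OF *(4) **(5)] * ** by (simp add: val_mult algebra_simps)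
  have 2: "d * d' + c * b' \<noteq> 0 \<and> val (d * d' + c * b') = val a + val a'"
    using val_add_eq[of "d * d'" "c * b'"] vge_mult[OF *(5) **(4)] * ** by (simp add: val_mult algebra_simps)
  have 3: "vge (val a + val a') (a * b' + b * d')"
    using vge_mult[OF va(1) **(4)] vge_mult[OF *(4) va(4)] by auto
  have 4: "vge (val a + val a' + 1) (c * a' + d * c')"
    using vge_mult[OF *(5) va(3)] vge_mult[OF va(2) **(5)] by (auto simp: algebra_simps)
  show ?thesis using 1 2 3 4 by (simp add: g h IZ_def add.commute)
qed

lemma IZ_minv: assumes "g \<in> IZ" shows "minv g \<in> IZ"
proof -
  obtain a b c d where g: "g = (a, b, c, d)" by (cases g)
  note D = IZ_det[OF assms[unfolded g]]
  show ?thesis using assms D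
    by (simp add: g IZ_def val_divide vge_divide)
qed

lemma one2_IZ: "one2 \<in> IZ"
  by (simp add: IZ_def one2_def)

lemma Kcong_IZ: "k \<in> Kcong val 1 \<Longrightarrow> k \<in> IZ"
  using unit_elt_of_one_unit[of 1] by (auto simp: Kcong_iff one2_def IZ_def unit_elt_def intro: vge_mono)

text \<open>The extension of a character of the integral torus to IZ sending the scalar unif to wp.\<close>

definition psi :: "('f \<Rightarrow> 'f \<Rightarrow> 'k::field) \<Rightarrow> 'k \<Rightarrow> 'f mat2 \<Rightarrow> 'k" where
  "psi \<chi> wp = (\<lambda>(a, b, c, d). wp powi val a * \<chi> (a / unif powi val a) (d / unif powi val a))"

text \<open>The condition that makes \<open>psi\<close> a character of \<open>IZ\<close> trivial on
  the pro-p radical. It is obtained from a nonzero eigenvector through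
  \<open>eig_jchar\<close>.\<close>

definition jchar :: "('f \<Rightarrow> 'f \<Rightarrow> 'k::field) \<Rightarrow> 'k \<Rightarrow> bool" where
  "jchar \<chi> wp \<longleftrightarrow> (\<forall>g\<in>IZ. \<forall>h\<in>IZ. psi \<chi> wp (mmul g h) = psi \<chi> wp g * psi \<chi> wp h) \<and>
     (\<forall>a d. vge 1 (a - 1) \<longrightarrow> vge 1 (d - 1) \<longrightarrow> \<chi> a d = 1)"

text \<open>Generator of the compact induction of \<open>psi\<close> from \<open>IZ\<close>; the
  compact induction itself appears as the cyclic subrepresentation
  \<open>cyc (delta \<chi> wp)\<close> of \<open>Fun\<close>.\<close>

definition delta :: "('f \<Rightarrow> 'f \<Rightarrow> 'k::field) \<Rightarrow> 'k \<Rightarrow> 'f mat2 \<Rightarrow> 'k" where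
  "delta \<chi> wp g = (if g \<in> IZ then psi \<chi> wp g else 0)"

text \<open>The ambient representation, under right translation, of compact inductions and principal
  series alike.\<close>

definition Fun :: "('f mat2 \<Rightarrow> 'k::field) set" where
  "Fun = {f. (\<forall>g. g \<notin> GL2 \<longrightarrow> f g = 0) \<and> (\<exists>n\<ge>1. \<forall>k\<in>Kcong val n. \<forall>g\<in>GL2. f (mmul g k) = f g)}"

lemma psi_integral: "val a = 0 \<Longrightarrow> psi \<chi> wp (a, b, c, d) = \<chi> a d"
  by (simp add: psi_def)

lemma jchar_mult: "jchar \<chi> wp \<Longrightarrow> g \<in> IZ \<Longrightarrow> h \<in> IZ \<Longrightarrow> psi \<chi> wp (mmul g h) = psi \<chi> wp g * psi \<chi> wp h"
  and jchar_one: "jchar \<chi> wp \<Longrightarrow> vge 1 (a - 1) \<Longrightarrow> vge 1 (d - 1) \<Longrightarrow> \<chi> a d = 1"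
  by (auto simp: jchar_def)

lemma psi_one: "jchar \<chi> wp \<Longrightarrow> psi \<chi> wp one2 = 1"
  by (simp add: one2_def psi_integral jchar_one)

lemma psi_nonzero: "jchar \<chi> wp \<Longrightarrow> g \<in> IZ \<Longrightarrow> psi \<chi> wp g \<noteq> 0"
  using jchar_mult[of \<chi> wp "minv g" g] IZ_minv[of g] mmul_minv[OF IZ_GL2, of g] psi_one[of \<chi> wp] by auto

lemma delta_mult_left:
  assumes "jchar \<chi> wp" "g \<in> IZ" "h \<in> GL2"
  shows "delta \<chi> wp (mmul g h) = psi \<chi> wp g * delta \<chi> wp h"
proof -
  have "mmul g h \<in> IZ \<longleftrightarrow> h \<in> IZ"
    using IZ_mmul[OF assms(2), of h] IZ_mmul[OF IZ_minv[OF assms(2)], of "mmul g h"] mmul_minv_cancel(1)[OF IZ_GL2[OF assms(2)], of h]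
    by auto
  then show ?thesis using jchar_mult[OF assms(1,2)] by (simp add: delta_def)
qed

lemma delta_mult_right:
  assumes "jchar \<chi> wp" "g \<in> IZ" "h \<in> GL2"
  shows "delta \<chi> wp (mmul h g) = psi \<chi> wp g * delta \<chi> wp h"
proof -
  have "mmul h g \<in> IZ \<longleftrightarrow> h \<in> IZ"
    using IZ_mmul[of h g] IZ_mmul[of "mmul h g" "minv g"] IZ_minv[OF assms(2)] assms(2) mmul_minv(2)[OF IZ_GL2[OF assms(2)]]
    by (auto simp: mmul_assoc)
  then show ?thesis using jchar_mult[OF assms(1) _ assms(2)] by (simp add: delta_def)
qed

lemma vge_mult_eq: "x \<noteq> 0 \<Longrightarrow> vge n (x * y) \<longleftrightarrow> vge (n - val x) y"
  by (cases "y = 0") (auto simp: vge_def val_mult)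

text \<open>This makes right translation by an arbitrary g preserve the smoothness of functions in
  \<open>Fun\<close>.\<close>

lemma Kcong_conj:
  assumes "g \<in> GL2" "n \<ge> 1"
  shows "\<exists>m\<ge>1. \<forall>k\<in>Kcong val m. \<exists>k'\<in>Kcong val n. mmul k g = mmul g k'"
proof -
  obtain a b c d where g: "g = (a, b, c, d)" by (cases g)
  define D where "D = a * d - b * c"
  have D: "D \<noteq> 0" using assms by (simp add: g D_def)
  \<comment> \<open>r bounds the valuations of the entries of g from below. The entries of g^-1 (k -
    1) g are sums of terms s u t / D with s, t among the entries of g up to sign and u an entry of k
    - 1, whence the bound m.\<close>
  define r where "r = min (min (min (val a) (val b)) (min (val c) (val d))) 0"
  have r: "vge r a" "vge r b" "vge r c" "vge r d" by (auto simp: r_def vge_def)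
  define m where "m = max 1 (n + val D - 2 * r)"
  have m: "m \<ge> 1" "n + val D \<le> (r + m) + r" by (auto simp: m_def)
  have "\<exists>k'\<in>Kcong val n. mmul k g = mmul g k'" if k: "k \<in> Kcong val m" for k
  proof
    obtain x y z w where kk: "k = (x, y, z, w)" by (cases k)
    have k1: "vge m (x - 1)" "vge m (w - 1)" "vge m y" "vge m z"
      using k Kcong_iff[OF m(1)] by (auto simp: kk one2_def)
    define k' where "k' = mmul (minv g) (mmul k g)"
    have q: "vge n (s * u * t / D)" if "vge r s" "vge m u" "vge r t" for s u t
      using vge_mult_le[OF vge_mult_le[OF that(1,2) order_refl] that(3) m(2)] D by (simp add: vge_divide)
    have e: "d / D * (x * a + y * c) + - b / D * (z * a + w * c) =
        1 + (d * (x - 1) * a / D + d * y * c / D - b * z * a / D - b * (w - 1) * c / D)"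
      "- c / D * (x * b + y * d) + a / D * (z * b + w * d) =
        1 + (a * z * b / D + a * (w - 1) * d / D - c * (x - 1) * b / D - c * y * d / D)"
      using D by (simp_all add: divide_simps) (simp_all add: D_def algebra_simps)
    have e': "d / D * (x * b + y * d) + - b / D * (z * b + w * d) =
        d * (x - 1) * b / D + d * y * d / D - b * z * b / D - b * (w - 1) * d / D"
      "- c / D * (x * a + y * c) + a / D * (z * a + w * c) =
        a * z * a / D + a * (w - 1) * c / D - c * (x - 1) * a / D - c * y * c / D"
      using D by (simp_all add: divide_simps) (simp_all add: algebra_simps)
    have "k' = (1 + (d * (x - 1) * a / D + d * y * c / D - b * z * a / D - b * (w - 1) * c / D),
      d * (x - 1) * b / D + d * y * d / D - b * z * b / D - b * (w - 1) * d / D,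
      a * z * a / D + a * (w - 1) * c / D - c * (x - 1) * a / D - c * y * c / D,
      1 + (a * z * b / D + a * (w - 1) * d / D - c * (x - 1) * b / D - c * y * d / D))"
      unfolding k'_def g kk minv.simps mmul.simps D_def[symmetric] e e' ..
    then have "mcong n one2 k'"
      using q r k1 by (auto simp: one2_def intro!: vge_add vge_diff)
    then show "k' \<in> Kcong val n" using Kcong_iff[OF assms(2)] by blast
    show "mmul k g = mmul g k'" using assms by (simp add: k'_def mmul_minv_cancel)
  qed
  then show ?thesis using m(1) by blast
qed

end

lemma vector_space_ind_scale: "vector_space (ind_scale :: 'k::field \<Rightarrow> ('f::field mat2 \<Rightarrow> 'k) \<Rightarrow> _)"
  by unfold_locales (auto simp: ind_scale_def fun_eq_iff algebra_simps)

lemma ind_scale_apply [simp]: "ind_scale c f g = c * f g"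
  by (simp add: ind_scale_def)

lemma ind_act_apply [simp]: "h \<in> GL2 \<Longrightarrow> ind_act g f h = f (mmul h g)"
  by (simp add: ind_act_def)

lemma ind_act_outside: "h \<notin> GL2 \<Longrightarrow> ind_act g f h = 0"
  by (simp add: ind_act_def)

section \<open>The representation on smooth functions\<close>

context local_field
begin

lemma Fun_outside: "f \<in> Fun \<Longrightarrow> g \<notin> GL2 \<Longrightarrow> f g = 0"
  unfolding Fun_def by blast

lemma Fun_eqI: "f \<in> Fun \<Longrightarrow> f' \<in> Fun \<Longrightarrow> (\<And>g. g \<in> GL2 \<Longrightarrow> f g = f' g) \<Longrightarrow> f = f'"
  using Fun_outside by (metis ext)

lemma smooth_rep_Fun: "smooth_rep val (ind_scale :: 'k::field \<Rightarrow> _) Fun ind_act"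
proof -
  interpret vector_space "ind_scale :: 'k \<Rightarrow> ('f mat2 \<Rightarrow> 'k) \<Rightarrow> _" by (rule vector_space_ind_scale)
  have sub: "subspace (Fun :: ('f mat2 \<Rightarrow> 'k) set)"
  proof (intro subspaceI)
    show "0 \<in> (Fun :: ('f mat2 \<Rightarrow> 'k) set)" by (auto simp: Fun_def)
    fix f f' :: "'f mat2 \<Rightarrow> 'k" assume f: "f \<in> Fun" "f' \<in> Fun"
    then obtain n n' where n: "n \<ge> 1" "\<forall>k\<in>Kcong val n. \<forall>g\<in>GL2. f (mmul g k) = f g"
      "n' \<ge> 1" "\<forall>k\<in>Kcong val n'. \<forall>g\<in>GL2. f' (mmul g k) = f' g" by (auto simp: Fun_def)
    have "(f + f') (mmul g k) = (f + f') g" if k: "k \<in> Kcong val (max n n')" and g: "g \<in> GL2" for g k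
    proof -
      have "k \<in> Kcong val n" "k \<in> Kcong val n'"
        using k Kcong_mono[of n "max n n'"] Kcong_mono[of n' "max n n'"] by auto
      then show ?thesis using n g by simp
    qed
    then show "f + f' \<in> Fun" using f n unfolding Fun_def by (intro CollectI conjI allI impI exI[of _ "max n n'"]) auto
  next
    show "ind_scale c f \<in> Fun" if "f \<in> Fun" for c and f :: "'f mat2 \<Rightarrow> 'k"
      using that by (auto simp: Fun_def)
  qed
  have "ind_act g f \<in> Fun" if g: "g \<in> GL2" and f: "f \<in> Fun" for g and f :: "'f mat2 \<Rightarrow> 'k"
  proof -
    obtain n where n: "n \<ge> 1" "\<forall>k\<in>Kcong val n. \<forall>g\<in>GL2. f (mmul g k) = f g"
      using f by (auto simp: Fun_def)
    obtain m where m: "m \<ge> 1" "\<forall>k\<in>Kcong val m. \<exists>k'\<in>Kcong val n. mmul k g = mmul g k'"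
      using Kcong_conj[OF g n(1)] by blast
    have "ind_act g f (mmul h k) = ind_act g f h" if k: "k \<in> Kcong val m" and h: "h \<in> GL2" for h k
    proof -
      obtain k' where k': "k' \<in> Kcong val n" "mmul k g = mmul g k'" using m k by blast
      then have "f (mmul (mmul h k) g) = f (mmul (mmul h g) k')" by (simp add: mmul_assoc)
      also have "\<dots> = f (mmul h g)" using n k' g h by blast
      finally show ?thesis using h k Kcong_GL2 by simp
    qed
    then show ?thesis using m(1) by (auto simp: Fun_def ind_act_outside)
  qed
  moreover have "ind_act one2 f = f" if "f \<in> Fun" for f :: "'f mat2 \<Rightarrow> 'k"
    using Fun_outside[OF that] by (auto simp: ind_act_def fun_eq_iff)
  moreover have "ind_act (mmul g h) f = ind_act g (ind_act h f)"
    if "g \<in> GL2" "h \<in> GL2" for g h and f :: "'f mat2 \<Rightarrow> 'k"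
    using that by (auto simp: ind_act_def fun_eq_iff mmul_assoc)
  moreover have "\<exists>n\<ge>1. \<forall>g\<in>Kcong val n. ind_act g f = f" if f: "f \<in> Fun" for f :: "'f mat2 \<Rightarrow> 'k"
  proof -
    obtain n where n: "n \<ge> 1" "\<forall>k\<in>Kcong val n. \<forall>g\<in>GL2. f (mmul g k) = f g"
      using f by (auto simp: Fun_def)
    then have "\<forall>g\<in>Kcong val n. ind_act g f = f" using Fun_outside[OF f] by (auto simp: ind_act_def fun_eq_iff)
    then show ?thesis using n by blast
  qed
  ultimately show ?thesis
    unfolding smooth_rep_def using vector_space_ind_scale sub
    by (auto simp: stable_def lin_on_def fun_eq_iff ind_act_def)
qed

lemma rep_Fun: "alg_closure_Fp p TYPE('k::field) \<Longrightarrow> rep val p (ind_scale :: 'k \<Rightarrow> _) Fun ind_act"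
  by unfold_locales (auto intro: smooth_rep_Fun)

end

section \<open>Cyclic subrepresentations and the action of \<open>IZ\<close> on eigenvectors\<close>

context rep
begin

definition cyc :: "'v \<Rightarrow> 'v set" where "cyc x = span ((\<lambda>g. act g x) ` GL2)"

lemma subspace_cyc: "subspace (cyc x)" by (simp add: cyc_def)

lemma cyc_minimal: "subspace W \<Longrightarrow> stable GL2 act W \<Longrightarrow> x \<in> W \<Longrightarrow> cyc x \<subseteq> W"
  unfolding cyc_def by (rule span_minimal) (auto simp: stable_def)

lemma cyc_subset: "x \<in> V \<Longrightarrow> cyc x \<subseteq> V"
  by (rule cyc_minimal[OF subspace_V]) (auto simp: stable_def)

lemma cyc_self: "x \<in> V \<Longrightarrow> x \<in> cyc x"
  unfolding cyc_def using act_one by (intro span_base) (force intro!: image_eqI[of _ _ one2])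

lemma stable_cyc: assumes "x \<in> V" shows "stable GL2 act (cyc x)"
  unfolding stable_def
proof (intro ballI)
  fix g :: "'f mat2" and v assume g: "g \<in> GL2" and v: "v \<in> cyc x"
  have "cyc x \<subseteq> {v\<in>V. act g v \<in> cyc x}"
    unfolding cyc_def
  proof (rule span_minimal)
    show "(\<lambda>g. act g x) ` GL2 \<subseteq> {v \<in> V. act g v \<in> span ((\<lambda>g. act g x) ` GL2)}"
      using assms g by (auto simp flip: act_mmul intro!: span_base)
    show "subspace {v \<in> V. act g v \<in> span ((\<lambda>g. act g x) ` GL2)}"
      using g by (intro subspaceI) (auto simp: act_add act_scale span_zero intro: span_add span_scale)
  qed
  then show "act g v \<in> cyc x" using v by blast
qed

lemma irreducible_cyc: "irreducible_rep sc V act \<Longrightarrow> x \<in> V \<Longrightarrow> x \<noteq> 0 \<Longrightarrow> cyc x = V"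
  unfolding irreducible_rep_def
  using subspace_cyc[of x] cyc_subset[of x] stable_cyc[of x] cyc_self[of x] by (metis singletonD)

lemma stable_So:
  assumes W: "subspace W" "stable GL2 act W" and x: "x \<in> W"
  shows "So x \<in> W" "Uo x \<in> W"
proof -
  have "So x \<in> W" if "x \<in> W" for x
    unfolding So_def usum_def using W that by (intro subspace_sum) (auto simp: stable_def)
  moreover have "act pm x \<in> W" using W x by (auto simp: stable_def)
  ultimately show "So x \<in> W" "Uo x \<in> W" using x by (auto simp: Uo_def)
qed

lemma central_powi:
  assumes x: "x \<in> V" "x \<noteq> 0" and wp: "act (dm unif unif) x = sc wp x"
  shows "wp \<noteq> 0" "act (dm (unif powi n) (unif powi n)) x = sc (wp powi n) x"
proof -
  show wp0: "wp \<noteq> 0"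
  proof
    assume "wp = 0"
    then have "act (dm unif unif) x = 0" using wp by simp
    then show False using act_inj[of "dm unif unif" x] x by simp
  qed
  have pos: "act (dm (unif ^ m) (unif ^ m)) x = sc (wp ^ m) x" for m
  proof (induction m)
    case 0
    then show ?case using act_one x by (simp add: one2_def)
  next
    case (Suc m)
    have "act (dm (unif ^ Suc m) (unif ^ Suc m)) x = act (dm unif unif) (act (dm (unif ^ m) (unif ^ m)) x)"
      using x by (intro act_eq1[symmetric]) auto
    then show ?case using Suc wp x by (simp add: act_scale mult.commute)
  qed
  show "act (dm (unif powi n) (unif powi n)) x = sc (wp powi n) x"
  proof (cases "n \<ge> 0")
    case True
    then show ?thesis using pos by (simp add: power_int_def)
  next
    case False
    define m where "m = nat (- n)"
    have n: "unif powi n = inverse (unif ^ m)" "wp powi n = inverse (wp ^ m)"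
      using False by (auto simp: power_int_def m_def power_inverse)
    have "act (dm (unif powi n) (unif powi n)) (act (dm (unif ^ m) (unif ^ m)) x) = act one2 x"
      using x by (intro act_eq1) (auto simp: n one2_def)
    then have "sc (wp ^ m) (act (dm (unif powi n) (unif powi n)) x) = x"
      using pos[of m] x act_one by (simp add: act_scale n)
    then have "sc (inverse (wp ^ m)) (sc (wp ^ m) (act (dm (unif powi n) (unif powi n)) x)) = sc (inverse (wp ^ m)) x" by simp
    then show ?thesis using wp0 n by simp
  qed
qed

lemma IZ_eig:
  assumes x: "eig \<chi> x" "x \<noteq> 0" and wp: "act (dm unif unif) x = sc wp x" and g: "g \<in> IZ"
  shows "act g x = sc (psi \<chi> wp g) x"
proof -
  obtain a b c d where gg: "g = (a, b, c, d)" by (cases g)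
  have *: "a \<noteq> 0" "d \<noteq> 0" "val d = val a" "vge (val a) b" "vge (val a + 1) c" using g by (auto simp: gg IZ_def)
  define z where "z = unif powi val a"
  have z: "z \<noteq> 0" "val z = val a"
    by (auto simp: z_def power_int_def val_power val_inverse)
  note xV = eig_V[OF x(1)]
  \<comment> \<open>In the Iwahori factorisation below, e is the 1-unit that corrects the
    determinant; it acts trivially on x.\<close>
  define e where "e = 1 - b * c / (a * d)"
  have "vge 1 (b * c / (a * d))"
    using vge_mult[OF *(4,5)] * by (simp add: vge_divide val_mult algebra_simps)
  then have e1: "vge 1 (e - 1)" by (simp add: e_def)
  then have e0: "e \<noteq> 0" using unit_elt_of_one_unit[of 1 e] unit_elt_nonzero by simp
  have az: "unit_elt (a / z)" "unit_elt (d / z)" using * z by (auto simp: unit_elt_def val_divide)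
  have dec: "g = mmul (mmul (dm z z) (um (b / d))) (mmul (dm (a / z) (d / z)) (mmul (dm e 1) (lm (c / d))))"
    using * z by (simp add: gg e_def field_simps)
  have "act g x = act (dm z z) (act (um (b / d)) (act (dm (a / z) (d / z)) (act (dm e 1) (act (lm (c / d)) x))))"
    unfolding dec using * z e0 xV by (simp add: act_mmul del: mmul.simps)
  also have "act (lm (c / d)) x = x"
    using fixedD(4)[OF eig_fixed[OF x(1)], of "c / d"] * by (simp add: vge_divide add.commute)
  also have "act (dm e 1) x = x" using fixedD(3)[OF eig_fixed[OF x(1)] e1, of 1] by simp
  also have "act (dm (a / z) (d / z)) x = sc (\<chi> (a / z) (d / z)) x" using eig_act[OF x(1) az] .
  also have "act (um (b / d)) (sc (\<chi> (a / z) (d / z)) x) = sc (\<chi> (a / z) (d / z)) x"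
    using fixedD(2)[OF eig_fixed[OF x(1)], of "b / d"] * xV by (simp add: act_scale vge_divide)
  also have "act (dm z z) \<dots> = sc (\<chi> (a / z) (d / z)) (sc (wp powi val a) x)"
    using central_powi(2)[OF xV x(2) wp, of "val a"] xV z(1) by (subst act_scale) (auto simp: z_def)
  finally show ?thesis by (simp add: gg psi_def z_def mult.commute)
qed

text \<open>Multiplicativity is forced by the action on a nonzero vector.\<close>

lemma eig_jchar:
  assumes x: "eig \<chi> x" "x \<noteq> 0" and wp: "act (dm unif unif) x = sc wp x"
  shows "jchar \<chi> wp"
  unfolding jchar_def
proof (intro conjI ballI allI impI)
  note xV = eig_V[OF x(1)]
  fix g h assume g: "g \<in> IZ" "h \<in> IZ"
  have "sc (psi \<chi> wp (mmul g h)) x = act g (act h x)"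
    using IZ_eig[OF x wp IZ_mmul[OF g]] xV g IZ_GL2 by (simp add: act_mmul)
  also have "\<dots> = sc (psi \<chi> wp g * psi \<chi> wp h) x"
    using IZ_eig[OF x wp] g xV IZ_GL2 by (simp add: act_scale mult.commute)
  finally show "psi \<chi> wp (mmul g h) = psi \<chi> wp g * psi \<chi> wp h" using x(2) by (metis scale_cancel_right)
next
  fix a d assume "vge 1 (a - 1)" "vge 1 (d - 1)"
  then have "sc (\<chi> a d) x = sc 1 x"
    using eig_act[OF x(1), of a d] fixedD(3)[OF eig_fixed[OF x(1)]] unit_elt_of_one_unit[of 1] by simp
  then show "\<chi> a d = 1" using x(2) by (metis scale_cancel_right)
qed

end

lemma sum_fun_apply: "(\<Sum>i\<in>A. f i) x = (\<Sum>i\<in>A. f i x)"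
  by (induction A rule: infinite_finite_induct) auto

section \<open>Products of representations, whose cyclic subrepresentations serve as graphs\<close>

context rep_pair
begin

definition psc :: "'k \<Rightarrow> 'v \<times> 'w \<Rightarrow> 'v \<times> 'w" where "psc c z = (sc c (fst z), sc' c (snd z))"
definition pact :: "'f mat2 \<Rightarrow> 'v \<times> 'w \<Rightarrow> 'v \<times> 'w" where "pact g z = (act g (fst z), act' g (snd z))"

lemma psc_simps [simp]: "fst (psc c z) = sc c (fst z)" "snd (psc c z) = sc' c (snd z)"
  and pact_simps [simp]: "fst (pact g z) = act g (fst z)" "snd (pact g z) = act' g (snd z)"
  by (simp_all add: psc_def pact_def)

lemma smooth_rep_pair: "smooth_rep val psc (V \<times> V') pact"
proof -
  have vs: "vector_space psc"
    by unfold_locales (auto simp: prod_eq_iff A.scale_right_distrib A.scale_left_distrib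
        B.scale_right_distrib B.scale_left_distrib)
  interpret vector_space psc by (rule vs)
  have "subspace (V \<times> V')"
    by (intro subspaceI) (auto simp: psc_def mem_Times_iff)
  moreover have "\<exists>n\<ge>1. \<forall>g\<in>Kcong val n. pact g z = z" if z: "z \<in> V \<times> V'" for z
  proof -
    obtain n m where n: "n \<ge> 1" "\<forall>g\<in>Kcong val n. act g (fst z) = fst z"
      "m \<ge> 1" "\<forall>g\<in>Kcong val m. act' g (snd z) = snd z"
      using A.smooth[of "fst z"] B.smooth[of "snd z"] z by (auto simp: mem_Times_iff)
    have "pact g z = z" if "g \<in> Kcong val (max n m)" for g
      using n that Kcong_mono[of n "max n m"] Kcong_mono[of m "max n m"] by (auto simp: prod_eq_iff)
    then show ?thesis using n by (intro exI[of _ "max n m"]) auto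
  qed
  ultimately show ?thesis
    unfolding smooth_rep_def using vs
    by (auto simp: stable_def lin_on_def prod_eq_iff mem_Times_iff A.act_add B.act_add A.act_scale
        B.act_scale A.act_one B.act_one A.act_mmul B.act_mmul)
qed

sublocale P: rep val p psc "V \<times> V'" pact
  by unfold_locales (rule A.coeff, rule smooth_rep_pair)

lemma pair_fixed: "P.fixed i j z \<longleftrightarrow> A.fixed i j (fst z) \<and> B.fixed i j (snd z)"
  unfolding P.fixed_def A.fixed_def B.fixed_def by (auto simp: prod_eq_iff mem_Times_iff)

lemma pair_usum: "P.usum z = (A.usum (fst z), B.usum (snd z))"
  by (simp add: prod_eq_iff P.usum_def A.usum_def B.usum_def fst_sum snd_sum)

lemma pair_So: "P.So z = (A.So (fst z), B.So (snd z))"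
  by (simp add: P.So_def A.So_def B.So_def pair_usum)

lemma pair_Uo: "P.Uo z = (A.Uo (fst z), B.Uo (snd z))"
  by (simp add: P.Uo_def A.Uo_def B.Uo_def pair_So)

lemma pair_eig: "P.eig \<chi> z \<longleftrightarrow> A.eig \<chi> (fst z) \<and> B.eig \<chi> (snd z)"
  unfolding P.eig_def A.eig_def B.eig_def pair_fixed by (auto simp: prod_eq_iff)

text \<open>Seen as a graph, the cyclic subrepresentation has the one generated by
  \<open>fst z\<close> as its domain; \<open>cyc_snd\<close> identifies the image.\<close>

lemma cyc_fst: assumes "z \<in> V \<times> V'" shows "fst ` P.cyc z = A.cyc (fst z)"
proof
  have "P.cyc z \<subseteq> {u. fst u \<in> A.cyc (fst z)}"
  proof (rule P.cyc_minimal)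
    show "stable GL2 pact {u. fst u \<in> A.cyc (fst z)}"
      using A.stable_cyc[of "fst z"] assms by (auto simp: stable_def mem_Times_iff)
    show "P.subspace {u. fst u \<in> A.cyc (fst z)}"
      using A.subspace_cyc[of "fst z"]
      by (intro P.subspaceI) (auto intro: A.subspace_add A.subspace_scale A.subspace_0)
  qed (use A.cyc_self[of "fst z"] assms in \<open>auto simp: mem_Times_iff\<close>)
  then show "fst ` P.cyc z \<subseteq> A.cyc (fst z)" by auto
  show "A.cyc (fst z) \<subseteq> fst ` P.cyc z"
  proof (rule A.cyc_minimal)
    show "A.subspace (fst ` P.cyc z)"
    proof (intro A.subspaceI)
      show "0 \<in> fst ` P.cyc z" using P.subspace_0[OF P.subspace_cyc[of z]] by force
      show "u + v \<in> fst ` P.cyc z" if "u \<in> fst ` P.cyc z" "v \<in> fst ` P.cyc z" for u v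
        using that P.subspace_add[OF P.subspace_cyc[of z]] by (force simp flip: fst_add)
      show "sc c u \<in> fst ` P.cyc z" if u: "u \<in> fst ` P.cyc z" for c u
      proof -
        obtain y where y: "y \<in> P.cyc z" "u = fst y" using u by blast
        then show ?thesis
          using P.subspace_scale[OF P.subspace_cyc[of z] y(1), of c] image_eqI[of "sc c u" fst "psc c y"] by simp
      qed
    qed
    show "stable GL2 act (fst ` P.cyc z)"
      using P.stable_cyc[OF assms] by (force simp: stable_def simp flip: pact_simps)
    show "fst z \<in> fst ` P.cyc z" using P.cyc_self[OF assms] by blast
  qed
qed

lemma cyc_snd: assumes "z \<in> V \<times> V'" shows "snd ` P.cyc z = B.cyc (snd z)"
proof
  have "P.cyc z \<subseteq> {u. snd u \<in> B.cyc (snd z)}"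
  proof (rule P.cyc_minimal)
    show "stable GL2 pact {u. snd u \<in> B.cyc (snd z)}"
      using B.stable_cyc[of "snd z"] assms by (auto simp: stable_def mem_Times_iff)
    show "P.subspace {u. snd u \<in> B.cyc (snd z)}"
      using B.subspace_cyc[of "snd z"]
      by (intro P.subspaceI) (auto intro: B.subspace_add B.subspace_scale B.subspace_0)
  qed (use B.cyc_self[of "snd z"] assms in \<open>auto simp: mem_Times_iff\<close>)
  then show "snd ` P.cyc z \<subseteq> B.cyc (snd z)" by auto
  show "B.cyc (snd z) \<subseteq> snd ` P.cyc z"
  proof (rule B.cyc_minimal)
    show "B.subspace (snd ` P.cyc z)"
    proof (intro B.subspaceI)
      show "0 \<in> snd ` P.cyc z" using P.subspace_0[OF P.subspace_cyc[of z]] by force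
      show "u + v \<in> snd ` P.cyc z" if "u \<in> snd ` P.cyc z" "v \<in> snd ` P.cyc z" for u v
        using that P.subspace_add[OF P.subspace_cyc[of z]] by (force simp flip: snd_add)
      show "sc' c u \<in> snd ` P.cyc z" if u: "u \<in> snd ` P.cyc z" for c u
      proof -
        obtain y where y: "y \<in> P.cyc z" "u = snd y" using u by blast
        then show ?thesis
          using P.subspace_scale[OF P.subspace_cyc[of z] y(1), of c] image_eqI[of "sc' c u" snd "psc c y"] by simp
      qed
    qed
    show "stable GL2 act' (snd ` P.cyc z)"
      using P.stable_cyc[OF assms] by (force simp: stable_def simp flip: pact_simps)
    show "snd z \<in> snd ` P.cyc z" using P.cyc_self[OF assms] by blast
  qed
qed

end

context local_field
begin

lemma delta_outside: "h \<notin> GL2 \<Longrightarrow> delta \<chi> wp h = 0"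
  using IZ_GL2[of h] by (auto simp: delta_def)

lemma delta_Fun: assumes "jchar \<chi> wp" shows "delta \<chi> wp \<in> Fun"
proof -
  have "delta \<chi> wp (mmul g k) = delta \<chi> wp g" if k: "k \<in> Kcong val 1" and "g \<in> GL2" for g k
  proof -
    obtain a b c d where kk: "k = (a, b, c, d)" by (cases k)
    have u: "vge 1 (a - 1)" "vge 1 (d - 1)" using k by (auto simp: kk Kcong_iff one2_def)
    then have "val a = 0" using unit_elt_of_one_unit[of 1 a] by (simp add: unit_elt_def)
    then have "psi \<chi> wp k = 1" using jchar_one[OF assms u] by (simp add: kk psi_integral)
    then show ?thesis using delta_mult_right[OF assms Kcong_IZ[OF k] that(2)] by simp
  qed
  then show ?thesis
    unfolding Fun_def using delta_outside by (intro CollectI conjI allI impI exI[of _ 1] ballI) auto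
qed

lemma ind_act_delta:
  assumes "jchar \<chi> wp" "j \<in> IZ" shows "ind_act j (delta \<chi> wp) = ind_scale (psi \<chi> wp j) (delta \<chi> wp)"
proof
  fix h show "ind_act j (delta \<chi> wp) h = ind_scale (psi \<chi> wp j) (delta \<chi> wp) h"
    using delta_mult_right[OF assms, of h] by (cases "h \<in> GL2") (simp_all add: ind_act_outside delta_outside)
qed

lemma delta_eig:
  assumes j: "jchar \<chi> wp" and F: "rep val p (ind_scale :: 'k::field \<Rightarrow> _) Fun ind_act"
  shows "rep.eig val ind_scale Fun ind_act \<chi> (delta \<chi> wp :: 'f mat2 \<Rightarrow> 'k)"
proof -
  interpret F: rep val p "ind_scale :: 'k \<Rightarrow> _" Fun ind_act by (rule F)
  have i: "act1 = 1 \<Longrightarrow> ind_scale act1 (delta \<chi> wp) = delta \<chi> wp" for act1 :: 'k by (simp add: ind_scale_def)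
  have one: "\<chi> 1 1 = 1" using jchar_one[OF j] by simp
  have "F.fixed 0 1 (delta \<chi> wp)"
  proof (rule F.fixedI[OF delta_Fun[OF j]])
    show "ind_act (um b) (delta \<chi> wp) = delta \<chi> wp" if "vge 0 b" for b
      using that one by (subst ind_act_delta[OF j]) (auto simp: IZ_def psi_integral i)
    show "ind_act (dm a d) (delta \<chi> wp) = delta \<chi> wp"
      if "unit_elt a" "unit_elt d" "vge 1 (a - 1)" "vge 1 (d - 1)" for a d
      using that jchar_one[OF j that(3,4)] by (subst ind_act_delta[OF j]) (auto simp: IZ_def unit_elt_def psi_integral i)
    show "ind_act (lm c) (delta \<chi> wp) = delta \<chi> wp" if "vge 1 c" for c
      using that one by (subst ind_act_delta[OF j]) (auto simp: IZ_def psi_integral i)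
  qed
  then show ?thesis
    by (auto simp: F.eig_def ind_act_delta[OF j] IZ_def unit_elt_def psi_integral)
qed

lemma delta_central:
  assumes j: "jchar \<chi> wp"
  shows "ind_act (dm unif unif) (delta \<chi> wp) = ind_scale wp (delta \<chi> wp)"
  using jchar_one[OF j, of 1 1] by (subst ind_act_delta[OF j]) (auto simp: IZ_def psi_def)

lemma delta_one: "jchar \<chi> wp \<Longrightarrow> delta \<chi> wp one2 = 1"
  using one2_IZ psi_one by (simp add: delta_def)

end

locale fun_pair = rep_pair val p "ind_scale :: 'k \<Rightarrow> ('f mat2 \<Rightarrow> 'k) \<Rightarrow> _" "local_field.Fun val" ind_act sc V act
  for val :: "'f::field \<Rightarrow> int" and p :: nat
    and sc :: "'k::field \<Rightarrow> 'v::ab_group_add \<Rightarrow> 'v" and V act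
begin

text \<open>Since delta generates the compact induction of psi from IZ freely, it maps to every vector on which IZ acts by psi.\<close>

lemma delta_free:
  assumes j: "jchar \<chi> wp" and x: "x \<in> V" "\<And>g. g \<in> IZ \<Longrightarrow> act g x = sc (psi \<chi> wp g) x"
    and w: "(0, w) \<in> P.cyc (delta \<chi> wp, x)"
  shows "w = 0"
proof -
  let ?d = "delta \<chi> wp"
  obtain t r where t: "finite t" "t \<subseteq> (\<lambda>g. pact g (?d, x)) ` GL2" and eq: "(0, w) = (\<Sum>a\<in>t. psc (r a) a)"
    using w unfolding P.cyc_def P.span_explicit by blast
  have "(\<Sum>a\<in>t. sc (r a) (snd a)) = 0"
  proof (rule sum_zero_class_split[where F = fst, OF B.vector_space_axioms t(1)])
    fix a assume "a \<in> t"
    then obtain g where g: "g \<in> GL2" "a = pact g (?d, x)" using t by blast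
    show "\<exists>z. fst a z \<noteq> 0 \<and>
        (\<forall>b\<in>t. fst b z = 0 \<or> (\<exists>c. (\<forall>h. fst b h = c * fst a h) \<and> snd b = sc c (snd a)))"
    \<comment> \<open>The translate of delta by g is supported on the coset of \<open>IZ\<close>
      through g^-1. So two translates are proportional or have disjoint supports, and g^-1 is a
      point to test at.\<close>
    proof (intro exI[of _ "minv g"] conjI ballI)
      show "fst a (minv g) \<noteq> 0" using g delta_one[OF j] by (simp add: mmul_minv)
      fix b assume "b \<in> t"
      then obtain h where h: "h \<in> GL2" "b = pact h (?d, x)" using t by blast
      define i where "i = mmul (minv g) h"
      show "fst b (minv g) = 0 \<or> (\<exists>c. (\<forall>h. fst b h = c * fst a h) \<and> snd b = sc c (snd a))"
      proof (cases "i \<in> IZ")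
        case False
        then show ?thesis using g h by (simp add: delta_def i_def)
      next
        case True
        have hi: "h = mmul g i" using g h by (simp add: i_def mmul_minv_cancel)
        have "fst b = ind_scale (psi \<chi> wp i) (fst a)"
          using g h True hi IZ_GL2 delta_Fun[OF j] ind_act_delta[OF j True] by (simp add: A.act_mmul A.act_scale)
        moreover have "snd b = sc (psi \<chi> wp i) (snd a)"
          using g h True hi IZ_GL2 x by (simp add: B.act_mmul B.act_scale)
        ultimately show ?thesis by auto
      qed
    qed
  next
    fix h
    have "0 = (\<Sum>a\<in>t. ind_scale (r a) (fst a))" using arg_cong[OF eq, of fst] by (simp add: fst_sum)
    from fun_cong[OF this, of h] show "(\<Sum>a\<in>t. r a * fst a h) = 0" by (simp add: sum_fun_apply)
  qed
  moreover have "w = (\<Sum>a\<in>t. sc (r a) (snd a))" using arg_cong[OF eq, of snd] by (simp add: snd_sum)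
  ultimately show ?thesis by simp
qed

end

lemma (in rep) fun_pair: "fun_pair val p sc V act"
  by (intro fun_pair.intro rep_pair.intro rep_Fun coeff) unfold_locales

subsection \<open>Eigenvectors of U and principal series\<close>

context local_field
begin

text \<open>Representatives of the integers modulo \<open>unif ^ n\<close> as digit expansions. The
  new digit is the lowest one, which matches applying U last in \<open>Uo_pow\<close>.\<close>

primrec resn :: "nat \<Rightarrow> 'f set" where
  "resn 0 = {0}"
| "resn (Suc n) = (\<lambda>(l, a). l + unif * a) ` (res \<times> resn n)"

lemma finite_resn: "finite (resn n)"
  by (induction n) (auto simp: finite_res)

lemma resn_integral: "a \<in> resn n \<Longrightarrow> vge 0 a"
proof (induction n arbitrary: a)
  case (Suc n)
  then obtain l b where "l \<in> res" "b \<in> resn n" "a = l + unif * b" by auto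
  then show ?case using Suc.IH[of b] res_integral[of l] vge_mono[of 0 b "-1"] by auto
qed simp

lemma inj_on_resn: "inj_on (\<lambda>(l, a). l + unif * a) (res \<times> resn n)"
proof (rule inj_onI, clarify)
  fix l a l' a' assume *: "l \<in> res" "a \<in> resn n" "l' \<in> res" "a' \<in> resn n" "l + unif * a = l' + unif * a'"
  have "l - l' = unif * (a' - a)" using *(5) by (simp add: algebra_simps)
  then have "vge 1 (l - l')" using resn_integral *(2,4) by (simp add: vge_diff)
  then have "l = l'" using * res_eqI by blast
  then show "l = l' \<and> a = a'" using * by simp
qed

lemma resn_eq_0: "a \<in> resn n \<Longrightarrow> vge (int n) a \<Longrightarrow> a = 0"
proof (induction n arbitrary: a)
  case (Suc n)
  then obtain l b where a: "l \<in> res" "b \<in> resn n" "a = l + unif * b" by auto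
  have v: "vge 1 a" using Suc.prems(2) by (rule vge_mono) simp
  have "vge 1 (unif * b)" using resn_integral[OF a(2)] by simp
  then have "vge 1 (l - 0)" using vge_diff[OF v, of "unif * b"] a(3) by simp
  then have l: "l = 0" using res_eqI[OF a(1) zero_res] by blast
  then have "vge (int n) b" using Suc.prems(2) a(3) by simp
  then show ?case using Suc.IH[OF a(2)] a(3) l by simp
qed simp

lemma zero_resn: "0 \<in> resn n"
  by (induction n) (auto simp: zero_res intro!: image_eqI[of _ _ "(0, 0)"])

end

context rep
begin

lemma Uo_pow:
  assumes x: "x \<in> V"
  shows "(Uo ^^ n) x = (\<Sum>a\<in>resn n. act (unif ^ n, a, 0, 1) x)"
proof (induction n)
  case 0
  then show ?case using act_one[OF x] by (simp add: one2_def)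
next
  case (Suc n)
  have V: "(Uo ^^ n) x \<in> V" using Suc x by auto
  have "(Uo ^^ Suc n) x = (\<Sum>l\<in>res. act (um l) (act (tm 1) (\<Sum>a\<in>resn n. act (unif ^ n, a, 0, 1) x)))"
    using Uo_eq[OF V] Suc by (simp add: usum_def)
  also have "\<dots> = (\<Sum>l\<in>res. \<Sum>a\<in>resn n. act (um l) (act (tm 1) (act (unif ^ n, a, 0, 1) x)))"
    using x by (simp add: act_sum)
  also have "\<dots> = (\<Sum>l\<in>res. \<Sum>a\<in>resn n. act (unif ^ Suc n, l + unif * a, 0, 1) x)"
  proof (intro sum.cong refl)
    fix l a
    have "act (um l) (act (tm 1) (act (unif ^ n, a, 0, 1) x)) = act (um l) (act (unif ^ Suc n, unif * a, 0, 1) x)"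
      using x by (intro arg_cong[of _ _ "act (um l)"] act_eq1) auto
    also have "\<dots> = act (unif ^ Suc n, l + unif * a, 0, 1) x"
      using x by (intro act_eq1) auto
    finally show "act (um l) (act (tm 1) (act (unif ^ n, a, 0, 1) x)) = act (unif ^ Suc n, l + unif * a, 0, 1) x" .
  qed
  also have "\<dots> = (\<Sum>a\<in>resn (Suc n). act (unif ^ Suc n, a, 0, 1) x)"
    by (simp add: sum.cartesian_product sum.reindex[OF inj_on_resn[unfolded case_prod_unfold]] case_prod_unfold
        del: power_Suc)
  finally show ?case .
qed

text \<open>For the vector psf below, the generators of Lev n are supported on the discs of radius n in the projective line P\G,
  so translates in a common Lev n are proportional or have disjoint supports.\<close>

definition Lev :: "nat \<Rightarrow> 'v \<Rightarrow> 'v set" where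
  "Lev n y = span ((\<lambda>k. act (mmul k (tm n)) y) ` GLO)"

lemma subspace_Lev: "subspace (Lev n y)" by (simp add: Lev_def)

end

text \<open>Instantiated with the pair y = (psf, x) in a product, so that rewriting translates of
  the function rewrites the translates of x in the same way.\<close>

locale U_eigenvector = rep val p sc V act
  for val :: "'f::field \<Rightarrow> int" and p :: nat
    and sc :: "'k::field \<Rightarrow> 'v::ab_group_add \<Rightarrow> 'v" and V act +
  fixes \<chi> :: "'f \<Rightarrow> 'f \<Rightarrow> 'k" and wp lam :: 'k and y :: 'v
  assumes y: "eig \<chi> y" "y \<noteq> 0" and wp: "act (dm unif unif) y = sc wp y"
    and lam: "lam \<noteq> 0" "Uo y = sc lam y"
begin

lemma yV: "y \<in> V" using y eig_V by blast

lemma y_expand: "y = sc (inverse (lam ^ j)) (\<Sum>a\<in>resn j. act (unif ^ j, a, 0, 1) y)"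
proof -
  interpret U: linear_operator sc V Uo by (rule Uo_linear)
  have "(Uo ^^ j) y = sc (lam ^ j) y"
    by (induction j) (auto simp: lam(2) yV U.f_scale mult.commute)
  then show ?thesis using lam(1) by (simp add: Uo_pow[OF yV, symmetric])
qed

text \<open>As lam \<noteq> 0, y is a multiple of U^j y. This subdivides each disc of radius m into
  discs of radius n = m + j.\<close>

lemma Lev_mono:
  assumes "m \<le> n" shows "Lev m y \<subseteq> Lev n y"
  unfolding Lev_def[of m]
proof (rule span_minimal[OF _ subspace_Lev], clarify)
  fix k :: "'f mat2" assume k: "k \<in> GLO"
  define j where "j = n - m"
  have kG: "k \<in> GL2" using k GLO_GL2 by blast
  have "act (mmul k (tm m)) y = act (mmul k (tm m)) (sc (inverse (lam ^ j)) (\<Sum>a\<in>resn j. act (unif ^ j, a, 0, 1) y))"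
    using y_expand[of j] by simp
  also have "\<dots> = sc (inverse (lam ^ j)) (\<Sum>a\<in>resn j. act (mmul k (tm m)) (act (unif ^ j, a, 0, 1) y))"
    using kG yV by (subst act_scale) (auto simp: act_sum)
  also have "\<dots> \<in> Lev n y"
  proof (intro subspace_scale[OF subspace_Lev] subspace_sum[OF subspace_Lev])
    fix a assume a: "a \<in> resn j"
    have "mmul (mmul k (tm m)) (unif ^ j, a, 0, 1) = mmul (mmul k (um (unif ^ m * a))) (tm n)"
      using assms by (simp add: mmul_assoc j_def flip: power_add)
    then have "act (mmul k (tm m)) (act (unif ^ j, a, 0, 1) y) = act (mmul (mmul k (um (unif ^ m * a))) (tm n)) y"
      using kG yV by (intro act_eq1) auto
    moreover have "mmul k (um (unif ^ m * a)) \<in> GLO"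
      using resn_integral[OF a] by (intro mmul_GLO[OF k]) (auto simp: GLO_def intro: vge_mono)
    ultimately show "act (mmul k (tm m)) (act (unif ^ j, a, 0, 1) y) \<in> Lev n y"
      unfolding Lev_def by (auto intro: span_base)
  qed
  finally show "act (mmul k (tm m)) y \<in> Lev n y" .
qed

text \<open>For large j the lower left entry is small compared with d, and the matrix factors into
  an integral k, a power of diag(unif, 1) and an element of \<open>IZ\<close>.\<close>

lemma translate_aux:
  assumes D: "a * d - b * c \<noteq> 0" and v: "vge v0 a" "vge v0 c" and j: "int j \<ge> val (a * d - b * c) - 2 * v0 + 1"
    and d: "d \<noteq> 0" "vge (val d) b"
  shows "\<exists>k\<in>GLO. \<exists>m r. act (a * unif ^ j, b, c * unif ^ j, d) y = sc r (act (mmul k (tm m)) y)"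
proof -
  define D where "D = a * d - b * c"
  have D0: "D \<noteq> 0" using D by (simp add: D_def)
  have "vge (v0 + val d) D"
  proof -
    have "vge (val d) d" by (simp add: vge_def)
    then show ?thesis using vge_mult[OF v(1), of "val d" d] vge_mult[OF d(2) v(2)] unfolding D_def
      by (auto simp: add.commute)
  qed
  then have dv: "v0 + val d \<le> val D" using D0 by (simp add: vge_def)
  \<comment> \<open>Taking out d, u(b/d) and a lower unipotent leaves diag(e, 1). The bound on j
    gives val e \<ge> 0, and m is this valuation.\<close>
  define e where "e = D * unif ^ j / d ^ 2"
  have e0: "e \<noteq> 0" using D0 d by (simp add: e_def)
  have "val e = val D + int j - 2 * val d"
    using D0 d by (simp add: e_def val_divide val_mult val_power)
  then have ve: "val e \<ge> 0" using dv j by (simp add: D_def)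
  define m where "m = nat (val e)"
  define i where "i = mmul (dm d d) (lm (c * unif ^ j / d))"
  define k where "k = mmul (um (b / d)) (dm (e / unif ^ m) 1)"
  have c1: "vge 1 (c * unif ^ j / d)"
    using vge_mono[OF v(2), of "1 + val d - int j"] dv j d by (simp add: vge_divide D_def)
  then have "lm (c * unif ^ j / d) \<in> IZ" by (simp add: IZ_def)
  then have i: "i \<in> IZ" unfolding i_def using d by (intro IZ_mmul) (auto simp: IZ_def)
  have ue: "unit_elt (e / unif ^ m)" using e0 ve by (simp add: unit_elt_def val_divide val_power m_def)
  have k: "k \<in> GLO"
    unfolding k_def using ue unit_elt_vge[OF ue, of 0] d by (intro mmul_GLO) (auto simp: GLO_def vge_divide[OF d(1)])
  have dec: "mmul (mmul k (tm m)) i = (a * unif ^ j, b, c * unif ^ j, d)"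
    using d D0 by (simp add: k_def i_def e_def power2_eq_square field_simps) (simp add: D_def algebra_simps)
  have "act (a * unif ^ j, b, c * unif ^ j, d) y = act (mmul k (tm m)) (act i y)"
    using k i yV GLO_GL2 IZ_GL2 by (intro act_eq1[OF dec, symmetric]) auto
  also have "\<dots> = sc (psi \<chi> wp i) (act (mmul k (tm m)) y)"
    using IZ_eig[OF y wp i] k GLO_GL2 yV by (simp add: act_scale)
  finally show ?thesis using k by blast
qed

text \<open>Expanding y through U^j reduces to the matrices of \<open>translate_aux\<close>. If the
  upper right entry is not an integral multiple of the lower right one, s interchanges the rows
  first.\<close>

lemma translate_in_Lev:
  assumes g: "g \<in> GL2" shows "\<exists>N. \<forall>n\<ge>N. act g y \<in> Lev n y"
proof -
  obtain a b c d where gg: "g = (a, b, c, d)" by (cases g)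
  define D where "D = a * d - b * c"
  have D: "D \<noteq> 0" using g by (simp add: gg D_def)
  define v0 where "v0 = min (val a) (val c)"
  have v: "vge v0 a" "vge v0 c" by (auto simp: v0_def vge_def)
  define j where "j = nat (val D - 2 * v0 + 1)"
  have j: "int j \<ge> val D - 2 * v0 + 1" by (simp add: j_def)
  have one: "\<exists>m. act g (act (unif ^ j, u, 0, 1) y) \<in> Lev m y" for u
  proof -
    define b' d' where "b' = a * u + b" and "d' = c * u + d"
    have D': "a * d' - b' * c = D" "c * b' - d' * a = - D" by (simp_all add: D_def b'_def d'_def algebra_simps)
    have eq: "act g (act (unif ^ j, u, 0, 1) y) = act (a * unif ^ j, b', c * unif ^ j, d') y"
      using g yV by (intro act_eq1) (auto simp: gg b'_def d'_def)
    have "\<exists>k\<in>GLO. \<exists>m r. act (a * unif ^ j, b', c * unif ^ j, d') y = sc r (act (mmul k (tm m)) y)"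
    proof (cases "d' \<noteq> 0 \<and> vge (val d') b'")
      case True
      then show ?thesis using translate_aux[of a d' b' c v0 j] D D' v j by simp
    next
      case False
      have b0: "b' \<noteq> 0" using False D D' by auto
      then have vb: "vge (val b') d'" using False by (auto simp: vge_def)
      obtain k m r where k: "k \<in> GLO" "act (c * unif ^ j, d', a * unif ^ j, b') y = sc r (act (mmul k (tm m)) y)"
        using translate_aux[of c b' d' a v0 j] D D' v j b0 vb by auto
      have nz: "c * unif ^ j * b' - d' * (a * unif ^ j) \<noteq> 0"
      proof -
        have "c * unif ^ j * b' - d' * (a * unif ^ j) = - D * unif ^ j" by (simp flip: D'(2)) (simp add: algebra_simps)
        then show ?thesis using D by simp
      qed
      have "act (a * unif ^ j, b', c * unif ^ j, d') y = act sm (act (c * unif ^ j, d', a * unif ^ j, b') y)"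
        using nz yV by (intro act_eq1[symmetric]) auto
      also have "\<dots> = sc r (act (mmul (mmul sm k) (tm m)) y)"
        using k GLO_GL2[OF k(1)] yV by (simp add: act_scale mmul_assoc del: mmul.simps flip: act_mmul)
      finally have "act (a * unif ^ j, b', c * unif ^ j, d') y = sc r (act (mmul (mmul sm k) (tm m)) y)" .
      moreover have "mmul sm k \<in> GLO" by (intro mmul_GLO k) (simp add: GLO_def)
      ultimately show ?thesis by blast
    qed
    then show ?thesis unfolding eq Lev_def by (metis image_eqI span_base span_scale)
  qed
  then obtain M where M: "\<And>u. act g (act (unif ^ j, u, 0, 1) y) \<in> Lev (M u) y" by metis
  define N where "N = Max (M ` resn j)"
  have "act g y \<in> Lev n y" if n: "n \<ge> N" for n
  proof -
    have "act g y = sc (inverse (lam ^ j)) (\<Sum>u\<in>resn j. act g (act (unif ^ j, u, 0, 1) y))"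
      using g yV by (subst y_expand[of j], subst act_scale) (auto simp: act_sum)
    moreover have "act g (act (unif ^ j, u, 0, 1) y) \<in> Lev n y" if "u \<in> resn j" for u
    proof -
      have "M u \<le> n" using n that finite_resn[of j] Max_ge[of "M ` resn j" "M u"] unfolding N_def
        by (meson finite_imageI imageI order.trans)
      then show ?thesis using M Lev_mono by blast
    qed
    ultimately show ?thesis
      by (auto intro!: subspace_scale[OF subspace_Lev] subspace_sum[OF subspace_Lev])
  qed
  then show ?thesis by blast
qed

lemma cyc_in_Lev: assumes "z \<in> cyc y" shows "\<exists>N. \<forall>n\<ge>N. z \<in> Lev n y"
proof -
  have "cyc y \<subseteq> {z. \<exists>N. \<forall>n\<ge>N. z \<in> Lev n y}"
    unfolding cyc_def
  proof (rule span_minimal)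
    show "subspace {z. \<exists>N. \<forall>n\<ge>N. z \<in> Lev n y}"
    proof (intro subspaceI CollectI)
      show "\<exists>N. \<forall>n\<ge>N. 0 \<in> Lev n y" using subspace_0[OF subspace_Lev] by blast
      fix u v assume "u \<in> {z. \<exists>N. \<forall>n\<ge>N. z \<in> Lev n y}" "v \<in> {z. \<exists>N. \<forall>n\<ge>N. z \<in> Lev n y}"
      then obtain N N' where "\<forall>n\<ge>N. u \<in> Lev n y" "\<forall>n\<ge>N'. v \<in> Lev n y" by blast
      then show "\<exists>N. \<forall>n\<ge>N. u + v \<in> Lev n y"
        using subspace_add[OF subspace_Lev] by (intro exI[of _ "max N N'"]) auto
    next
      show "\<exists>N. \<forall>n\<ge>N. sc c u \<in> Lev n y" if "u \<in> {z. \<exists>N. \<forall>n\<ge>N. z \<in> Lev n y}" for c u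
        using that subspace_scale[OF subspace_Lev] by blast
    qed
  qed (use translate_in_Lev in auto)
  then show ?thesis using assms by blast
qed

end

section \<open>The principal series and the function supported on P s I\<close>

context local_field
begin

definition upart :: "'f \<Rightarrow> 'f" where "upart a = a / unif powi val a"

lemma val_unif_powi: "val (unif powi n) = n"
  by (auto simp: power_int_def val_power val_inverse)

lemma upart_unit: "a \<noteq> 0 \<Longrightarrow> unit_elt (upart a)"
  by (simp add: upart_def unit_elt_def val_divide val_unif_powi)

lemma upart_mult: "a \<noteq> 0 \<Longrightarrow> b \<noteq> 0 \<Longrightarrow> upart (a * b) = upart a * upart b"
  by (simp add: upart_def val_mult power_int_add)

lemma upart_of_unit: "unit_elt a \<Longrightarrow> upart a = a"
  by (simp add: upart_def unit_elt_def)

lemma upart_unif: "upart unif = 1"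
  by (simp add: upart_def)

text \<open>The parameters are read off the generator psf, the function on G supported on P s I: a character of the integral torus
  through which I acts, the scalar wp by which unif acts, and the eigenvalue lam of U.\<close>

definition ps_char :: "('f \<Rightarrow> 'f \<Rightarrow> 'k::field) \<Rightarrow> 'k \<Rightarrow> 'k \<Rightarrow> 'f \<Rightarrow> 'f \<Rightarrow> 'k" where
  "ps_char \<chi> wp lam a d = \<chi> (upart d) (upart a) * (wp / lam) powi val a * lam powi val d"

text \<open>With D the determinant, g is the product of the upper triangular matrix with diagonal (-
  D / c, c) and corner a, of s, and of u(d / c). Integrality of d / c means that g lies in P s
  I.\<close>

definition psf :: "('f \<Rightarrow> 'f \<Rightarrow> 'k::field) \<Rightarrow> 'k \<Rightarrow> 'k \<Rightarrow> 'f mat2 \<Rightarrow> 'k" where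
  "psf \<chi> wp lam = (\<lambda>(a, b, c, d). if a * d - b * c \<noteq> 0 \<and> c \<noteq> 0 \<and> vge (val c) d
     then ps_char \<chi> wp lam (- (a * d - b * c) / c) c else 0)"

lemma psf_eq:
  "a * d - b * c = D \<Longrightarrow> psf \<chi> wp lam (a, b, c, d) =
    (if D \<noteq> 0 \<and> c \<noteq> 0 \<and> vge (val c) d then ps_char \<chi> wp lam (- D / c) c else 0)"
  by (auto simp: psf_def)

lemma jchar_units:
  assumes "jchar \<chi> wp" "unit_elt a" "unit_elt d"
  shows "unit_elt a' \<Longrightarrow> unit_elt d' \<Longrightarrow> \<chi> (a * a') (d * d') = \<chi> a d * \<chi> a' d'" "\<chi> a d \<noteq> 0"
proof -
  have I: "dm u v \<in> IZ \<and> psi \<chi> wp (dm u v) = \<chi> u v" if "unit_elt u" "unit_elt v" for u v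
    using that by (auto simp: IZ_def unit_elt_def psi_integral)
  show "\<chi> (a * a') (d * d') = \<chi> a d * \<chi> a' d'" if "unit_elt a'" "unit_elt d'"
    using jchar_mult[OF assms(1), of "dm a d" "dm a' d'"] I[OF assms(2,3)] I[OF that]
      I[OF unit_elt_mult[OF assms(2) that(1)] unit_elt_mult[OF assms(3) that(2)]] by simp
  show "\<chi> a d \<noteq> 0" using I[OF assms(2,3)] psi_nonzero[OF assms(1)] by metis
qed

context
  fixes \<chi> :: "'f \<Rightarrow> 'f \<Rightarrow> 'k::field" and wp lam :: 'k
  assumes j: "jchar \<chi> wp" and nz: "wp \<noteq> 0" "lam \<noteq> 0"
begin

lemma ps_char_mult:
  assumes "a \<noteq> 0" "d \<noteq> 0" "a' \<noteq> 0" "d' \<noteq> 0"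
  shows "ps_char \<chi> wp lam (a * a') (d * d') = ps_char \<chi> wp lam a d * ps_char \<chi> wp lam a' d'"
  using assms nz jchar_units(1)[OF j upart_unit upart_unit upart_unit upart_unit, of d a d' a']
  by (simp add: ps_char_def upart_mult val_mult power_int_add power_int_divide_distrib)

lemma ps_char_units: "unit_elt a \<Longrightarrow> unit_elt d \<Longrightarrow> ps_char \<chi> wp lam a d = \<chi> d a"
  by (simp add: ps_char_def upart_of_unit) (simp add: unit_elt_def)

lemma smooth_char_ps_char: "smooth_char_T val (ps_char \<chi> wp lam)"
proof -
  have "ps_char \<chi> wp lam a d \<noteq> 0" if "a \<noteq> 0" "d \<noteq> 0" for a d
    using that nz jchar_units(2)[OF j upart_unit upart_unit] by (simp add: ps_char_def)
  moreover have "ps_char \<chi> wp lam a d = 1" if "close val 1 a 1" "close val 1 d 1" for a d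
    using that unit_elt_of_one_unit[of 1 a] unit_elt_of_one_unit[of 1 d] jchar_one[OF j, of d a]
    by (simp add: ps_char_units close_iff)
  ultimately show ?thesis unfolding smooth_char_T_def using ps_char_mult by blast
qed

lemma psf_outside: "g \<notin> GL2 \<Longrightarrow> psf \<chi> wp lam g = 0"
  by (cases g) (simp add: psf_def)

lemma psf_left:
  assumes "b \<in> Borel" "g \<in> GL2"
  shows "psf \<chi> wp lam (mmul b g) = charP (ps_char \<chi> wp lam) b * psf \<chi> wp lam g"
proof -
  obtain r s t where b: "b = (r, s, 0, t)" "r \<noteq> 0" "t \<noteq> 0" using assms(1) by (auto simp: Borel_def)
  obtain a b' c d where g: "g = (a, b', c, d)" by (cases g)
  define D where "D = a * d - b' * c"
  have D: "D \<noteq> 0" using assms(2) by (simp add: g D_def)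
  have det: "(r * a + s * c) * (t * d) - (r * b' + s * d) * (t * c) = r * t * D"
    by (simp add: D_def algebra_simps)
  show ?thesis
  proof (cases "c = 0")
    case False
    have "- (r * t * D) / (t * c) = r * (- D / c)" using False b by simp
    moreover have "vge (val (t * c)) (t * d) \<longleftrightarrow> vge (val c) d"
      using False b by (simp add: val_mult vge_mult_eq)
    moreover have "ps_char \<chi> wp lam (r * (- D / c)) (t * c) = ps_char \<chi> wp lam r t * ps_char \<chi> wp lam (- D / c) c"
      using False b D by (intro ps_char_mult) auto
    ultimately show ?thesis
      using False b D psf_eq[OF det, of \<chi> wp lam] psf_eq[OF D_def[symmetric], of \<chi> wp lam] by (simp add: g)
  qed (simp add: g b psf_def)
qed

lemma psf_IZ:
  assumes i: "i \<in> IZ" and g: "g \<in> GL2" and v: "i = (\<alpha>, \<beta>, \<gamma>, \<delta>)" "unit_elt \<alpha>"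
  shows "psf \<chi> wp lam (mmul g i) = \<chi> \<alpha> \<delta> * psf \<chi> wp lam g"
proof -
  \<comment> \<open>The computation on the support. A nonzero value at g i with value 0 at g is
    excluded by the same computation for g i and the inverse of i.\<close>
  have supp: "psf \<chi> wp lam (mmul g i) = \<chi> \<alpha> \<delta> * psf \<chi> wp lam g"
    if i: "i \<in> IZ" "i = (\<alpha>, \<beta>, \<gamma>, \<delta>)" "unit_elt \<alpha>" and g: "g = (a, b, c, d)" "a * d - b * c \<noteq> 0" "c \<noteq> 0" "vge (val c) d"
    for a b c d \<alpha> \<beta> \<gamma> \<delta> i g
  proof -
    define D where "D = a * d - b * c"
    have D: "D \<noteq> 0" using g by (simp add: D_def)
    have *: "unit_elt \<delta>" "vge 0 \<beta>" "vge 1 \<gamma>" using i by (auto simp: IZ_def unit_elt_def)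
    define u where "u = \<alpha> + d / c * \<gamma>"
    have dc: "vge 0 (d / c)" using g by (simp add: vge_divide)
    have "vge 1 (d / c * \<gamma>)" using vge_mult[OF dc *(3)] by simp
    then have u: "vge 1 (u - \<alpha>)" by (simp add: u_def)
    then have uu: "unit_elt u" using unit_elt_cong[of \<alpha> u] i(3) by (simp add: vge_diff_comm)
    have cu: "c * \<alpha> + d * \<gamma> = c * u" using g by (simp add: u_def field_simps)
    define Di where "Di = \<alpha> * \<delta> - \<beta> * \<gamma>"
    have "vge 1 (\<beta> * \<gamma>)" using vge_mult[OF *(2,3)] by simp
    then have Di: "vge 1 (Di - \<alpha> * \<delta>)" by (simp add: Di_def)
    then have uD: "unit_elt Di" using unit_elt_cong[of "\<alpha> * \<delta>" Di] unit_elt_mult[OF i(3) *(1)] by (simp add: vge_diff_comm)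
    have det: "(a * \<alpha> + b * \<gamma>) * (c * \<beta> + d * \<delta>) - (a * \<beta> + b * \<delta>) * (c * \<alpha> + d * \<gamma>) = D * Di"
      by (simp add: D_def Di_def algebra_simps)
    have cnz: "c * u \<noteq> 0" "val (c * u) = val c" using g uu by (auto simp: unit_elt_def val_mult)
    have v1: "vge (val c) (c * \<beta> + d * \<delta>)"
    proof (rule vge_add)
      show "vge (val c) (c * \<beta>)" using vge_mult[of "val c" c 0 \<beta>] *(2) by (simp add: vge_def)
      show "vge (val c) (d * \<delta>)" using g(4) *(1) by simp
    qed
    have "psf \<chi> wp lam (mmul g i) = ps_char \<chi> wp lam (- (D * Di) / (c * u)) (c * u)"
      using cnz v1 D uD psf_eq[OF det, of \<chi> wp lam] by (simp add: g(1) i(2) cu unit_elt_nonzero)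
    also have "- (D * Di) / (c * u) = (- D / c) * (Di / u)" using cnz by simp
    also have "ps_char \<chi> wp lam ((- D / c) * (Di / u)) (c * u) = ps_char \<chi> wp lam (- D / c) c * \<chi> u (Di / u)"
      using D uu uD g unit_elt_divide[OF uD uu] by (subst ps_char_mult) (auto simp: unit_elt_nonzero ps_char_units)
    also have "\<chi> u (Di / u) = \<chi> \<alpha> \<delta> * \<chi> (u / \<alpha>) (Di / (u * \<delta>))"
      using uu uD i(3) *(1)
      by (subst jchar_units(1)[OF j i(3) *(1), symmetric]) (auto simp: unit_elt_divide unit_elt_mult unit_elt_nonzero)
    also have "\<chi> (u / \<alpha>) (Di / (u * \<delta>)) = 1"
    proof (rule jchar_one[OF j])
      have "u / \<alpha> - 1 = (u - \<alpha>) / \<alpha>" using i(3) by (simp add: unit_elt_nonzero diff_divide_distrib)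
      then show "vge 1 (u / \<alpha> - 1)" using u i(3) by simp
      have "Di / (u * \<delta>) - 1 = (Di - u * \<delta>) / (u * \<delta>)" using uu *(1) by (simp add: unit_elt_nonzero diff_divide_distrib)
      moreover have "Di - u * \<delta> = (Di - \<alpha> * \<delta>) - (u - \<alpha>) * \<delta>" by (simp add: algebra_simps)
      moreover have "vge 1 ((Di - \<alpha> * \<delta>) - (u - \<alpha>) * \<delta>)" using vge_diff[OF Di, of "(u - \<alpha>) * \<delta>"] u *(1) by simp
      ultimately show "vge 1 (Di / (u * \<delta>) - 1)" using unit_elt_mult[OF uu *(1)] by simp
    qed
    finally show ?thesis using g D by (simp add: psf_def D_def)
  qed
  show ?thesis
  proof (cases "psf \<chi> wp lam g = 0 \<and> psf \<chi> wp lam (mmul g i) = 0")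
    case False
    show ?thesis
    proof (cases "psf \<chi> wp lam g = 0")
      case False
      then show ?thesis using supp[OF i v] by (cases g) (auto simp: psf_def split: if_splits)
    next
      case True
      then have nz': "psf \<chi> wp lam (mmul g i) \<noteq> 0" using False by blast
      obtain \<alpha>' \<beta>' \<gamma>' \<delta>' where mi: "minv i = (\<alpha>', \<beta>', \<gamma>', \<delta>')" by (cases "minv i")
      have "unit_elt \<alpha>'"
        using i IZ_det[of \<alpha> \<beta> \<gamma> \<delta>] mi v by (auto simp: IZ_def unit_elt_def val_divide)
      then have "psf \<chi> wp lam (mmul (mmul g i) (minv i)) = \<chi> \<alpha>' \<delta>' * psf \<chi> wp lam (mmul g i)"
        using supp[OF IZ_minv[OF i] mi] nz' by (cases "mmul g i") (auto simp: psf_def split: if_splits)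
      moreover have "\<chi> \<alpha>' \<delta>' \<noteq> 0"
        using \<open>unit_elt \<alpha>'\<close> IZ_minv[OF i] mi by (intro jchar_units(2)[OF j]) (auto simp: IZ_def unit_elt_def)
      ultimately show ?thesis using True nz' mmul_minv(2)[OF IZ_GL2[OF i]] by (simp add: mmul_assoc)
    qed
  qed simp
qed

lemma psf_Fun: "psf \<chi> wp lam \<in> Fun"
proof -
  have "psf \<chi> wp lam (mmul g k) = psf \<chi> wp lam g" if k: "k \<in> Kcong val 1" and g: "g \<in> GL2" for g k
  proof -
    obtain a b c d where kk: "k = (a, b, c, d)" by (cases k)
    have u: "vge 1 (a - 1)" "vge 1 (d - 1)" using k by (auto simp: kk Kcong_iff one2_def)
    then show ?thesis using psf_IZ[OF Kcong_IZ[OF k] g kk] jchar_one[OF j u] unit_elt_of_one_unit[of 1 a] by simp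
  qed
  then show ?thesis unfolding Fun_def using psf_outside by (intro CollectI conjI allI impI exI[of _ 1] ballI) auto
qed

lemma psf_sm: "psf \<chi> wp lam sm = 1"
  using ps_char_units[of 1 1] jchar_one[OF j, of 1 1] by (simp add: psf_def)

lemma psf_central: "ind_act (dm unif unif) (psf \<chi> wp lam) = ind_scale wp (psf \<chi> wp lam)"
proof
  fix h
  have c: "mmul h (dm unif unif) = mmul (dm unif unif) h" by (cases h) (simp add: mult.commute)
  have "dm unif unif \<in> Borel" by (simp add: Borel_def)
  moreover have "ps_char \<chi> wp lam unif unif = wp"
    using nz jchar_one[OF j, of 1 1] by (simp add: ps_char_def upart_unif)
  ultimately show "ind_act (dm unif unif) (psf \<chi> wp lam) h = ind_scale wp (psf \<chi> wp lam) h"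
    using psf_left[of "dm unif unif" h] by (cases "h \<in> GL2") (simp_all add: ind_act_outside psf_outside c)
qed

lemma psf_eig:
  assumes F: "rep val p (ind_scale :: 'k \<Rightarrow> _) Fun ind_act"
  shows "rep.eig val ind_scale Fun ind_act \<chi> (psf \<chi> wp lam)"
proof -
  interpret F: rep val p "ind_scale :: 'k \<Rightarrow> _" Fun ind_act by (rule F)
  have act: "ind_act (\<alpha>, \<beta>, \<gamma>, \<delta>) (psf \<chi> wp lam) = ind_scale (\<chi> \<alpha> \<delta>) (psf \<chi> wp lam)"
    if "(\<alpha>, \<beta>, \<gamma>, \<delta>) \<in> IZ" "unit_elt \<alpha>" for \<alpha> \<beta> \<gamma> \<delta>
  proof
    fix h show "ind_act (\<alpha>, \<beta>, \<gamma>, \<delta>) (psf \<chi> wp lam) h = ind_scale (\<chi> \<alpha> \<delta>) (psf \<chi> wp lam) h"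
      using psf_IZ[OF that(1) _ refl that(2), of h]
      by (cases "h \<in> GL2") (simp_all add: ind_act_outside psf_outside)
  qed
  have i: "ind_scale 1 (psf \<chi> wp lam) = psf \<chi> wp lam" by (simp add: ind_scale_def)
  have one: "\<chi> 1 1 = 1" using jchar_one[OF j] by simp
  have "F.fixed 0 1 (psf \<chi> wp lam)"
  proof (rule F.fixedI[OF psf_Fun])
    show "ind_act (um b) (psf \<chi> wp lam) = psf \<chi> wp lam" if "vge 0 b" for b
      using that by (subst act) (auto simp: IZ_def one i)
    show "ind_act (dm a d) (psf \<chi> wp lam) = psf \<chi> wp lam"
      if "unit_elt a" "unit_elt d" "vge 1 (a - 1)" "vge 1 (d - 1)" for a d
      using that jchar_one[OF j that(3,4)] by (subst act) (auto simp: IZ_def unit_elt_def i)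
    show "ind_act (lm c) (psf \<chi> wp lam) = psf \<chi> wp lam" if "vge 1 c" for c
      using that by (subst act) (auto simp: IZ_def one i)
  qed
  then show ?thesis using act by (auto simp: F.eig_def IZ_def unit_elt_def)
qed

lemma psf_Uo:
  assumes F: "rep val p (ind_scale :: 'k \<Rightarrow> _) Fun ind_act"
  shows "rep.Uo val ind_act (psf \<chi> wp lam) = ind_scale lam (psf \<chi> wp lam)"
proof -
  interpret F: rep val p "ind_scale :: 'k \<Rightarrow> _" Fun ind_act by (rule F)
  show ?thesis
  proof (rule Fun_eqI)
    show "F.Uo (psf \<chi> wp lam) \<in> Fun" by (rule F.Uo_closed[OF psf_Fun])
    show "ind_scale lam (psf \<chi> wp lam) \<in> Fun" by (rule F.V_scale[OF psf_Fun])
    fix h :: "'f mat2" assume h: "h \<in> GL2"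
    obtain a b x z where hh: "h = (a, b, x, z)" by (cases h)
    define D where "D = a * z - b * x"
    have D: "D \<noteq> 0" using h by (simp add: hh D_def)
    have det: "(a * unif) * (x * l + z) - (a * l + b) * (x * unif) = D * unif" for l
      by (simp add: D_def algebra_simps)
    have "F.Uo (psf \<chi> wp lam) h = (\<Sum>l\<in>res. psf \<chi> wp lam (mmul (mmul h (um l)) (tm 1)))"
      using h by (simp add: F.Uo_eq[OF psf_Fun] F.usum_def sum_fun_apply del: mmul.simps)
    also have "\<dots> = (\<Sum>l\<in>res. if x \<noteq> 0 \<and> vge (val x + 1) (x * l + z)
        then ps_char \<chi> wp lam (- D / x) x * lam else 0)"
    proof (intro sum.cong refl)
      fix l
      have "ps_char \<chi> wp lam (- (D * unif) / (x * unif)) (x * unif) = ps_char \<chi> wp lam (- D / x) x * lam" if "x \<noteq> 0"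
      proof -
        have "ps_char \<chi> wp lam (- D / x * 1) (x * unif) = ps_char \<chi> wp lam (- D / x) x * ps_char \<chi> wp lam 1 unif"
          using that D by (intro ps_char_mult) auto
        moreover have "ps_char \<chi> wp lam 1 unif = lam"
          using jchar_one[OF j, of 1 1] by (simp add: ps_char_def upart_unif upart_of_unit)
        ultimately show ?thesis using that by simp
      qed
      then show "psf \<chi> wp lam (mmul (mmul h (um l)) (tm 1)) = (if x \<noteq> 0 \<and> vge (val x + 1) (x * l + z)
        then ps_char \<chi> wp lam (- D / x) x * lam else 0)"
        using D psf_eq[OF det[of l], of \<chi> wp lam] by (auto simp: hh val_mult algebra_simps)
    qed
    also have "\<dots> = ind_scale lam (psf \<chi> wp lam) h"
    proof (cases "x \<noteq> 0 \<and> vge (val x) z")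
      case True
      \<comment> \<open>The bottom row of h u(l) diag(unif, 1) is (x unif, x l + z), so exactly one
        residue l contributes: that of - z / x.\<close>
      define l0 where "l0 = rrep (- z / x)"
      have v: "vge 0 (- z / x)" using True by (simp add: vge_divide)
      have eq: "vge (val x + 1) (x * l + z) \<longleftrightarrow> l = l0" if "l \<in> res" for l
      proof -
        have "x * l + z = x * (l - (- z / x))" using True by (simp add: field_simps)
        then have "vge (val x + 1) (x * l + z) \<longleftrightarrow> vge 1 (l - (- z / x))" using True by (simp add: vge_mult_eq)
        also have "\<dots> \<longleftrightarrow> vge 1 (- z / x - l)" by (rule vge_diff_comm)
        also have "\<dots> \<longleftrightarrow> l = l0" using rrep_unique[OF v that] rrep_close[OF v] by (auto simp: l0_def)
        finally show ?thesis .
      qed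
      have "(\<Sum>l\<in>res. if x \<noteq> 0 \<and> vge (val x + 1) (x * l + z) then ps_char \<chi> wp lam (- D / x) x * lam else 0) =
          (\<Sum>l\<in>res. if l = l0 then ps_char \<chi> wp lam (- D / x) x * lam else 0)"
        using eq True by (intro sum.cong) auto
      also have "\<dots> = ps_char \<chi> wp lam (- D / x) x * lam"
        using rrep_res[OF v] finite_res by (simp add: l0_def)
      finally show ?thesis using True D by (simp add: hh psf_def D_def mult.commute)
    next
      case False
      have "\<not> (x \<noteq> 0 \<and> vge (val x + 1) (x * l + z))" if "l \<in> res" for l
      proof
        assume *: "x \<noteq> 0 \<and> vge (val x + 1) (x * l + z)"
        have "vge (val x) (x * l)" using * res_integral[OF that] by (simp add: vge_mult_eq)
        then have "vge (val x) (x * l + z - x * l)" using * vge_mono[of "val x + 1" "x * l + z" "val x"] by (intro vge_diff) auto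
        then show False using False * by simp
      qed
      then have "(\<Sum>l\<in>res. if x \<noteq> 0 \<and> vge (val x + 1) (x * l + z) then ps_char \<chi> wp lam (- D / x) x * lam else 0) = 0"
        by (intro sum.neutral) auto
      then show ?thesis using False by (auto simp: hh psf_def)
    qed
    finally show "F.Uo (psf \<chi> wp lam) h = ind_scale lam (psf \<chi> wp lam) h" .
  qed
qed

end

end

context fun_pair
begin

text \<open>The subrepresentation generated by (f, x) is the graph of a map from the span of the
  translates of f onto V. It is single valued because every relation can be rewritten in one
  \<open>Lev n\<close>, where \<open>sum_zero_class_split\<close> applies.\<close>

lemma subquotient_of_U_eigenvector:
  assumes irr: "irreducible_rep sc V act" and x: "B.eig \<chi> x" "x \<noteq> 0"
    and wp: "act (dm unif unif) x = sc wp x" and lam: "lam \<noteq> 0" "B.Uo x = sc lam x"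
  shows "\<exists>\<chi>T. smooth_char_T val \<chi>T \<and> subquotient_of_ind val \<chi>T sc V act"
proof -
  have j: "jchar \<chi> wp" using B.eig_jchar[OF x wp] .
  have wp0: "wp \<noteq> 0" using B.central_powi(1)[OF B.eig_V[OF x(1)] x(2) wp] .
  note ps = j wp0 lam(1)
  define f where "f = psf \<chi> wp lam"
  define \<chi>T where "\<chi>T = ps_char \<chi> wp lam"
  note F = rep_Fun[OF B.coeff]
  have fF: "f \<in> Fun" unfolding f_def by (rule psf_Fun[OF ps])
  have xV: "x \<in> V" using x B.eig_V by blast
  have IZf: "ind_act i f = ind_scale (psi \<chi> wp i) f" if "i \<in> IZ" for i
  proof (rule A.IZ_eig[OF _ _ _ that])
    show "A.eig \<chi> f" unfolding f_def by (rule psf_eig[OF ps F])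
    show "ind_act (dm unif unif) f = ind_scale wp f" unfolding f_def by (rule psf_central[OF ps])
    show "f \<noteq> 0" using psf_sm[OF ps] by (metis f_def zero_fun_apply zero_neq_one)
  qed
  interpret UE: U_eigenvector val p psc "Fun \<times> V" pact \<chi> wp lam "(f, x)"
  proof
    show "P.eig \<chi> (f, x)" using x(1) psf_eig[OF ps F] by (simp add: pair_eig f_def)
    show "(f, x) \<noteq> 0" using x(2) by (simp add: prod_eq_iff)
    show "pact (dm unif unif) (f, x) = psc wp (f, x)" using wp psf_central[OF ps] by (simp add: prod_eq_iff f_def)
    show "P.Uo (f, x) = psc lam (f, x)" using lam psf_Uo[OF ps F] by (simp add: pair_Uo prod_eq_iff f_def)
  qed fact
  have free: "w = 0" if w: "(0, w) \<in> P.cyc (f, x)" for w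
  proof -
    obtain N where "\<forall>n\<ge>N. (0, w) \<in> P.Lev n (f, x)" using UE.cyc_in_Lev[OF w] by blast
    \<comment> \<open>The successor ensures a positive level, which below puts \<beta> \<gamma> into
      the maximal ideal.\<close>
    then have "(0, w) \<in> P.Lev (Suc N) (f, x)" by simp
    then obtain t r where t: "finite t" "t \<subseteq> (\<lambda>k. pact (mmul k (tm (Suc N))) (f, x)) ` GLO"
      and eq: "(0, w) = (\<Sum>a\<in>t. psc (r a) a)"
      unfolding P.Lev_def P.span_explicit by blast
    define n where "n = Suc N"
    have tn: "tm n \<in> GL2" by simp
    have "(\<Sum>a\<in>t. sc (r a) (snd a)) = 0"
    proof (rule sum_zero_class_split[where F = fst, OF B.vector_space_axioms t(1)])
      fix a assume "a \<in> t"
      then obtain k where k: "k \<in> GLO" "a = pact (mmul k (tm n)) (f, x)" using t n_def by blast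
      have kG: "k \<in> GL2" using k GLO_GL2 by blast
      define q where "q = mmul k (tm n)"
      have q: "q \<in> GL2" using kG unfolding q_def by (intro mmul_GL2) auto
      have s: "sm \<in> GL2" by simp
      show "\<exists>z. fst a z \<noteq> 0 \<and>
          (\<forall>b\<in>t. fst b z = 0 \<or> (\<exists>c. (\<forall>h. fst b h = c * fst a h) \<and> snd b = sc c (snd a)))"
      \<comment> \<open>f is 1 at s, so s q^-1 lies in the support of the translate of f by
        q.\<close>
      proof (intro exI[of _ "mmul sm (minv q)"] conjI ballI)
        have "f sm \<noteq> 0" using psf_sm[OF ps] by (simp add: f_def)
        then show "fst a (mmul sm (minv q)) \<noteq> 0"
          using k q s by (simp add: mmul_assoc mmul_minv(1) del: mmul.simps flip: q_def)
        fix b assume "b \<in> t"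
        then obtain k' where k': "k' \<in> GLO" "b = pact (mmul k' (tm n)) (f, x)" using t n_def by blast
        have kG': "k' \<in> GL2" using k' GLO_GL2 by blast
        define k0 where "k0 = mmul (minv k) k'"
        obtain \<alpha> \<beta> \<gamma> \<delta> where k0: "k0 = (\<alpha>, \<beta>, \<gamma>, \<delta>)" by (cases k0)
        have k0O: "k0 \<in> GLO" unfolding k0_def by (intro mmul_GLO minv_GLO k k')
        \<comment> \<open>i is the quotient of the two translating matrices. If both translates are
          nonzero at the test point, then i lies in \<open>IZ\<close>, which acts on f and on x
          through the same character.\<close>
        define i where "i = (\<alpha>, \<beta> / unif ^ n, \<gamma> * unif ^ n, \<delta>)"
        have "mmul (tm n) i = mmul k0 (tm n)" by (simp add: i_def k0 mult.commute)
        then have qi: "mmul q i = mmul k' (tm n)"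
          using kG by (simp add: q_def mmul_assoc k0_def mmul_minv_cancel del: mmul.simps)
        have iG: "i \<in> GL2" using GLO_GL2[OF k0O] by (simp add: i_def k0)
        have ev: "fst b (mmul sm (minv q)) = f (mmul sm i)"
          using k' q s by (simp add: mmul_assoc mmul_minv_cancel del: mmul.simps flip: qi)
        show "fst b (mmul sm (minv q)) = 0 \<or> (\<exists>c. (\<forall>h. fst b h = c * fst a h) \<and> snd b = sc c (snd a))"
        proof (cases "f (mmul sm i) = 0")
          case True
          then show ?thesis using ev by simp
        next
          case False
          then have \<alpha>: "\<alpha> \<noteq> 0" "vge (val \<alpha> + int n) \<beta>"
            by (auto simp: f_def psf_def i_def split: if_splits)
          have int: "vge 0 \<alpha>" "vge 0 \<beta>" "vge 0 \<gamma>" "vge 0 \<delta>" "unit_elt (\<alpha> * \<delta> - \<beta> * \<gamma>)"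
            using k0O by (auto simp: GLO_def k0)
          have v\<alpha>: "val \<alpha> \<ge> 0" using int(1) \<alpha> by (simp add: vge_def)
          have \<beta>: "vge (int n) \<beta>" using \<alpha>(2) vge_mono v\<alpha> by simp
          have "vge 1 (\<beta> * \<gamma>)" using vge_mult_le[OF \<beta> int(3), of 1] by (simp add: n_def)
          then have u: "unit_elt (\<alpha> * \<delta>)" using unit_elt_cong[OF _ int(5), of "\<alpha> * \<delta>"] int(5)
            by (metis add_diff_cancel_left' diff_diff_eq2 unit_elt_cong vge_minus minus_diff_eq diff_add_cancel)
          have d0: "\<delta> \<noteq> 0" using u unit_elt_nonzero by force
          then have "val \<delta> \<ge> 0" using int(4) by (simp add: vge_def)
          then have "val \<alpha> = 0" "val \<delta> = 0" using u v\<alpha> \<alpha>(1) d0 by (auto simp: unit_elt_def val_mult)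
          moreover have "int n \<ge> 1" by (simp add: n_def)
          ultimately have iI: "i \<in> IZ" using \<alpha>(1) d0 \<beta> vge_mono[OF int(3), of "1 - int n"]
            by (simp add: IZ_def i_def)
          have "fst b = ind_scale (psi \<chi> wp i) (fst a)"
            using k k' q iG IZf[OF iI] fF by (simp add: A.act_mmul A.act_scale del: mmul.simps flip: qi q_def)
          moreover have "snd b = sc (psi \<chi> wp i) (snd a)"
            using k k' q iG B.IZ_eig[OF x wp iI] xV by (simp add: B.act_mmul B.act_scale del: mmul.simps flip: qi q_def)
          ultimately show ?thesis by auto
        qed
      qed
    next
      fix h
      have "0 = (\<Sum>a\<in>t. ind_scale (r a) (fst a))" using arg_cong[OF eq, of fst] by (simp add: fst_sum)
      from fun_cong[OF this, of h] show "(\<Sum>a\<in>t. r a * fst a h) = 0" by (simp add: sum_fun_apply)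
    qed
    moreover have "w = (\<Sum>a\<in>t. sc (r a) (snd a))" using arg_cong[OF eq, of snd] by (simp add: snd_sum)
    ultimately show ?thesis by simp
  qed
  define D where "D = P.cyc (f, x)"
  have fxV: "(f, x) \<in> Fun \<times> V" using fF xV by simp
  note subD = P.subspace_cyc[of "(f, x)", folded D_def] and stD = P.stable_cyc[OF fxV, folded D_def]
  define \<phi> where "\<phi> F = (SOME w. (F, w) \<in> D)" for F
  have \<phi>: "(F, w) \<in> D \<Longrightarrow> \<phi> F = w" for F w
  proof -
    assume Fw: "(F, w) \<in> D"
    then have "(F, \<phi> F) \<in> D" unfolding \<phi>_def by (rule someI)
    then have "(F, \<phi> F) - (F, w) \<in> D" using Fw P.subspace_diff[OF subD] by blast
    then have "(0, \<phi> F - w) \<in> D" by (simp add: minus_prod_def)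
    then have "\<phi> F - w = 0" unfolding D_def by (rule free)
    then show "\<phi> F = w" by simp
  qed
  define W1 where "W1 = fst ` D"
  have W1: "W1 = A.cyc f" unfolding W1_def D_def using cyc_fst[OF fxV] by simp
  have sndD: "snd ` D = V"
    using cyc_snd[OF fxV] B.irreducible_cyc[OF irr xV x(2)] by (simp add: D_def)
  have W1D: "\<exists>w. (F, w) \<in> D" if "F \<in> W1" for F using that by (force simp: W1_def)
  have "W1 \<subseteq> ind_space val \<chi>T"
  proof -
    define Q where "Q = {F\<in>Fun. \<forall>b\<in>Borel. \<forall>g\<in>GL2. F (mmul b g) = charP \<chi>T b * F g}"
    have BG: "b \<in> GL2" if "b \<in> Borel" for b :: "'f mat2" using that by (auto simp: Borel_def)
    have "A.cyc f \<subseteq> Q"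
    proof (rule A.cyc_minimal)
      show "A.subspace Q"
        unfolding Q_def by (intro A.subspaceI) (auto simp: algebra_simps simp del: split_paired_All)
      show "stable GL2 ind_act Q" unfolding stable_def Q_def using BG by (auto simp: mmul_assoc)
      show "f \<in> Q" using fF psf_left[OF ps] unfolding Q_def f_def \<chi>T_def by blast
    qed
    then show ?thesis unfolding W1 Q_def Fun_def ind_space_def by blast
  qed
  moreover have "A.subspace W1" unfolding W1 by (rule A.subspace_cyc)
  moreover have "stable GL2 ind_act W1" unfolding W1 by (rule A.stable_cyc[OF fF])
  moreover have "lin_on ind_scale W1 sc \<phi>"
    unfolding lin_on_def
  proof (intro conjI ballI allI)
    fix F F' assume "F \<in> W1" "F' \<in> W1"
    then obtain w w' where w: "(F, w) \<in> D" "(F', w') \<in> D" using W1D by blast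
    then have "(F + F', w + w') \<in> D" using P.subspace_add[OF subD w] by (simp add: plus_prod_def)
    then show "\<phi> (F + F') = \<phi> F + \<phi> F'" using \<phi> w by simp
  next
    fix c F assume "F \<in> W1"
    then obtain w where w: "(F, w) \<in> D" using W1D by blast
    then have "(ind_scale c F, sc c w) \<in> D" using P.subspace_scale[OF subD w, of c] by (simp add: psc_def)
    then show "\<phi> (ind_scale c F) = sc c (\<phi> F)" using \<phi> w by simp
  qed
  moreover have "\<phi> ` W1 = V"
    unfolding W1_def image_image using \<phi> sndD by (metis (no_types, lifting) image_cong prod.collapse)
  moreover have "equivariant_on GL2 W1 ind_act act \<phi>"
    unfolding equivariant_on_def
  proof (intro ballI)
    fix g :: "'f mat2" and F assume g: "g \<in> GL2" and "F \<in> W1"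
    then obtain w where w: "(F, w) \<in> D" using W1D by blast
    then have "pact g (F, w) \<in> D" using stD g unfolding stable_def by blast
    then have "(ind_act g F, act g w) \<in> D" by (simp add: pact_def)
    then show "\<phi> (ind_act g F) = act g (\<phi> F)" using \<phi> w by simp
  qed
  ultimately have "subquotient_of_ind val \<chi>T sc V act" unfolding subquotient_of_ind_def by blast
  then show ?thesis using smooth_char_ps_char[OF ps] by (auto simp: \<chi>T_def)
qed

end

subsection \<open>Double cosets and words in the Hecke algebra\<close>

lemma minv_unique: "g \<in> GL2 \<Longrightarrow> mmul h g = one2 \<Longrightarrow> h = minv g"
  using mmul_minv(2)[of g] mmul_assoc[of h g "minv g"] by simp

lemma minv_mmul: "g \<in> GL2 \<Longrightarrow> h \<in> GL2 \<Longrightarrow> minv (mmul g h) = mmul (minv h) (minv g)"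
  by (intro minv_unique[symmetric]) (auto simp: mmul_assoc mmul_minv_cancel mmul_minv)

lemma minv_minv: "g \<in> GL2 \<Longrightarrow> minv (minv g) = g"
  by (intro minv_unique[symmetric]) (auto simp: mmul_minv)

context local_field
begin

definition monom2 :: "bool \<Rightarrow> 'f \<Rightarrow> 'f \<Rightarrow> 'f mat2" where
  "monom2 s x y = (if s then (0, x, y, 0) else (x, 0, 0, y))"

text \<open>The matrices Pi^eps diag(unif^n, 1) s^eta, which represent the double cosets of the pro-p Iwahori subgroup and IZ;
  Tw below is the Hecke operator of the double coset of wm.\<close>

definition wm :: "bool \<Rightarrow> bool \<Rightarrow> nat \<Rightarrow> 'f mat2" where
  "wm \<epsilon> \<eta> n = monom2 (\<epsilon> \<noteq> \<eta>) (if \<epsilon> then 1 else unif ^ n) (if \<epsilon> then unif ^ Suc n else 1)"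

lemma wm_GL2 [simp]: "wm \<epsilon> \<eta> n \<in> GL2"
  by (auto simp: wm_def monom2_def)

text \<open>Compare entries. For equal shapes the difference of valuations survives, as diagonal
  entries of an element of \<open>IZ\<close> have equal valuation; for different shapes the strict
  bound on lower left entries is contradicted.\<close>

lemma monom2_double_coset:
  assumes nz: "x \<noteq> 0" "y \<noteq> 0" "x' \<noteq> 0" "y' \<noteq> 0" and i: "i \<in> IZ" and j: "j \<in> IZ"
    and eq: "mmul i (monom2 s x y) = mmul (monom2 s' x' y') j"
  shows "s = s' \<and> val x - val y = val x' - val y'"
proof -
  obtain \<alpha> \<beta> \<gamma> \<delta> where ii: "i = (\<alpha>, \<beta>, \<gamma>, \<delta>)" by (cases i)
  obtain a b c d where jj: "j = (a, b, c, d)" by (cases j)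
  have I: "\<alpha> \<noteq> 0" "\<delta> \<noteq> 0" "val \<delta> = val \<alpha>" "vge (val \<alpha>) \<beta>" "vge (val \<alpha> + 1) \<gamma>" using i by (auto simp: ii IZ_def)
  have J: "a \<noteq> 0" "d \<noteq> 0" "val d = val a" "vge (val a) b" "vge (val a + 1) c" using j by (auto simp: jj IZ_def)
  have vm: "val u + val t = val u' + val t'" if "u * t = u' * t'" "u \<noteq> 0" "t \<noteq> 0" "u' \<noteq> 0" "t' \<noteq> 0" for u t u' t'
    using that val_mult by metis
  have vg: "n + val t \<le> val u' + val t'" if "u * t = u' * t'" "vge n u" "t \<noteq> 0" "u' \<noteq> 0" "t' \<noteq> 0" for u t u' t' n
  proof -
    have "u \<noteq> 0" using that by auto
    then show ?thesis using vm[OF that(1)] that by (simp add: vge_def)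
  qed
  show ?thesis
  proof (cases s; cases s')
    assume s: "s" "s'"
    then have e: "\<alpha> * x = x' * d" "\<delta> * y = y' * a" using eq by (auto simp: ii jj monom2_def)
    show ?thesis
      using vm[OF e(1) I(1) nz(1,3) J(2)] vm[OF e(2) I(2) nz(2,4) J(1)] I(3) J(3) s by simp
  next
    assume s: "\<not> s" "\<not> s'"
    then have e: "\<alpha> * x = x' * a" "\<delta> * y = y' * d" using eq by (auto simp: ii jj monom2_def)
    show ?thesis
      using vm[OF e(1) I(1) nz(1,3) J(1)] vm[OF e(2) I(2) nz(2,4) J(2)] I(3) J(3) s by simp
  next
    assume s: "\<not> s" "s'"
    then have e: "c * x' = \<alpha> * x" "\<beta> * y = x' * d" "\<gamma> * x = y' * a" "b * y' = \<delta> * y"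
      using eq by (auto simp: ii jj monom2_def mult.commute)
    show ?thesis
      using vg[OF e(1) J(5) nz(3) I(1) nz(1)] vg[OF e(2) I(4) nz(2,3) J(2)]
        vg[OF e(3) I(5) nz(1,4) J(1)] vg[OF e(4) J(4) nz(4) I(2) nz(2)] I J by linarith
  next
    assume s: "s" "\<not> s'"
    then have e: "\<beta> * y = x' * a" "b * x' = \<alpha> * x" "c * y' = \<delta> * y" "\<gamma> * x = y' * d"
      using eq by (auto simp: ii jj monom2_def mult.commute)
    show ?thesis
      using vg[OF e(1) I(4) nz(2,3) J(1)] vg[OF e(2) J(4) nz(3) I(1) nz(1)]
        vg[OF e(3) J(5) nz(4) I(2) nz(2)] vg[OF e(4) I(5) nz(1,4) J(2)] I J by linarith
  qed
qed

lemma wm_double_coset: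
  assumes "i \<in> IZ" "j \<in> IZ" "mmul i (wm \<epsilon> \<eta> n) = mmul (wm \<epsilon>' \<eta>' n') j"
  shows "\<epsilon> = \<epsilon>' \<and> \<eta> = \<eta>' \<and> n = n'"
proof -
  have "(\<epsilon> \<noteq> \<eta>) = (\<epsilon>' \<noteq> \<eta>') \<and>
     val (if \<epsilon> then 1 else unif ^ n) - val (if \<epsilon> then unif ^ Suc n else 1) =
     val (if \<epsilon>' then 1 else unif ^ n') - val (if \<epsilon>' then unif ^ Suc n' else 1)"
    by (rule monom2_double_coset[OF _ _ _ _ assms(1,2) assms(3)[unfolded wm_def]]) auto
  then show ?thesis by (auto simp: val_power simp del: power_Suc split: if_splits)
qed

text \<open>The sign of \<open>val x - val y\<close> decides whether Pi occurs. In that case n is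
  one less than the difference, because Pi itself carries a factor \<open>unif\<close>.\<close>

lemma monom2_wm:
  assumes "x \<noteq> 0" "y \<noteq> 0"
  shows "\<exists>\<epsilon> \<eta> n. \<exists>j\<in>IZ. monom2 s x y = mmul (wm \<epsilon> \<eta> n) j"
proof (cases "val x \<ge> val y")
  case True
  define n where "n = nat (val x - val y)"
  have n: "int n = val x - val y" using True by (simp add: n_def)
  show ?thesis
  proof (intro exI bexI)
    show "monom2 s x y = mmul (wm False s n) (if s then dm y (x / unif ^ n) else dm (x / unif ^ n) y)"
      by (auto simp: wm_def monom2_def)
    show "(if s then dm y (x / unif ^ n) else dm (x / unif ^ n) y) \<in> IZ"
      using assms n by (auto simp: IZ_def val_divide val_power)
  qed
next
  case False
  define n where "n = nat (val y - val x - 1)"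
  have n: "int n = val y - val x - 1" using False by (simp add: n_def)
  show ?thesis
  proof (intro exI bexI)
    show "monom2 s x y = mmul (wm True (\<not> s) n) (if s then dm (y / unif ^ Suc n) x else dm x (y / unif ^ Suc n))"
      by (auto simp: wm_def monom2_def)
    show "(if s then dm (y / unif ^ Suc n) x else dm x (y / unif ^ Suc n)) \<in> IZ"
      using assms n by (auto simp: IZ_def val_divide val_power simp del: power_Suc)
  qed
qed

text \<open>Bruhat decomposition for the Iwahori subgroup, by elimination. The pivot is chosen by
  valuations so that the left factor is a single unipotent of the pro-p Iwahori subgroup.\<close>

lemma monom2_cover:
  assumes g: "g \<in> GL2"
  shows "\<exists>u s x y j. ((\<exists>b. u = um b \<and> vge 0 b) \<or> (\<exists>c. u = lm c \<and> vge 1 c)) \<and> x \<noteq> 0 \<and> y \<noteq> 0 \<and>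
    j \<in> IZ \<and> g = mmul u (mmul (monom2 s x y) j)"
proof -
  obtain a b c d where gg: "g = (a, b, c, d)" by (cases g)
  define D where "D = a * d - b * c"
  have D: "D \<noteq> 0" using g by (simp add: gg D_def)
  have lm: "lm e \<in> IZ" if "vge 1 e" for e using that by (simp add: IZ_def)
  have um: "um e \<in> IZ" if "vge 0 e" for e using that by (simp add: IZ_def)
  show ?thesis
  proof (cases "c \<noteq> 0 \<and> vge (val c) d")
    case True
    then have c: "c \<noteq> 0" "vge 0 (d / c)" by (auto simp: vge_divide)
    show ?thesis
    proof (cases "vge (val c) a")
      case True
      have "g = mmul (um (a / c)) (mmul (monom2 True (- D / c) c) (um (d / c)))"
        using c by (simp add: gg D_def monom2_def field_simps)
      moreover have "vge 0 (a / c)" using True c by (simp add: vge_divide)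
      ultimately show ?thesis using um[OF c(2)] c(1) D
        by (intro exI[of _ "um (a / c)"] exI[of _ True] exI[of _ "- D / c"] exI[of _ c] exI[of _ "um (d / c)"]) auto
    next
      case False
      then have a: "a \<noteq> 0" "val c > val a" by (auto simp: vge_def)
      have 1: "vge 1 (c / a)" using a c by (simp add: vge_def val_divide)
      show ?thesis
      proof (cases "vge (val a) b")
        case True
        have "g = mmul (lm (c / a)) (mmul (monom2 False a (D / a)) (um (b / a)))"
          using a by (simp add: gg D_def monom2_def field_simps)
        moreover have "vge 0 (b / a)" using True a by (simp add: vge_divide)
        ultimately show ?thesis using 1 um[of "b / a"] a(1) D
          by (intro exI[of _ "lm (c / a)"] exI[of _ False] exI[of _ a] exI[of _ "D / a"] exI[of _ "um (b / a)"]) auto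
      next
        case False
        then have b: "b \<noteq> 0" "val b < val a" by (auto simp: vge_def)
        have ab: "vge 1 (a / b)" using a b by (simp add: vge_def val_divide)
        have "vge 1 (d / b)"
        proof -
          have "d / b = (d / c) * (c / a) * (a / b)" using a b c by simp
          moreover have "vge 1 ((d / c) * (c / a) * (a / b))" by (rule vge_mult_le[OF vge_mult[OF c(2) 1] ab]) simp
          ultimately show ?thesis by (simp only:)
        qed
        moreover have "g = mmul (lm (d / b)) (mmul (monom2 True b (- D / b)) (lm (a / b)))"
          using b by (simp add: gg D_def monom2_def field_simps)
        ultimately show ?thesis using lm[OF ab] b(1) D
          by (intro exI[of _ "lm (d / b)"] exI[of _ True] exI[of _ b] exI[of _ "- D / b"] exI[of _ "lm (a / b)"]) auto
      qed
    qed
  next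
    case False
    then have d: "d \<noteq> 0" using D by (auto simp: D_def vge_def)
    have cd: "vge 1 (c / d)"
      using False d by (cases "c = 0") (auto simp: vge_def val_divide)
    show ?thesis
    proof (cases "vge (val d) b")
      case True
      have "g = mmul (um (b / d)) (mmul (monom2 False (D / d) d) (lm (c / d)))"
        using d by (simp add: gg D_def monom2_def field_simps)
      moreover have "vge 0 (b / d)" using True d by (simp add: vge_divide)
      ultimately show ?thesis using lm[OF cd] d D
        by (intro exI[of _ "um (b / d)"] exI[of _ False] exI[of _ "D / d"] exI[of _ d] exI[of _ "lm (c / d)"]) auto
    next
      case False
      then have b: "b \<noteq> 0" "val b < val d" by (auto simp: vge_def)
      have db: "vge 1 (d / b)" using b d by (simp add: vge_def val_divide)
      show ?thesis
      proof (cases "a \<noteq> 0 \<and> val a \<le> val b")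
        case True
        have "vge 1 (c / a)"
        proof -
          have "c / a = (c / d) * (d / b) * (b / a)" using True b d by simp
          moreover have "vge 0 (b / a)" using True b by (simp add: vge_def val_divide)
          then have "vge 1 ((c / d) * (d / b) * (b / a))" by (rule vge_mult_le[OF vge_mult[OF cd db]]) simp
          ultimately show ?thesis by (simp only:)
        qed
        moreover have "g = mmul (lm (c / a)) (mmul (monom2 False a (D / a)) (um (b / a)))"
          using True by (simp add: gg D_def monom2_def field_simps)
        moreover have "vge 0 (b / a)" using True b by (simp add: vge_def val_divide)
        ultimately show ?thesis using um[of "b / a"] True D
          by (intro exI[of _ "lm (c / a)"] exI[of _ False] exI[of _ a] exI[of _ "D / a"] exI[of _ "um (b / a)"]) auto
      next
        case False
        have ab: "vge 1 (a / b)" using False b by (cases "a = 0") (auto simp: vge_def val_divide)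
        have "g = mmul (lm (d / b)) (mmul (monom2 True b (- D / b)) (lm (a / b)))"
          using b by (simp add: gg D_def monom2_def field_simps)
        then show ?thesis using lm[OF ab] b(1) db D
          by (intro exI[of _ "lm (d / b)"] exI[of _ True] exI[of _ b] exI[of _ "- D / b"] exI[of _ "lm (a / b)"]) auto
      qed
    qed
  qed
qed

lemma wm_cover:
  assumes g: "g \<in> GL2"
  shows "\<exists>u \<epsilon> \<eta> n j. ((\<exists>b. u = um b \<and> vge 0 b) \<or> (\<exists>c. u = lm c \<and> vge 1 c)) \<and> j \<in> IZ \<and>
    g = mmul u (mmul (wm \<epsilon> \<eta> n) j)"
proof -
  obtain u s x y j where *: "(\<exists>b. u = um b \<and> vge 0 b) \<or> (\<exists>c. u = lm c \<and> vge 1 c)" "x \<noteq> 0" "y \<noteq> 0"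
    "j \<in> IZ" "g = mmul u (mmul (monom2 s x y) j)"
    using monom2_cover[OF g] by blast
  obtain \<epsilon> \<eta> n j' where "j' \<in> IZ" "monom2 s x y = mmul (wm \<epsilon> \<eta> n) j'"
    using monom2_wm[OF *(2,3)] by blast
  then have "g = mmul u (mmul (wm \<epsilon> \<eta> n) (mmul j' j))" "mmul j' j \<in> IZ"
    using * IZ_mmul by (auto simp: mmul_assoc)
  then show ?thesis using *(1) by blast
qed

text \<open>Conjugation by Pi turns u(a) into the lower unipotent with entry unif a; with a in
  \<open>resn\<close> these are the coset representatives for \<open>Tw\<close>.\<close>

definition ue :: "bool \<Rightarrow> 'f \<Rightarrow> 'f mat2" where
  "ue \<epsilon> a = (if \<epsilon> then lm (unif * a) else um a)"

lemma ue_IZ: "vge 0 a \<Longrightarrow> ue \<epsilon> a \<in> IZ"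
  by (auto simp: ue_def IZ_def)

lemma ue_wm: "mmul (ue \<epsilon> a) (wm \<epsilon> \<eta> n) = mmul (wm \<epsilon> \<eta> n) (if \<eta> then lm (a / unif ^ n) else um (a / unif ^ n))"
  by (cases \<epsilon>; cases \<eta>) (simp_all add: ue_def wm_def monom2_def)

text \<open>Of the translates in \<open>Tw_eq\<close>, only the one with matching indices and a = 0
  is nonzero at the inverse of a given \<open>wm\<close>. So evaluation there reads off coefficients
  of Hecke operators, see \<open>Tw_delta_wm\<close>.\<close>

lemma delta_wm:
  assumes j: "jchar \<chi> wp" and a: "a \<in> resn (n + (if \<eta> then 1 else 0))"
  shows "delta \<chi> wp (mmul (minv (wm \<epsilon>' \<eta>' n')) (mmul (ue \<epsilon> a) (wm \<epsilon> \<eta> n))) =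
    (if a = 0 \<and> \<epsilon> = \<epsilon>' \<and> \<eta> = \<eta>' \<and> n = n' then 1 else 0)"
proof (cases "\<epsilon> = \<epsilon>' \<and> \<eta> = \<eta>' \<and> n = n'")
  case True
  define j0 where "j0 = (if \<eta> then lm (a / unif ^ n) else um (a / unif ^ n))"
  have eq: "mmul (minv (wm \<epsilon>' \<eta>' n')) (mmul (ue \<epsilon> a) (wm \<epsilon> \<eta> n)) = j0"
    using True by (simp add: ue_wm mmul_minv_cancel j0_def)
  have "a = 0" if "j0 \<in> IZ"
  proof -
    have "vge (int (n + (if \<eta> then 1 else 0))) a" using that by (auto simp: j0_def IZ_def add.commute split: if_splits)
    then show ?thesis by (rule resn_eq_0[OF a])
  qed
  moreover have "j0 = one2" if "a = 0" using that by (simp add: j0_def one2_def)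
  ultimately show ?thesis using True delta_one[OF j] unfolding eq by (auto simp: delta_def)
next
  case False
  have "mmul (minv (wm \<epsilon>' \<eta>' n')) (mmul (ue \<epsilon> a) (wm \<epsilon> \<eta> n)) \<notin> IZ"
  proof
    assume "mmul (minv (wm \<epsilon>' \<eta>' n')) (mmul (ue \<epsilon> a) (wm \<epsilon> \<eta> n)) \<in> IZ"
    from wm_double_coset[OF ue_IZ[OF resn_integral[OF a]] this, of \<epsilon> \<epsilon> \<eta> n \<epsilon>' \<eta>' n'] False
    show False by (simp add: mmul_minv_cancel)
  qed
  then show ?thesis using False by (auto simp: delta_def)
qed

end

section \<open>Hecke operators as sums over double cosets\<close>

context rep
begin

definition Tw :: "bool \<Rightarrow> bool \<Rightarrow> nat \<Rightarrow> 'v \<Rightarrow> 'v" where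
  "Tw \<epsilon> \<eta> n x = (if \<epsilon> then act pm else id) ((Uo ^^ n) ((if \<eta> then So else id) x))"

lemma Uo_pow_V: "x \<in> V \<Longrightarrow> (Uo ^^ n) x \<in> V"
  by (rule linear_operator.funpow_closed[OF Uo_linear])

lemma fixed_Tw: assumes "fixed 0 1 x" shows "fixed 0 1 (Tw \<epsilon> \<eta> n x)"
proof -
  have "fixed 0 1 ((Uo ^^ n) z)" if "fixed 0 1 z" for z
    using that by (induction n) (auto intro: fixed_Uo)
  then show ?thesis using assms by (auto simp: Tw_def intro: fixed_pm01 fixed_So)
qed

lemma stable_Tw:
  assumes W: "subspace W" "stable GL2 act W" and x: "x \<in> W"
  shows "Tw \<epsilon> \<eta> n x \<in> W"
proof -
  have "(Uo ^^ n) z \<in> W" if "z \<in> W" for z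
    using that by (induction n) (auto intro: stable_So[OF W])
  moreover have "act pm z \<in> W" if "z \<in> W" for z using W that by (auto simp: stable_def)
  ultimately show ?thesis using x stable_So[OF W] by (auto simp: Tw_def)
qed

lemma So_eq_Uo: "x \<in> V \<Longrightarrow> So x = Uo (act (0, 1 / unif, 1, 0) x)"
  unfolding Uo_def using act_eq1[of pm "(0, 1 / unif, 1, 0)" one2 x] act_one by (simp add: one2_def)

text \<open>Since S = U Pi^-1, the word U^n S is U^(n+1) on a translate of x; hence the extra digit
  when \<eta> holds.\<close>

lemma Tw_eq:
  assumes x: "x \<in> V"
  shows "Tw \<epsilon> \<eta> n x = (\<Sum>a\<in>resn (n + (if \<eta> then 1 else 0)). act (mmul (ue \<epsilon> a) (wm \<epsilon> \<eta> n)) x)"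
proof -
  have base: "(Uo ^^ n) ((if \<eta> then So else id) x) =
      (\<Sum>a\<in>resn (n + (if \<eta> then 1 else 0)). act (mmul (um a) (wm False \<eta> n)) x)"
  proof (cases \<eta>)
    case True
    define x' where "x' = act (0, 1 / unif, 1, 0) x"
    have x': "x' \<in> V" using x by (simp add: x'_def)
    have "(Uo ^^ n) (So x) = (Uo ^^ Suc n) x'"
      using So_eq_Uo[OF x] by (simp add: x'_def funpow_swap1)
    also have "\<dots> = (\<Sum>a\<in>resn (Suc n). act (unif ^ Suc n, a, 0, 1) x')" by (rule Uo_pow[OF x'])
    also have "\<dots> = (\<Sum>a\<in>resn (Suc n). act (mmul (um a) (wm False True n)) x)"
      unfolding x'_def using x by (intro sum.cong refl act_eq1) (auto simp: wm_def monom2_def)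
    finally show ?thesis using True by simp
  next
    case False
    then show ?thesis using Uo_pow[OF x, of n] by (simp add: wm_def monom2_def)
  qed
  show ?thesis
  proof (cases \<epsilon>)
    case True
    have "Tw \<epsilon> \<eta> n x = (\<Sum>a\<in>resn (n + (if \<eta> then 1 else 0)). act pm (act (mmul (um a) (wm False \<eta> n)) x))"
      unfolding Tw_def base using True x by (simp add: act_sum)
    also have "\<dots> = (\<Sum>a\<in>resn (n + (if \<eta> then 1 else 0)). act (mmul (ue \<epsilon> a) (wm \<epsilon> \<eta> n)) x)"
      using True x by (intro sum.cong refl act_eq1) (auto simp: ue_def wm_def monom2_def)
    finally show ?thesis .
  next
    case False
    then show ?thesis unfolding Tw_def base by (simp add: ue_def)
  qed
qed

lemma Tw_add: "x \<in> V \<Longrightarrow> z \<in> V \<Longrightarrow> Tw \<epsilon> \<eta> n (x + z) = Tw \<epsilon> \<eta> n x + Tw \<epsilon> \<eta> n z"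
  and Tw_scale: "x \<in> V \<Longrightarrow> Tw \<epsilon> \<eta> n (sc c x) = sc c (Tw \<epsilon> \<eta> n x)"
  by (auto simp: Tw_def So_add So_scale So_closed Uo_pow_V act_add act_scale
      linear_operator.funpow_add[OF Uo_linear] linear_operator.funpow_scale[OF Uo_linear])

lemma Tw_diff_scale:
  assumes "x \<in> V" "z \<in> V" shows "Tw \<epsilon> \<eta> n (x - sc c z) = Tw \<epsilon> \<eta> n x - sc c (Tw \<epsilon> \<eta> n z)"
proof -
  have "x - sc c z = x + sc (- c) z" by simp
  then show ?thesis using assms by (simp only: Tw_add Tw_scale V_scale) simp
qed

lemma Tw_So: "Tw \<epsilon> False n (So x) = Tw \<epsilon> True n x"
  by (simp add: Tw_def)

end

context rep_pair
begin

lemma pair_Tw: "P.Tw \<epsilon> \<eta> n z = (A.Tw \<epsilon> \<eta> n (fst z), B.Tw \<epsilon> \<eta> n (snd z))"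
proof -
  have "(P.Uo ^^ n) z = ((A.Uo ^^ n) (fst z), (B.Uo ^^ n) (snd z))" for z
    by (induction n) (auto simp: pair_Uo)
  then show ?thesis by (simp add: P.Tw_def A.Tw_def B.Tw_def pair_So pact_def)
qed

end

section \<open>Pro-p Iwahori invariants of the compact induction\<close>

context fun_pair
begin

lemma Tw_delta_wm:
  assumes j: "jchar \<chi> wp"
  shows "A.Tw \<epsilon> \<eta> n (delta \<chi> wp) (minv (wm \<epsilon>' \<eta>' n')) = (if \<epsilon> = \<epsilon>' \<and> \<eta> = \<eta>' \<and> n = n' then 1 else 0)"
proof -
  let ?R = "resn (n + (if \<eta> then 1 else 0))"
  have "A.Tw \<epsilon> \<eta> n (delta \<chi> wp) (minv (wm \<epsilon>' \<eta>' n')) =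
      (\<Sum>a\<in>?R. delta \<chi> wp (mmul (minv (wm \<epsilon>' \<eta>' n')) (mmul (ue \<epsilon> a) (wm \<epsilon> \<eta> n))))"
    by (simp add: A.Tw_eq[OF delta_Fun[OF j]] sum_fun_apply)
  also have "\<dots> = (\<Sum>a\<in>?R. if a = 0 then (if \<epsilon> = \<epsilon>' \<and> \<eta> = \<eta>' \<and> n = n' then 1 else 0) else 0)"
    by (intro sum.cong refl, subst delta_wm[OF j]) auto
  also have "\<dots> = (if \<epsilon> = \<epsilon>' \<and> \<eta> = \<eta>' \<and> n = n' then 1 else 0)"
    using zero_resn finite_resn by (subst sum.delta) auto
  finally show ?thesis .
qed

text \<open>The smooth induction of \<open>psi\<close> from \<open>IZ\<close>, with no condition on
  supports; finiteness is the matter of \<open>cyc_delta_finite_support\<close>.\<close>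

definition left_eig :: "('f \<Rightarrow> 'f \<Rightarrow> 'k) \<Rightarrow> 'k \<Rightarrow> ('f mat2 \<Rightarrow> 'k) set" where
  "left_eig \<chi> wp = {F\<in>Fun. \<forall>g\<in>IZ. \<forall>h\<in>GL2. F (mmul g h) = psi \<chi> wp g * F h}"

lemma cyc_delta_left_eig:
  assumes j: "jchar \<chi> wp" shows "A.cyc (delta \<chi> wp) \<subseteq> left_eig \<chi> wp"
proof (rule A.cyc_minimal)
  show "A.subspace (left_eig \<chi> wp)"
    unfolding left_eig_def by (intro A.subspaceI) (auto simp: algebra_simps)
  show "stable GL2 ind_act (left_eig \<chi> wp)"
    unfolding stable_def left_eig_def using IZ_GL2 by (auto simp: mmul_assoc)
  show "delta \<chi> wp \<in> left_eig \<chi> wp"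
    unfolding left_eig_def using delta_Fun[OF j] delta_mult_left[OF j] by blast
qed

text \<open>Applying \<open>wm_cover\<close> to the inverse of h puts \<open>IZ\<close> on the left,
  where functions transform by \<open>psi\<close>, and the pro-p unipotent on the right, where they
  are invariant.\<close>

lemma fixed_left_eig_eqI:
  assumes F: "F \<in> left_eig \<chi> wp" "A.fixed 0 1 F" and G: "G \<in> left_eig \<chi> wp" "A.fixed 0 1 G"
    and eq: "\<And>\<epsilon> \<eta> n. F (minv (wm \<epsilon> \<eta> n)) = G (minv (wm \<epsilon> \<eta> n))"
  shows "F = G"
proof (rule Fun_eqI)
  show "F \<in> Fun" "G \<in> Fun" using F G by (auto simp: left_eig_def)
  fix h :: "'f mat2" assume h: "h \<in> GL2"
  obtain u \<epsilon> \<eta> n j where u: "(\<exists>b. u = um b \<and> vge 0 b) \<or> (\<exists>c. u = lm c \<and> vge 1 c)" and j: "j \<in> IZ"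
    and mh: "minv h = mmul u (mmul (wm \<epsilon> \<eta> n) j)"
    using wm_cover[OF minv_GL2[OF h]] by blast
  have uG: "u \<in> GL2" using u by auto
  have "h = minv (minv h)" using minv_minv[OF h] by simp
  also have "\<dots> = mmul (minv j) (mmul (minv (wm \<epsilon> \<eta> n)) (minv u))"
    unfolding mh using uG IZ_GL2[OF j] by (simp add: minv_mmul mmul_assoc)
  finally have hh: "h = mmul (minv j) (mmul (minv (wm \<epsilon> \<eta> n)) (minv u))" .
  have "H h = psi \<chi> wp (minv j) * H (minv (wm \<epsilon> \<eta> n))" if H: "H \<in> left_eig \<chi> wp" "A.fixed 0 1 H" for H
  proof -
    have "ind_act (minv u) H = H"
      using u A.fixedD(2)[OF H(2)] A.fixedD(4)[OF H(2)] by auto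
    then have "H (mmul (minv (wm \<epsilon> \<eta> n)) (minv u)) = H (minv (wm \<epsilon> \<eta> n))"
      by (metis ind_act_apply minv_GL2 wm_GL2)
    then show ?thesis
      using H(1) IZ_minv[OF j] uG unfolding hh left_eig_def by auto
  qed
  from this[OF F] this[OF G] show "F h = G h" using eq by simp
qed

text \<open>A translate of \<open>delta\<close> is supported on one coset of \<open>IZ\<close>, so
  it meets the inverses of \<open>wm\<close> for at most one n.\<close>

lemma cyc_delta_finite_support:
  assumes j: "jchar \<chi> wp" and F: "F \<in> A.cyc (delta \<chi> wp)"
  shows "\<exists>N. \<forall>\<epsilon> \<eta> n. n \<ge> N \<longrightarrow> F (minv (wm \<epsilon> \<eta> n)) = 0"
proof -
  let ?Q = "{F :: 'f mat2 \<Rightarrow> 'k. \<exists>N. \<forall>\<epsilon> \<eta> n. n \<ge> N \<longrightarrow> F (minv (wm \<epsilon> \<eta> n)) = 0}"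
  have "A.cyc (delta \<chi> wp) \<subseteq> ?Q"
    unfolding A.cyc_def
  proof (rule A.span_minimal)
    show "A.subspace ?Q"
    proof (intro A.subspaceI CollectI)
      fix F G assume "F \<in> ?Q" "G \<in> ?Q"
      then obtain N M where "\<forall>\<epsilon> \<eta> n. n \<ge> N \<longrightarrow> F (minv (wm \<epsilon> \<eta> n)) = 0"
        "\<forall>\<epsilon> \<eta> n. n \<ge> M \<longrightarrow> G (minv (wm \<epsilon> \<eta> n)) = 0" by blast
      then show "\<exists>N. \<forall>\<epsilon> \<eta> n. n \<ge> N \<longrightarrow> (F + G) (minv (wm \<epsilon> \<eta> n)) = 0"
        by (intro exI[of _ "max N M"]) auto
    next
      show "\<exists>N. \<forall>\<epsilon> \<eta> n. n \<ge> N \<longrightarrow> (ind_scale c F) (minv (wm \<epsilon> \<eta> n)) = 0" if F: "F \<in> ?Q" for c F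
      proof -
        obtain N where "\<forall>\<epsilon> \<eta> n. n \<ge> N \<longrightarrow> F (minv (wm \<epsilon> \<eta> n)) = 0" using F by blast
        then show ?thesis by (intro exI[of _ N]) simp
      qed
    qed simp
    show "(\<lambda>g. ind_act g (delta \<chi> wp)) ` GL2 \<subseteq> ?Q"
    proof clarify
      fix g :: "'f mat2" assume g: "g \<in> GL2"
      have uniq: "n = n'" if nz: "ind_act g (delta \<chi> wp) (minv (wm \<epsilon> \<eta> n)) \<noteq> 0"
          "ind_act g (delta \<chi> wp) (minv (wm \<epsilon>' \<eta>' n')) \<noteq> 0" for \<epsilon> \<eta> n \<epsilon>' \<eta>' n'
      proof -
        define i i' where "i = mmul (minv (wm \<epsilon> \<eta> n)) g" and "i' = mmul (minv (wm \<epsilon>' \<eta>' n')) g"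
        have i: "i \<in> IZ" "i' \<in> IZ" using nz by (auto simp: i_def i'_def delta_def split: if_splits)
        have "mmul (wm \<epsilon> \<eta> n) i = mmul (wm \<epsilon>' \<eta>' n') i'" by (simp add: i_def i'_def mmul_minv_cancel)
        then have "mmul one2 (wm \<epsilon> \<eta> n) = mmul (wm \<epsilon>' \<eta>' n') (mmul i' (minv i))"
          using IZ_GL2[OF i(1)] by (metis mmul_assoc mmul_minv(2) mmul_one2)
        then show ?thesis using wm_double_coset[OF one2_IZ IZ_mmul[OF i(2) IZ_minv[OF i(1)]]] by blast
      qed
      show "\<exists>N. \<forall>\<epsilon> \<eta> n. n \<ge> N \<longrightarrow> ind_act g (delta \<chi> wp) (minv (wm \<epsilon> \<eta> n)) = 0"
      proof (cases "\<exists>\<epsilon> \<eta> n. ind_act g (delta \<chi> wp) (minv (wm \<epsilon> \<eta> n)) \<noteq> 0")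
        case True
        then obtain \<epsilon> \<eta> n where "ind_act g (delta \<chi> wp) (minv (wm \<epsilon> \<eta> n)) \<noteq> 0" by blast
        then show ?thesis using uniq by (intro exI[of _ "Suc n"] allI impI) (metis Suc_n_not_le_n)
      qed blast
    qed
  qed
  then show ?thesis using F by blast
qed

end

subsection \<open>Existence of good vectors\<close>

context rep
begin

lemma cyc_zero: "cyc 0 = {0}"
proof
  show "cyc 0 \<subseteq> {0}" by (rule cyc_minimal) (auto simp: stable_def intro: subspaceI)
  show "{0} \<subseteq> cyc 0" using subspace_0[OF subspace_cyc] by blast
qed

text \<open>Substituting m v for m multiplies the character sum by \<chi>(v, 1/v).\<close>

lemma echi_zero:
  assumes j: "jchar \<chi> wp" and v: "unit_elt v" "\<chi> v (1 / v) \<noteq> (1 :: 'k)"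
  shows "echi \<chi> = 0"
proof -
  have vi: "unit_elt (1 / v)" using unit_elt_divide[OF unit_elt_1 v(1)] .
  have "echi \<chi> = (\<Sum>m\<in>res - {0}. \<chi> (m * v) (- 1 / (m * v)))"
    unfolding echi_def
  proof (rule res_sum_reindex[symmetric, where g = "\<lambda>z. \<chi> z (- 1 / z)"])
    show "vge 0 (l * v)" if "l \<in> res - {0}" for l using that res_integral v(1) by simp
    show "rrep (l * v) \<in> res - {0}" if "l \<in> res - {0}" for l
      using that res_unit v(1) by (intro rrep_unit unit_elt_mult) auto
    show "vge 1 (l - m)" if "vge 1 (l * v - m * v)" for l m
      using that vge_mult_unit(2)[OF v(1), of 1 "l - m"] by (simp add: left_diff_distrib)
    show "\<chi> x (- 1 / x) = \<chi> z (- 1 / z)" if xz: "vge 0 x" "z \<in> res - {0}" "vge 1 (x - z)" for x z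
    proof -
      have z: "unit_elt z" using xz(2) res_unit by blast
      then have x: "unit_elt x" using unit_elt_cong[of z x] xz(3) vge_diff_comm by blast
      have zi: "unit_elt (- 1 / z)" using unit_elt_divide[OF unit_elt_1 z] by simp
      have "x / z - 1 = (x - z) / z" using unit_elt_nonzero[OF z] by (simp add: diff_divide_distrib)
      then have 1: "vge 1 (x / z - 1)" using xz(3) z by simp
      have "\<chi> (z * (x / z)) (- 1 / z * (z / x)) = \<chi> z (- 1 / z) * \<chi> (x / z) (z / x)"
        using x z zi by (intro jchar_units(1)[OF j] unit_elt_divide) auto
      moreover have "\<chi> (x / z) (z / x) = 1"
        using one_unit_inverse[OF _ 1] by (intro jchar_one[OF j 1]) simp
      ultimately show ?thesis using unit_elt_nonzero[OF x] unit_elt_nonzero[OF z] by simp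
    qed
  qed auto
  also have "\<dots> = (\<Sum>m\<in>res - {0}. \<chi> m (- 1 / m) * \<chi> v (1 / v))"
  proof (intro sum.cong refl)
    fix m assume "m \<in> res - {0}"
    then have m: "unit_elt m" using res_unit by blast
    then have "unit_elt (- 1 / m)" using unit_elt_divide[OF unit_elt_1 m] by simp
    from jchar_units(1)[OF j m this v(1) vi] show "\<chi> (m * v) (- 1 / (m * v)) = \<chi> m (- 1 / m) * \<chi> v (1 / v)"
      by simp
  qed
  also have "\<dots> = echi \<chi> * \<chi> v (1 / v)" by (simp add: echi_def sum_distrib_right)
  finally show ?thesis using v(2) by simp
qed

text \<open>This makes S kill the test vector S \<delta>s - e \<delta> in
  \<open>Hecke_relation\<close>. If \<chi>(v, 1/v) = 1 for all units v, then \<chi> is symmetric on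
  units; otherwise both sums vanish by \<open>echi_zero\<close>.\<close>

lemma echi_flip:
  assumes j: "jchar \<chi> wp" "jchar (flip \<chi>) wp"
  shows "(echi \<chi> = 0 \<and> echi (flip \<chi>) = (0 :: 'k)) \<or>
    (echi (flip \<chi>) = echi \<chi> \<and> delta (flip \<chi>) wp = delta \<chi> wp)"
proof (cases "\<exists>v. unit_elt v \<and> \<chi> v (1 / v) \<noteq> 1")
  case True
  then obtain v where v: "unit_elt v" "\<chi> v (1 / v) \<noteq> 1" by blast
  then have "flip \<chi> (1 / v) (1 / (1 / v)) \<noteq> 1" by (simp add: flip_def)
  then show ?thesis using echi_zero[OF j(1) v] echi_zero[OF j(2) unit_elt_divide[OF unit_elt_1 v(1)]] by blast
next
  case False
  have eq: "flip \<chi> a d = \<chi> a d" if u: "unit_elt a" "unit_elt d" for a d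
  proof -
    have "\<chi> (a * (d / a)) (d * (a / d)) = \<chi> a d * \<chi> (d / a) (a / d)"
      using u by (intro jchar_units(1)[OF j(1)] unit_elt_divide)
    moreover have "\<chi> (d / a) (a / d) = 1" using False unit_elt_divide[OF u(2,1)] by (metis divide_divide_eq_right mult_1)
    ultimately show ?thesis using u by (simp add: flip_def unit_elt_nonzero)
  qed
  have "echi (flip \<chi>) = echi \<chi>"
    unfolding echi_def
  proof (intro sum.cong refl eq)
    fix m assume "m \<in> res - {0}"
    then show m: "unit_elt m" using res_unit by blast
    show "unit_elt (- 1 / m)" using unit_elt_divide[OF unit_elt_1 m] by simp
  qed
  moreover have "psi (flip \<chi>) wp g = psi \<chi> wp g" if g: "g \<in> IZ" for g
  proof -
    obtain a b c d where gg: "g = (a, b, c, d)" by (cases g)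
    have "a \<noteq> 0" "d \<noteq> 0" "val d = val a" using g by (auto simp: gg IZ_def)
    then have "unit_elt (a / unif powi val a)" "unit_elt (d / unif powi val a)"
      using upart_unit[of a] upart_unit[of d] by (simp_all add: upart_def)
    then show ?thesis by (simp add: gg psi_def eq)
  qed
  then have "delta (flip \<chi>) wp = delta \<chi> wp" by (auto simp: delta_def fun_eq_iff)
  ultimately show ?thesis by blast
qed

lemma central_So:
  assumes x: "x \<in> V" and c: "act (dm unif unif) x = sc wp x"
  shows "act (dm unif unif) (So x) = sc wp (So x)" "act (dm unif unif) (act pm x) = sc wp (act pm x)"
proof -
  have comm: "act (dm unif unif) (act g z) = act g (act (dm unif unif) z)" if "g \<in> GL2" "z \<in> V" for g z
  proof (rule act_eq)
    show "mmul (dm unif unif) g = mmul g (dm unif unif)" by (cases g) (simp add: mult.commute)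
  qed (use that in auto)
  have "act (dm unif unif) (So x) = (\<Sum>l\<in>res. act (dm unif unif) (act (um l) (act sm x)))"
    unfolding So_def usum_def using x by (intro act_sum) auto
  also have "\<dots> = (\<Sum>l\<in>res. sc wp (act (um l) (act sm x)))"
    using x by (simp add: comm c act_scale)
  finally show "act (dm unif unif) (So x) = sc wp (So x)" by (simp add: So_def usum_def scale_sum_right)
  show "act (dm unif unif) (act pm x) = sc wp (act pm x)"
    using x by (simp add: comm c act_scale)
qed

text \<open>If both combinations vanished, then X^2 D = wp e^2 D. Comparing degrees gives D = 0, and
  then C = 0.\<close>

lemma two_term_relation_polys:
  assumes wp: "wp \<noteq> (0 :: 'k)" and nz: "C \<noteq> 0 \<or> D \<noteq> 0"
  shows "smult e C + pCons 0 D \<noteq> 0 \<or> pCons 0 C + smult (wp * e) D \<noteq> 0"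
proof (rule ccontr)
  assume "\<not> ?thesis"
  then have "pCons 0 D + smult e C = 0" and "pCons 0 C + smult (wp * e) D = 0"
    by (simp_all add: add.commute)
  then have 1: "pCons 0 D = - smult e C" and 2: "pCons 0 C = - smult (wp * e) D"
    by (simp_all only: eq_neg_iff_add_eq_0)
  have "pCons 0 (pCons 0 D) = pCons 0 (smult (- e) C)" by (simp add: 1)
  also have "\<dots> = smult (- e) (pCons 0 C)" by simp
  also have "\<dots> = smult (e * (wp * e)) D" unfolding 2 by simp
  finally have eq: "pCons 0 (pCons 0 D) = smult (e * (wp * e)) D" .
  have D: "D = 0"
  proof (rule ccontr)
    assume "D \<noteq> 0"
    then have "degree (pCons 0 (pCons 0 D)) = degree D + 2" by simp
    moreover have "degree (smult (e * (wp * e)) D) \<le> degree D" by (rule degree_smult_le)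
    ultimately show False using eq by simp
  qed
  then have "C = 0" using 2 by simp
  then show False using D nz by blast
qed

end

context fun_pair
begin

lemma Hecke_relation:
  assumes irr: "irreducible_rep sc V act" and x': "B.eig \<chi> x'" "B.So x' \<noteq> 0"
    and wp: "act (dm unif unif) x' = sc wp x'"
    and no1: "B.Uo (B.So x') \<noteq> B.So x'"
  shows "\<exists>C D :: nat \<Rightarrow> 'k. \<exists>N. (\<exists>n<N. C n \<noteq> 0 \<or> D n \<noteq> 0) \<and>
    (\<Sum>n<N. sc (C n) ((B.Uo ^^ n) (B.So x')) + sc (D n) (act pm ((B.Uo ^^ n) (B.So x')))) = 0"
proof -
  define x where "x = B.So x'"
  have x'V: "x' \<in> V" using x' B.eig_V by blast
  have xV: "x \<in> V" using B.So_closed[OF x'V] by (simp add: x_def)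
  have "B.So 0 = 0" by (rule linear_operator.f_zero[OF B.So_linear])
  then have x'0: "x' \<noteq> 0" using x'(2) by auto
  have j: "jchar \<chi> wp" using B.eig_jchar[OF x'(1) x'0 wp] .
  have pm0: "act pm x' \<noteq> 0" using B.act_inj[of pm x'] x'V x'0 by auto
  have js: "jchar (flip \<chi>) wp"
    using B.eig_jchar[OF B.eig_pm[OF x'(1)] pm0 B.central_So(2)[OF x'V wp]] .
  have wp0: "wp \<noteq> 0" using B.central_powi(1)[OF x'V x'0 wp] .
  define \<delta> where "\<delta> = delta \<chi> wp"
  define f where "f = A.So \<delta>"
  note F = rep_Fun[OF B.coeff]
  have \<delta>F: "\<delta> \<in> Fun" unfolding \<delta>_def by (rule delta_Fun[OF j])
  have \<delta>e: "A.eig \<chi> \<delta>" unfolding \<delta>_def by (rule delta_eig[OF j F])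
  have \<delta>c: "ind_act (dm unif unif) \<delta> = ind_scale wp \<delta>" unfolding \<delta>_def by (rule delta_central[OF j])
  have fF: "f \<in> Fun" unfolding f_def by (rule A.So_closed[OF \<delta>F])
  have free: "w = 0" if "(0, w) \<in> P.cyc (\<delta>, x')" for w
    using delta_free[OF j x'V B.IZ_eig[OF x'(1) x'0 wp]] that by (simp add: \<delta>_def)
  \<comment> \<open>Pairing \<open>Fun\<close> with itself provides test maps from \<delta> to d
    within \<open>Fun\<close>. By \<open>Qfree\<close> they are well defined for nonzero
    eigenvectors d with the data \<chi> and wp.\<close>
  interpret Q: fun_pair val p "ind_scale :: 'k \<Rightarrow> ('f mat2 \<Rightarrow> 'k) \<Rightarrow> _" Fun ind_act
    by (rule rep.fun_pair[OF F])
  have Qfree: "w = 0" if "A.eig \<chi> d" "d \<noteq> 0" "ind_act (dm unif unif) d = ind_scale wp d"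
    "(0, w) \<in> Q.P.cyc (\<delta>, d)" for d w
    using Q.delta_free[OF j A.eig_V[OF that(1)] A.IZ_eig[OF that(1-3)]] that(4) by (simp add: \<delta>_def)
  define z where "z = (\<delta>, x')"
  have zV: "z \<in> Fun \<times> V" using \<delta>F x'V by (simp add: z_def)
  have Sz: "P.So z = (f, x)" by (simp add: pair_So z_def f_def x_def)
  have fxV: "(f, x) \<in> Fun \<times> V" using fF xV by simp
  have fx_cyc: "P.cyc (f, x) \<subseteq> P.cyc z"
    using P.stable_So(1)[OF P.subspace_cyc P.stable_cyc[OF zV] P.cyc_self[OF zV]] Sz
    by (intro P.cyc_minimal P.subspace_cyc P.stable_cyc[OF zV]) simp
  \<comment> \<open>The relation comes from writing x in terms of translates of U x - x; it is nontrivial because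
    the principal series contains an image of f on which U - 1 vanishes.\<close>
  obtain F0 where F0: "(F0, 0) \<in> P.cyc (f, x)" "F0 \<noteq> 0"
  proof -
    define y0 where "y0 = B.Uo x - x"
    have y0: "y0 \<in> V" "y0 \<noteq> 0" using no1 xV B.Uo_closed by (auto simp: y0_def x_def)
    define Y where "Y = P.Uo (f, x) - (f, x)"
    have Ye: "Y = (A.Uo f - f, y0)" by (simp add: Y_def y0_def pair_Uo minus_prod_def)
    have YV: "Y \<in> Fun \<times> V" using P.Uo_closed[OF fxV] fxV by (auto simp: Y_def intro!: P.V_diff)
    have Yc: "P.cyc Y \<subseteq> P.cyc (f, x)"
      unfolding Y_def
      by (intro P.cyc_minimal P.subspace_cyc P.stable_cyc fxV P.subspace_diff[OF P.subspace_cyc]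
          P.stable_So(2)[OF P.subspace_cyc] P.cyc_self)
    \<comment> \<open>U x - x is nonzero and hence generates V by irreducibility.\<close>
    have "x \<in> snd ` P.cyc Y"
      using cyc_snd[OF YV] B.irreducible_cyc[OF irr y0] xV by (simp add: Ye)
    then obtain F1 where F1: "(F1, x) \<in> P.cyc Y" by force
    have "(f, x) - (F1, x) \<in> P.cyc (f, x)"
      using F1 Yc P.cyc_self[OF fxV] P.subspace_diff[OF P.subspace_cyc] by blast
    then have rel: "(f - F1, 0) \<in> P.cyc (f, x)" by (simp add: minus_prod_def)
    have "f \<noteq> F1"
    proof
      assume "f = F1"
      then have f_cyc: "f \<in> A.cyc (A.Uo f - f)" using F1 cyc_fst[OF YV] by (force simp: Ye)
      \<comment> \<open>The test map from \<delta> to d = Pi f1 sends f = S \<delta> to U f1 = f1,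
        and U f - f to 0; so f in the span of translates of U f - f would force f1 = 0. Starting
        from \<open>flip \<chi>\<close> makes d an eigenvector for \<chi>.\<close>
      define f1 where "f1 = psf (flip \<chi>) wp 1"
      note ps = js wp0 one_neq_zero
      have f1F: "f1 \<in> Fun" unfolding f1_def by (rule psf_Fun[OF ps])
      have f1e: "A.eig (flip \<chi>) f1" unfolding f1_def by (rule psf_eig[OF ps F])
      have f1c: "ind_act (dm unif unif) f1 = ind_scale wp f1" unfolding f1_def by (rule psf_central[OF ps])
      have f1U: "A.Uo f1 = f1" unfolding f1_def using psf_Uo[OF ps F] by (simp add: ind_scale_def)
      have f10: "f1 \<noteq> 0" using psf_sm[OF ps] by (metis f1_def zero_fun_apply zero_neq_one)
      define d where "d = ind_act pm f1"
      have dF: "d \<in> Fun" using A.act_closed[of pm f1] f1F by (simp add: d_def)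
      have de: "A.eig \<chi> d" using A.eig_pm[OF f1e] by (simp add: d_def)
      have d0: "d \<noteq> 0" using A.act_inj[of pm f1] f1F f10 by (auto simp: d_def)
      have dc: "ind_act (dm unif unif) d = ind_scale wp d" unfolding d_def by (rule A.central_So(2)[OF f1F f1c])
      have Sd: "A.So d = f1" using f1U by (simp add: A.Uo_def d_def)
      have dV: "(\<delta>, d) \<in> Fun \<times> Fun" using \<delta>F dF by simp
      have fd: "(f, f1) \<in> Q.P.cyc (\<delta>, d)"
        using Q.P.stable_So(1)[OF Q.P.subspace_cyc Q.P.stable_cyc[OF dV] Q.P.cyc_self[OF dV]]
        by (simp add: Q.pair_So f_def Sd)
      have "Q.P.Uo (f, f1) - (f, f1) \<in> Q.P.cyc (\<delta>, d)"
        using Q.P.stable_So(2)[OF Q.P.subspace_cyc Q.P.stable_cyc[OF dV] fd] fd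
        by (rule Q.P.subspace_diff[OF Q.P.subspace_cyc])
      then have U0: "(A.Uo f - f, 0) \<in> Q.P.cyc (\<delta>, d)" by (simp add: Q.pair_Uo f1U minus_prod_def)
      have UV: "(A.Uo f - f, 0 :: 'f mat2 \<Rightarrow> 'k) \<in> Fun \<times> Fun" using A.Uo_closed[OF fF] fF by auto
      obtain G where G: "(f, G) \<in> Q.P.cyc (A.Uo f - f, 0)" using Q.cyc_fst[OF UV] f_cyc by force
      then have "G \<in> A.cyc 0" using Q.cyc_snd[OF UV] by force
      then have "G = 0" by (simp add: A.cyc_zero)
      then have "(f, 0) \<in> Q.P.cyc (\<delta>, d)"
        using G Q.P.cyc_minimal[OF Q.P.subspace_cyc Q.P.stable_cyc[OF dV] U0] by blast
      then have "(f, f1) - (f, 0) \<in> Q.P.cyc (\<delta>, d)" by (rule Q.P.subspace_diff[OF Q.P.subspace_cyc fd])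
      then have "(0, f1) \<in> Q.P.cyc (\<delta>, d)" by (simp add: minus_prod_def)
      then show False using Qfree[OF de d0 dc] f10 by blast
    qed
    then show thesis using that rel by auto
  qed
  obtain F where F: "(F, 0) \<in> P.cyc (f, x)" "F \<noteq> 0" "A.fixed 0 1 F"
  proof -
    define R where "R = {F. (F, 0) \<in> P.cyc (f, x)}"
    have "A.subspace R"
      unfolding R_def
    proof (intro A.subspaceI CollectI)
      show "(0, 0) \<in> P.cyc (f, x)" using P.subspace_0[OF P.subspace_cyc] by (simp add: zero_prod_def)
      show "(u + v, 0) \<in> P.cyc (f, x)" if "u \<in> {F. (F, 0) \<in> P.cyc (f, x)}" "v \<in> {F. (F, 0) \<in> P.cyc (f, x)}" for u v
        using that P.subspace_add[OF P.subspace_cyc, of "(u, 0)" "(f, x)" "(v, 0)"] by simp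
      show "(ind_scale c u, 0) \<in> P.cyc (f, x)" if "u \<in> {F. (F, 0) \<in> P.cyc (f, x)}" for c u
        using that P.subspace_scale[OF P.subspace_cyc, of "(u, 0)" "(f, x)" c] by (simp add: psc_def)
    qed
    moreover have "R \<subseteq> Fun" using P.cyc_subset[OF fxV] by (auto simp: R_def)
    moreover have "stable GL2 ind_act R"
      using P.stable_cyc[OF fxV] unfolding stable_def R_def pact_def by fastforce
    ultimately show thesis using A.ex_fixed[of R F0] F0 that by (auto simp: R_def)
  qed
  have FA: "F \<in> A.cyc f" using F(1) cyc_fst[OF fxV] by force
  have \<delta>V: "A.cyc f \<subseteq> A.cyc \<delta>"
    unfolding f_def
    by (intro A.cyc_minimal A.subspace_cyc A.stable_cyc \<delta>F A.stable_So(1)[OF A.subspace_cyc] A.cyc_self)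
  have Fl: "F \<in> left_eig \<chi> wp" using FA \<delta>V cyc_delta_left_eig[OF j] by (auto simp: \<delta>_def)
  obtain N where N: "\<And>\<epsilon> \<eta> n. n \<ge> N \<Longrightarrow> F (minv (wm \<epsilon> \<eta> n)) = 0"
    using cyc_delta_finite_support[OF j] FA \<delta>V unfolding \<delta>_def by blast
  define c where "c \<epsilon> \<eta> n = F (minv (wm \<epsilon> \<eta> n))" for \<epsilon> \<eta> n
  define J where "J = (UNIV :: bool set) \<times> (UNIV :: bool set) \<times> {..<N}"
  have fJ: "finite J" by (simp add: J_def)
  define G where "G = (\<Sum>(\<epsilon>, \<eta>, n)\<in>J. ind_scale (c \<epsilon> \<eta> n) (A.Tw \<epsilon> \<eta> n \<delta>))"
  have G\<delta>: "G \<in> A.cyc \<delta>"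
    unfolding G_def
    by (intro A.subspace_sum[OF A.subspace_cyc])
      (auto intro!: A.subspace_scale[OF A.subspace_cyc] A.stable_Tw[OF A.subspace_cyc A.stable_cyc[OF \<delta>F] A.cyc_self[OF \<delta>F]])
  \<comment> \<open>An invariant function is determined by its values at the inverses of
    \<open>wm\<close>, and G is built from those of F.\<close>
  have "F = G"
  proof (rule fixed_left_eig_eqI[OF Fl F(3)])
    show "G \<in> left_eig \<chi> wp" using G\<delta> cyc_delta_left_eig[OF j] by (auto simp: \<delta>_def)
    show "A.fixed 0 1 G"
      unfolding G_def by (intro A.fixed_sum) (auto intro!: A.fixed_scale A.fixed_Tw A.eig_fixed[OF \<delta>e])
    fix \<epsilon> \<eta> n
    have "G (minv (wm \<epsilon> \<eta> n)) = (\<Sum>i\<in>J. if i = (\<epsilon>, \<eta>, n) then c \<epsilon> \<eta> n else 0)"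
      unfolding G_def sum_fun_apply
      by (intro sum.cong refl) (auto simp: \<delta>_def Tw_delta_wm[OF j] split: if_splits)
    also have "\<dots> = F (minv (wm \<epsilon> \<eta> n))" using N[of n \<epsilon> \<eta>] fJ by (auto simp: J_def c_def)
    finally show "F (minv (wm \<epsilon> \<eta> n)) = G (minv (wm \<epsilon> \<eta> n))" by simp
  qed
  have rel: "(\<Sum>(\<epsilon>, \<eta>, n)\<in>J. sc (c \<epsilon> \<eta> n) (B.Tw \<epsilon> \<eta> n x')) = 0"
  proof -
    let ?H = "\<Sum>(\<epsilon>, \<eta>, n)\<in>J. psc (c \<epsilon> \<eta> n) (P.Tw \<epsilon> \<eta> n z)"
    have "?H \<in> P.cyc z"
      by (intro P.subspace_sum[OF P.subspace_cyc])
        (auto intro!: P.subspace_scale[OF P.subspace_cyc] P.stable_Tw[OF P.subspace_cyc P.stable_cyc[OF zV] P.cyc_self[OF zV]])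
    moreover have "?H = (F, \<Sum>(\<epsilon>, \<eta>, n)\<in>J. sc (c \<epsilon> \<eta> n) (B.Tw \<epsilon> \<eta> n x'))"
      unfolding \<open>F = G\<close> G_def by (simp add: prod_eq_iff fst_sum snd_sum case_prod_unfold pair_Tw z_def)
    ultimately have 1: "(F, \<Sum>(\<epsilon>, \<eta>, n)\<in>J. sc (c \<epsilon> \<eta> n) (B.Tw \<epsilon> \<eta> n x')) \<in> P.cyc z" by simp
    have 2: "(F, 0) \<in> P.cyc z" using F(1) fx_cyc by blast
    have "(0, \<Sum>(\<epsilon>, \<eta>, n)\<in>J. sc (c \<epsilon> \<eta> n) (B.Tw \<epsilon> \<eta> n x')) \<in> P.cyc (\<delta>, x')"
      using P.subspace_diff[OF P.subspace_cyc 1 2] unfolding minus_prod_def fst_conv snd_conv diff_self diff_zero z_def .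
    then show ?thesis by (rule free)
  qed
  \<comment> \<open>The test vector d is killed by S, hence so is the submodule generated by f; this eliminates the
    words not ending in S.\<close>
  have c0: "c \<epsilon> False n = 0" for \<epsilon> n
  proof (cases "n < N")
    case True
    define \<delta>s where "\<delta>s = delta (flip \<chi>) wp"
    have \<delta>sF: "\<delta>s \<in> Fun" unfolding \<delta>s_def by (rule delta_Fun[OF js])
    have \<delta>se: "A.eig (flip \<chi>) \<delta>s" unfolding \<delta>s_def by (rule delta_eig[OF js rep_Fun[OF B.coeff]])
    define e where "e = echi \<chi>"
    \<comment> \<open>S d = 0 by \<open>So_So\<close> and \<open>echi_flip\<close>: either both
      eigenvalues vanish, or they agree and \<delta>s = \<delta>. The term S \<delta>s makes the
      words with \<eta> false visible at the inverses of
      \<open>wm \<epsilon> True n\<close>.\<close>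
    define d where "d = A.So \<delta>s - ind_scale e \<delta>"
    have SsF: "A.So \<delta>s \<in> Fun" by (rule A.So_closed[OF \<delta>sF])
    have dF: "d \<in> Fun" using SsF \<delta>F by (auto simp: d_def)
    have Tval: "A.Tw \<epsilon>' False n' d (minv (wm \<epsilon> True n)) = (if \<epsilon>' = \<epsilon> \<and> n' = n then 1 else 0)" for \<epsilon>' n' \<epsilon> n
      unfolding d_def A.Tw_diff_scale[OF SsF \<delta>F] A.Tw_So
      by (simp add: \<delta>_def \<delta>s_def Tw_delta_wm[OF j] Tw_delta_wm[OF js])
    have d0: "d \<noteq> 0"
    proof
      assume "d = 0"
      then have "A.Tw False False 0 d = 0" using A.Tw_scale[OF A.V_0, of False False 0 0] by simp
      then show False using Tval[of False 0 False 0] by simp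
    qed
    have "A.eig \<chi> (A.So \<delta>s)" using A.eig_So[OF \<delta>se] by simp
    then have de: "A.eig \<chi> d"
      using A.subspace_diff[OF A.subspace_eig] A.subspace_scale[OF A.subspace_eig] \<delta>e by (auto simp: d_def)
    have dc: "ind_act (dm unif unif) d = ind_scale wp d"
    proof -
      have "ind_act (dm unif unif) (A.So \<delta>s) = ind_scale wp (A.So \<delta>s)"
        unfolding \<delta>s_def by (rule A.central_So(1)[OF delta_Fun[OF js] delta_central[OF js]])
      then show ?thesis
        using SsF \<delta>F \<delta>c by (simp add: d_def A.act_diff A.act_scale A.scale_right_diff_distrib mult.commute)
    qed
    have Sd: "A.So d = 0"
    proof -
      have "A.So d = A.So (A.So \<delta>s) - ind_scale e (A.So \<delta>)"
        unfolding d_def using linear_operator.f_diff[OF A.So_linear SsF A.V_scale[OF \<delta>F]] A.So_scale[OF \<delta>F] by simp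
      also have "A.So (A.So \<delta>s) = ind_scale (echi (flip \<chi>)) (A.So \<delta>s)" by (rule A.So_So[OF \<delta>se])
      finally show ?thesis
        using A.echi_flip[OF j js] by (auto simp: e_def \<delta>s_def \<delta>_def)
    qed
    have dV: "(\<delta>, d) \<in> Fun \<times> Fun" using \<delta>F dF by simp
    have f0: "(f, 0) \<in> Q.P.cyc (\<delta>, d)"
      using Q.P.stable_So(1)[OF Q.P.subspace_cyc Q.P.stable_cyc[OF dV] Q.P.cyc_self[OF dV]]
      by (simp add: Q.pair_So f_def Sd)
    have f0V: "(f, 0 :: 'f mat2 \<Rightarrow> 'k) \<in> Fun \<times> Fun" using fF by simp
    obtain H where H: "(F, H) \<in> Q.P.cyc (f, 0)" using Q.cyc_fst[OF f0V] FA by force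
    then have "H \<in> A.cyc 0" using Q.cyc_snd[OF f0V] by force
    then have "H = 0" by (simp add: A.cyc_zero)
    then have FQ: "(F, 0) \<in> Q.P.cyc (\<delta>, d)"
      using H Q.P.cyc_minimal[OF Q.P.subspace_cyc Q.P.stable_cyc[OF dV] f0] by blast
    let ?K = "\<Sum>(\<epsilon>, \<eta>, n)\<in>J. Q.psc (c \<epsilon> \<eta> n) (Q.P.Tw \<epsilon> \<eta> n (\<delta>, d))"
    let ?k = "\<Sum>(\<epsilon>, \<eta>, n)\<in>J. ind_scale (c \<epsilon> \<eta> n) (A.Tw \<epsilon> \<eta> n d)"
    have "?K \<in> Q.P.cyc (\<delta>, d)"
      by (intro Q.P.subspace_sum[OF Q.P.subspace_cyc])
        (auto intro!: Q.P.subspace_scale[OF Q.P.subspace_cyc]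
          Q.P.stable_Tw[OF Q.P.subspace_cyc Q.P.stable_cyc[OF dV] Q.P.cyc_self[OF dV]])
    moreover have "?K = (F, ?k)"
      unfolding \<open>F = G\<close> G_def by (simp add: prod_eq_iff fst_sum snd_sum case_prod_unfold Q.pair_Tw)
    ultimately have 1: "(F, ?k) \<in> Q.P.cyc (\<delta>, d)" by simp
    have "(0, ?k) \<in> Q.P.cyc (\<delta>, d)"
      using Q.P.subspace_diff[OF Q.P.subspace_cyc 1 FQ] unfolding minus_prod_def fst_conv snd_conv diff_self diff_zero .
    then have "?k = 0" by (rule Qfree[OF de d0 dc])
    from fun_cong[OF this, of "minv (wm \<epsilon> True n)"]
    have "0 = (\<Sum>(\<epsilon>', \<eta>', n')\<in>J. c \<epsilon>' \<eta>' n' * A.Tw \<epsilon>' \<eta>' n' d (minv (wm \<epsilon> True n)))"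
      by (simp add: sum_fun_apply case_prod_unfold)
    also have "\<dots> = (\<Sum>i\<in>J. if i = (\<epsilon>, False, n) then c \<epsilon> False n else 0)"
    proof (intro sum.cong refl)
      fix i assume "i \<in> J"
      obtain \<epsilon>' \<eta>' n' where i: "i = (\<epsilon>', \<eta>', n')" by (cases i)
      have "A.Tw \<epsilon>' True n' d = 0"
        using A.Tw_So[of \<epsilon>' n' d] A.Tw_scale[OF A.V_0, of \<epsilon>' False n' 0] by (simp add: Sd)
      then show "(case i of (\<epsilon>', \<eta>', n') \<Rightarrow> c \<epsilon>' \<eta>' n' * A.Tw \<epsilon>' \<eta>' n' d (minv (wm \<epsilon> True n))) =
          (if i = (\<epsilon>, False, n) then c \<epsilon> False n else 0)"
        by (cases \<eta>') (auto simp: i Tval)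
    qed
    also have "\<dots> = c \<epsilon> False n" using True fJ by (auto simp: J_def)
    finally show ?thesis by simp
  qed (use N in \<open>simp add: c_def\<close>)
  have "(\<Sum>n<N. sc (c False True n) ((B.Uo ^^ n) x) + sc (c True True n) (act pm ((B.Uo ^^ n) x))) = 0"
  proof -
    have "0 = (\<Sum>\<epsilon>\<in>UNIV. \<Sum>\<eta>\<in>UNIV. \<Sum>n<N. sc (c \<epsilon> \<eta> n) (B.Tw \<epsilon> \<eta> n x'))"
      using rel by (simp add: J_def sum.cartesian_product)
    then show ?thesis
      by (simp add: UNIV_bool c0 B.Tw_def x_def sum.distrib add.commute)
  qed
  moreover have "\<exists>n<N. c False True n \<noteq> 0 \<or> c True True n \<noteq> 0"
  proof (rule ccontr)
    assume *: "\<not> ?thesis"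
    have "c \<epsilon> \<eta> n = 0" for \<epsilon> \<eta> n
      using * c0 N[of n \<epsilon> \<eta>] by (cases \<epsilon>; cases \<eta>; cases "n < N") (auto simp: c_def)
    then have "G = 0" unfolding G_def by (intro sum.neutral) (auto simp: fun_eq_iff)
    then show False using F(2) \<open>F = G\<close> by simp
  qed
  ultimately show ?thesis unfolding x_def by blast
qed

end

context rep
begin

lemma annihilating_poly:
  assumes x': "eig \<chi> x'" and wpc: "\<And>v. v \<in> V \<Longrightarrow> act (dm unif unif) v = sc wp v"
    and wp0: "wp \<noteq> 0"
    and nz: "n < N" "C n \<noteq> 0 \<or> D n \<noteq> 0"
    and rel: "(\<Sum>n<N. sc (C n) ((Uo ^^ n) (So x')) + sc (D n) (act pm ((Uo ^^ n) (So x')))) = 0"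
  shows "\<exists>q. q \<noteq> 0 \<and> poly_op sc Uo q (So x') = 0"
proof -
  define x where "x = So x'"
  define e where "e = echi \<chi>"
  interpret U: linear_operator sc V Uo by (rule Uo_linear)
  interpret S: linear_operator sc V So by (rule So_linear)
  \<comment> \<open>S acts on W by the scalar e, and U preserves W because U = S Pi has values in
    the image of S. This lets S pass through polynomials in U.\<close>
  define W where "W = {u. eig (flip \<chi>) u \<and> So u = sc e u}"
  have WV: "W \<subseteq> V" using eig_V by (auto simp: W_def)
  have xW: "x \<in> W" using eig_So[OF x'] So_So[OF x'] by (simp add: W_def x_def e_def)
  then have xV: "x \<in> V" using WV by blast
  have subW: "subspace W"
  proof (intro subspaceI)
    show "0 \<in> W" using subspace_0[OF subspace_eig] by (simp add: W_def S.f_zero)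
    show "u + v \<in> W" if "u \<in> W" "v \<in> W" for u v
      using that subspace_add[OF subspace_eig, of u "flip \<chi>" v] WV
      by (auto simp: W_def S.f_add scale_right_distrib eig_V)
    show "sc c u \<in> W" if "u \<in> W" for c u
      using that subspace_scale[OF subspace_eig, of u "flip \<chi>" c]
      by (auto simp: W_def S.f_scale mult.commute eig_V)
  qed
  have UW: "Uo u \<in> W" if "u \<in> W" for u
  proof -
    have u: "eig (flip \<chi>) u" using that by (simp add: W_def)
    have "eig \<chi> (act pm u)" using eig_pm[OF u] by simp
    then show ?thesis using eig_Uo[OF u] So_So[of \<chi> "act pm u"] by (simp add: W_def Uo_def e_def)
  qed
  interpret UW: linear_operator sc W Uo
    by unfold_locales
      (use subW UW WV U.f_add U.f_scale vector_space_axioms in \<open>auto simp: lin_op_def lin_on_def subset_iff\<close>)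
  define Cp Dp where "Cp = (\<Sum>n<N. monom (C n) n)" and "Dp = (\<Sum>n<N. monom (D n) n)"
  have coeff: "coeff (\<Sum>n<N. monom (E n) n) i = (if i < N then E i else 0)" for E :: "nat \<Rightarrow> 'k" and i
    by (simp add: coeff_sum)
  have pnz: "Cp \<noteq> 0 \<or> Dp \<noteq> 0"
    using nz coeff[of C n] coeff[of D n] by (auto simp: Cp_def Dp_def)
  have psum: "poly_op sc Uo (\<Sum>n<N. monom (E n) n) x = (\<Sum>n<N. sc (E n) ((Uo ^^ n) x))" for E :: "nat \<Rightarrow> 'k"
    by (induction N) (simp_all add: U.poly_op_0 U.poly_op_add U.poly_op_monom)
  define u v where "u = poly_op sc Uo Cp x" and "v = poly_op sc Uo Dp x"
  have uv: "u \<in> W" "v \<in> W" using UW.poly_op_closed[OF xW] by (auto simp: u_def v_def)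
  then have uvV: "u \<in> V" "v \<in> V" using WV by auto
  have Se: "So u = sc e u" "So v = sc e v" using uv by (auto simp: W_def)
  have rel': "u + act pm v = 0"
  proof -
    have "act pm v = (\<Sum>n<N. sc (D n) (act pm ((Uo ^^ n) x)))"
      unfolding v_def Dp_def psum using xV by (simp add: act_sum act_scale U.funpow_closed)
    moreover have "u = (\<Sum>n<N. sc (C n) ((Uo ^^ n) x))" unfolding u_def Cp_def by (rule psum)
    ultimately show ?thesis using rel by (simp add: sum.distrib x_def)
  qed
  \<comment> \<open>S Pi is U, so the second term contributes U v.\<close>
  have "So (u + act pm v) = poly_op sc Uo (smult e Cp + pCons 0 Dp) x"
    using uvV Se by (simp add: S.f_add U.poly_op_add U.poly_op_smult U.poly_op_pCons[OF xV] u_def v_def Uo_def)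
  then have 1: "poly_op sc Uo (smult e Cp + pCons 0 Dp) x = 0" using rel' by (simp add: S.f_zero)
  \<comment> \<open>U Pi is S Pi Pi, and Pi Pi is the central element that acts by wp.\<close>
  have "Uo (act pm v) = sc (wp * e) v"
    unfolding Uo_def using uvV Se by (simp add: pm_pm wpc S.f_scale)
  then have "Uo (u + act pm v) = poly_op sc Uo (pCons 0 Cp + smult (wp * e) Dp) x"
    using uvV by (simp add: U.f_add U.poly_op_add U.poly_op_smult U.poly_op_pCons[OF xV] u_def v_def)
  then have 2: "poly_op sc Uo (pCons 0 Cp + smult (wp * e) Dp) x = 0" using rel' by (simp add: U.f_zero)
  show ?thesis using two_term_relation_polys[OF wp0 pnz, of e] 1 2 unfolding x_def by blast
qed

text \<open>With x = S x', the eigenvector is sought among polynomials in U applied to U x instead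
  of x. It then has the form U u = S (Pi u), so S acts on it by a scalar, and its U-eigenvalue is 0
  by \<open>no\<close>. If U x = 0, then x itself is good.\<close>

lemma good_vector_of_annihilating_poly:
  assumes x': "eig \<chi> x'" "So x' \<noteq> 0" and q: "q \<noteq> 0" "poly_op sc Uo q (So x') = 0"
    and no: "\<And>\<chi> x lam. eig \<chi> x \<Longrightarrow> x \<noteq> 0 \<Longrightarrow> lam \<noteq> 0 \<Longrightarrow> Uo x \<noteq> sc lam x"
  shows "\<exists>y. good_vector y"
proof (cases "Uo (So x') = 0")
  case True
  then show ?thesis
    using x' eig_So[OF x'(1)] So_So[OF x'(1)] by (auto simp: good_vector_def)
next
  case False
  define x where "x = So x'"
  have xe: "eig (flip \<chi>) x" using eig_So[OF x'(1)] by (simp add: x_def)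
  define E where "E = {u. eig (flip \<chi>) u}"
  have EV: "E \<subseteq> V" using eig_V by (auto simp: E_def)
  interpret V: linear_operator sc V Uo by (rule Uo_linear)
  interpret U: linear_operator sc E Uo
    by unfold_locales
      (use subspace_eig[of "flip \<chi>"] eig_Uo EV V.f_add V.f_scale vector_space_axioms in
        \<open>auto simp: lin_op_def lin_on_def E_def eig_V\<close>)
  have xE: "x \<in> E" using xe by (simp add: E_def)
  have comm: "poly_op sc Uo r (Uo x) = Uo (poly_op sc Uo r x)" for r
  proof (induction r)
    case (pCons a r)
    have "poly_op sc Uo r x \<in> E" by (rule U.poly_op_closed[OF xE])
    then show ?case using pCons U.closed xE
      by (simp add: U.poly_op_pCons U.f_add U.f_scale subspace_scale[OF U.sub])
  qed (simp add: U.poly_op_0 U.f_zero)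
  have "poly_op sc Uo q x = 0" using q(2) by (simp add: x_def)
  then have "poly_op sc Uo q (Uo x) = 0" by (simp add: comm U.f_zero)
  then obtain r a where r: "poly_op sc Uo r (Uo x) \<noteq> 0" "Uo (poly_op sc Uo r (Uo x)) = sc a (poly_op sc Uo r (Uo x))"
    using U.eigenvector_of_annihilating_poly[OF alg_closed U.closed[OF xE] _ q(1)] False x_def by blast
  define u where "u = poly_op sc Uo r x"
  define y where "y = Uo u"
  have y: "y \<noteq> 0" "Uo y = sc a y" using r by (simp_all add: comm y_def u_def)
  have ue: "eig (flip \<chi>) u" using U.poly_op_closed[OF xE] by (simp add: u_def E_def)
  have ye: "eig (flip \<chi>) y" unfolding y_def by (rule eig_Uo[OF ue])
  have "a = 0" using no[OF ye y(1)] y(2) by blast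
  then have "Uo y = 0" using y by simp
  moreover have "So y = sc (echi \<chi>) y"
    using So_So[of \<chi> "act pm u"] eig_pm[OF ue] by (simp add: y_def Uo_def)
  ultimately show ?thesis using y ye by (auto simp: good_vector_def)
qed

end

context fun_pair
begin

lemma ex_good_vector:
  assumes ss: "supersingular val sc V act"
  shows "\<exists>y. B.good_vector y"
proof -
  have irr: "irreducible_rep sc V act" using ss by (simp add: supersingular_def)
  obtain \<omega> where \<omega>: "\<And>z v. z \<noteq> 0 \<Longrightarrow> v \<in> V \<Longrightarrow> act (dm z z) v = sc (\<omega> z) v"
    using ss by (auto simp: supersingular_def has_central_char_def)
  define wp where "wp = \<omega> unif"
  have wp: "act (dm unif unif) v = sc wp v" if "v \<in> V" for v using \<omega> that by (simp add: wp_def)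
  have no: "B.Uo x \<noteq> sc lam x" if "B.eig \<chi> x" "x \<noteq> 0" "lam \<noteq> 0" for \<chi> x lam
    using subquotient_of_U_eigenvector[OF irr that(1,2) wp[OF B.eig_V[OF that(1)]] that(3)] ss
    unfolding supersingular_def by metis
  have V0: "V \<noteq> {0}" using irr by (simp add: irreducible_rep_def)
  show ?thesis
  proof (cases "\<exists>\<chi> x. B.eig \<chi> x \<and> B.So x \<noteq> 0")
    case True
    then obtain \<chi> x where x: "B.eig \<chi> x" "B.So x \<noteq> 0" by blast
    have xV: "x \<in> V" using B.eig_V[OF x(1)] .
    have Sx: "B.eig (flip \<chi>) (B.So x)" by (rule B.eig_So[OF x(1)])
    have wp0: "wp \<noteq> 0" using B.central_powi(1)[OF B.eig_V[OF Sx] x(2) wp[OF B.eig_V[OF Sx]]] .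
    have "B.Uo (B.So x) \<noteq> B.So x" using no[OF Sx x(2), of 1] by simp
    from Hecke_relation[OF irr x wp[OF xV] this]
    obtain C D :: "nat \<Rightarrow> 'k" and N n where CD: "n < N" "C n \<noteq> 0 \<or> D n \<noteq> 0"
      "(\<Sum>n<N. sc (C n) ((B.Uo ^^ n) (B.So x)) + sc (D n) (act pm ((B.Uo ^^ n) (B.So x)))) = 0"
      by (elim exE conjE)
    obtain q where q: "q \<noteq> 0" "poly_op sc B.Uo q (B.So x) = 0"
      using B.annihilating_poly[OF x(1) _ wp0 CD] wp by blast
    show ?thesis by (rule B.good_vector_of_annihilating_poly[OF x q no])
  next
    case False
    \<comment> \<open>If S kills every eigenvector, so does U = S Pi, since Pi maps eigenvectors to
      eigenvectors. Any nonzero eigenvector is then good.\<close>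
    obtain \<chi> x where x: "B.eig \<chi> x" "x \<noteq> 0" using B.ex_eig[OF V0] by blast
    have "B.So x = sc 0 x" using False x by simp
    moreover have "B.Uo x = 0" using False B.eig_pm[OF x(1)] by (auto simp: B.Uo_def)
    ultimately show ?thesis using x by (auto simp: B.good_vector_def)
  qed
qed

end

theorem theorem4p4:
  fixes val :: "'f::field \<Rightarrow> int" and p :: nat
    and sc :: "'k::field \<Rightarrow> 'v::ab_group_add \<Rightarrow> 'v" and V :: "'v set"
    and act :: "'f mat2 \<Rightarrow> 'v \<Rightarrow> 'v"
    and sc' :: "'k \<Rightarrow> 'w::ab_group_add \<Rightarrow> 'w" and V' :: "'w set"
    and act' :: "'f mat2 \<Rightarrow> 'w \<Rightarrow> 'w"
  assumes "nonarch_local_field val p"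
    and "alg_closure_Fp p TYPE('k)"
    and "supersingular val sc V act"
    and "smooth_rep val sc' V' act'"
  shows "Hom Borel sc V act sc' V' act' = Hom GL2 sc V act sc' V' act'"
proof
  have irr: "irreducible_rep sc V act" and sm: "smooth_rep val sc V act"
    using assms(3) by (auto simp: supersingular_def)
  interpret rep_pair val p sc V act sc' V' act'
    by unfold_locales (use assms sm in auto)
  interpret FV: fun_pair val p sc V act by (rule A.fun_pair)
  obtain x where x: "A.good_vector x" using FV.ex_good_vector[OF assms(3)] by blast
  show "Hom Borel sc V act sc' V' act' \<subseteq> Hom GL2 sc V act sc' V' act'"
    using Borel_Hom_equivariant[OF _ x irr] by blast
  have "(Borel :: 'f mat2 set) \<subseteq> GL2" by (auto simp: Borel_def)
  then show "Hom GL2 sc V act sc' V' act' \<subseteq> Hom Borel sc V act sc' V' act'"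
    by (auto simp: Hom_def equivariant_on_def)
qed

end
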